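(* Let $\{X_E:E\in\mathcal{B}_0\}$ be a free Poisson random measure (with $\alpha=1$) in a $W^*$-probability space $(\mathcal{A},\varphi)$, and let $f\in L^{\infty-}:=\bigcap_{n\ge1}L^n(\mathbb{R})$ be a real-valued function. If $X_E\ge0$ for all $E\in\mathcal{B}_0$, then $X(f)\in\bigcap_{n=1}^\infty L^n(\mathcal{A},\varphi)$, and $X(f)$ has a compound free Poisson distribution: $$\kappa_m(X(f))=\int_{\mathbb{R}}f(x)^m\,dx,\qquad m=1,2,\dots.$$
   Context: A $W^*$-probability space $(\mathcal{A},\varphi)$ is a finite von Neumann algebra with a faithful normal tracial state; $\|a\|_p=\varphi(|a|^p)^{1/p}$, and $L^p(\mathcal{A},\varphi)$ is the completion of $\mathcal{A}$ in $\|\cdot\|_p$, $p\ge1$. $\kappa_n(a):=\kappa_n(a,\dots,a)$ denotes the $n$-th free cumulant, determined by the moments $\varphi(a^j)$, $j\le n$, through the free moment-cumulant formula (also for $a\in\bigcap_nL^n(\mathcal{A},\varphi)$). Compound free Poisson distribution: for a compactly supported probability measure $\nu$ on $\mathbb{R}$ and $\lambda\ge0$, a probability measure $\mu$ on $\mathbb{R}$ is called a compound free Poisson distribution with rate $\lambda$ and jump distribution $\nu$ if its $n$-th free cumulant is $\kappa_n(\mu)=\lambda m_n(\nu)$ for all $n\ge1$, where $m_n(\nu)$ is the $n$-th moment of $\nu$. An element has a compound free Poisson distribution if its distribution is of this kind. Free Poisson random measure (with $\alpha=1$): a map $E\mapsto X_E$ from the set $\mathcal{B}_0$ of Borel subsets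 of $\mathbb{R}$ of finite Lebesgue measure $|E|$ into the self-adjoint elements of $\mathcal{A}$ such that (1) $\kappa_n(X_E)=|E|$ for all $n\ge1$; (2) if $E_1,\dots,E_k$ are mutually disjoint, then $X_{E_1},\dots,X_{E_k}$ are freely independent; (3) if $E_1,\dots,E_k$ are mutually disjoint, then $X_{\cup_{i=1}^kE_i}=\sum_{i=1}^kX_{E_i}$. Integral: for a simple function $s=\sum_{i=1}^nc_i\chi_{E_i}$ with $E_i\in\mathcal{B}_0$ mutually disjoint, $X(s)=\sum_{i=1}^nc_iX_{E_i}$. For $f\in L^2(\mathbb{R})$ whose support $S_f$ has finite measure, $X(f)$ is the $\|\cdot\|_2$-limit of $X(s_n)$ for any sequence of simple functions $s_n$ supported in $S_f$ with $\|s_n-f\|_2\to0$. For real-valued $f\in L^1(\mathbb{R})\cap L^2(\mathbb{R})$, $X(f):=\lim_{t\to\infty}X(f\chi_{[-t,t]})$ in $\|\cdot\|_2$ (this limit exists).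
   Formalization: The cumulant formula is proved for all f; a compound free Poisson law with finite rate and compactly supported jump distribution is claimed only for essentially bounded f with support of finite measure, as it fails otherwise (e.g. f(x)=exp(-x) for x>0, f=0 elsewhere). *)

theory Defs
  imports "HOL-Probability.Probability" "HOL-Library.Disjoint_Sets"
begin

section \<open>Complex Hilbert spaces and their bounded operators\<close>

text \<open>
  The norm, metric and topology come from the underlying real inner product, which is
  the real part of the complex one.  The complex inner product is linear on the left.
\<close>

class complex_hilbert = real_inner + complete_space +
  fixes cscale :: "complex \<Rightarrow> 'a \<Rightarrow> 'a"
    and cinner :: "'a \<Rightarrow> 'a \<Rightarrow> complex"
  assumes cscale_add_right: "cscale c (x + y) = cscale c x + cscale c y"
    and cscale_add_left: "cscale (c + d) x = cscale c x + cscale d x"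
    and cscale_cscale: "cscale c (cscale d x) = cscale (c * d) x"
    and cscale_of_real: "cscale (complex_of_real r) x = r *\<^sub>R x"
    and cinner_add_left: "cinner (x + y) z = cinner x z + cinner y z"
    and cinner_cscale_left: "cinner (cscale c x) y = c * cinner x y"
    and cinner_commute: "cinner x y = cnj (cinner y x)"
    and Re_cinner: "Re (cinner x y) = inner x y"

lemma norm_cscale: "norm (cscale c x) = cmod c * norm (x :: 'a :: complex_hilbert)"
proof -
  have "cinner (cscale c x) (cscale c x) = c * cnj (cinner (cscale c x) x)"
    by (metis cinner_commute cinner_cscale_left)
  also have "\<dots> = (c * cnj c) * cnj (cinner x x)"
    by (simp add: cinner_cscale_left)
  also have "\<dots> = of_real ((cmod c)\<^sup>2) * cnj (cinner x x)"
    by (simp only: complex_norm_square [symmetric] of_real_power)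
  finally have "Re (cinner (cscale c x) (cscale c x)) = (cmod c)\<^sup>2 * Re (cinner x x)"
    by simp
  then have "(norm (cscale c x))\<^sup>2 = (cmod c * norm x)\<^sup>2"
    by (simp add: Re_cinner dot_square_norm power_mult_distrib)
  then show ?thesis
    by (simp add: power2_eq_iff_nonneg)
qed

lemma bounded_linear_cscale: "bounded_linear (cscale c :: 'a :: complex_hilbert \<Rightarrow> 'a)"
proof (rule bounded_linear_intro[where K = "cmod c"])
  show "cscale c (r *\<^sub>R x) = r *\<^sub>R cscale c x" for r and x :: 'a
    by (metis cscale_cscale cscale_of_real mult.commute)
qed (simp_all add: cscale_add_right norm_cscale mult.commute)

text \<open>
  The type \<open>'h \<Rightarrow>\<^sub>L 'h\<close> consists of the bounded real-linear maps; \<open>B(H)\<close> is the set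
  of the complex-linear ones.
\<close>

type_synonym 'h op = "'h \<Rightarrow>\<^sub>L 'h"

definition bounded_ops :: "'h::complex_hilbert op set" where
  "bounded_ops = {a. \<forall>c x. blinfun_apply a (cscale c x) = cscale c (blinfun_apply a x)}"

lift_definition op_cscale :: "complex \<Rightarrow> 'h::complex_hilbert op \<Rightarrow> 'h op"
  is "\<lambda>c a x. cscale c (a x)"
  by (rule bounded_linear_compose[OF bounded_linear_cscale])

definition adj :: "'h::complex_hilbert op \<Rightarrow> 'h op" where
  "adj a = (THE b. \<forall>x y. cinner (blinfun_apply a x) y = cinner x (blinfun_apply b y))"

definition op_pow :: "'h::complex_hilbert op \<Rightarrow> nat \<Rightarrow> 'h op" where
  "op_pow a n = (((o\<^sub>L) a) ^^ n) id_blinfun"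

definition op_positive :: "'h::complex_hilbert op \<Rightarrow> bool" where
  "op_positive a \<longleftrightarrow> a \<in> bounded_ops \<and>
     (\<forall>x. Im (cinner (blinfun_apply a x) x) = 0 \<and> 0 \<le> Re (cinner (blinfun_apply a x) x))"

definition op_abs :: "'h::complex_hilbert op \<Rightarrow> 'h op" where
  "op_abs a = (THE b. op_positive b \<and> b o\<^sub>L b = adj a o\<^sub>L a)"

section \<open>\<open>W\<^sup>*\<close>-probability spaces\<close>

definition commutant :: "'h::complex_hilbert op set \<Rightarrow> 'h op set" where
  "commutant S = {b \<in> bounded_ops. \<forall>a\<in>S. b o\<^sub>L a = a o\<^sub>L b}"

text \<open>
  That \<open>M\<close> is a unital algebra follows from its being a commutant.
\<close>

definition von_neumann_algebra :: "'h::complex_hilbert op set \<Rightarrow> bool" where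
  "von_neumann_algebra M \<longleftrightarrow>
     M \<subseteq> bounded_ops \<and> (\<forall>a\<in>M. adj a \<in> M) \<and> commutant (commutant M) = M"

definition finite_von_neumann_algebra :: "'h::complex_hilbert op set \<Rightarrow> bool" where
  "finite_von_neumann_algebra M \<longleftrightarrow> von_neumann_algebra M \<and>
     (\<forall>u\<in>M. adj u o\<^sub>L u = id_blinfun \<longrightarrow> u o\<^sub>L adj u = id_blinfun)"

definition selfadjoint_part :: "'h::complex_hilbert op set \<Rightarrow> 'h op set" where
  "selfadjoint_part M = {a \<in> M. adj a = a}"

definition op_le :: "'h::complex_hilbert op \<Rightarrow> 'h op \<Rightarrow> bool" where
  "op_le a b \<longleftrightarrow> op_positive (b - a)"

text \<open>
  Normality: \<open>\<phi>\<close> preserves suprema of bounded increasing nets of self-adjoint elements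
  (nets are replaced by upward directed sets).
\<close>

definition normal_on :: "'h::complex_hilbert op set \<Rightarrow> ('h op \<Rightarrow> complex) \<Rightarrow> bool" where
  "normal_on M \<phi> \<longleftrightarrow>
     (\<forall>D s. D \<noteq> {} \<longrightarrow> D \<subseteq> selfadjoint_part M \<longrightarrow>
        (\<forall>a\<in>D. \<forall>b\<in>D. \<exists>c\<in>D. op_le a c \<and> op_le b c) \<longrightarrow>
        s \<in> selfadjoint_part M \<longrightarrow> (\<forall>a\<in>D. op_le a s) \<longrightarrow>
        (\<forall>t\<in>selfadjoint_part M. (\<forall>a\<in>D. op_le a t) \<longrightarrow> op_le s t) \<longrightarrow>
        Re (\<phi> s) = (SUP a\<in>D. Re (\<phi> a)))"

locale wstar_probability_space =
  fixes M :: "'h::complex_hilbert op set"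
    and \<phi> :: "'h op \<Rightarrow> complex"
  assumes finite_vn: "finite_von_neumann_algebra M"
    and add: "a \<in> M \<Longrightarrow> b \<in> M \<Longrightarrow> \<phi> (a + b) = \<phi> a + \<phi> b"
    and scale: "a \<in> M \<Longrightarrow> \<phi> (op_cscale c a) = c * \<phi> a"
    and unital: "\<phi> id_blinfun = 1"
    and positive: "a \<in> M \<Longrightarrow> op_positive a \<Longrightarrow> Im (\<phi> a) = 0 \<and> 0 \<le> Re (\<phi> a)"
    and faithful: "a \<in> M \<Longrightarrow> op_positive a \<Longrightarrow> \<phi> a = 0 \<Longrightarrow> a = 0"
    and tracial: "a \<in> M \<Longrightarrow> b \<in> M \<Longrightarrow> \<phi> (a o\<^sub>L b) = \<phi> (b o\<^sub>L a)"
    and normal: "normal_on M \<phi>"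

section \<open>The spaces \<open>L\<^sup>p(M, \<phi>)\<close>\<close>

text \<open>
  Only integer exponents \<open>p \<ge> 1\<close> are needed.
\<close>

definition nc_norm :: "('h::complex_hilbert op \<Rightarrow> complex) \<Rightarrow> nat \<Rightarrow> 'h op \<Rightarrow> real" where
  "nc_norm \<phi> p a = root p (Re (\<phi> (op_pow (op_abs a) p)))"

definition nc_Cauchy ::
    "'h::complex_hilbert op set \<Rightarrow> ('h op \<Rightarrow> complex) \<Rightarrow> nat \<Rightarrow> (nat \<Rightarrow> 'h op) \<Rightarrow> bool" where
  "nc_Cauchy M \<phi> p u \<longleftrightarrow> (\<forall>k. u k \<in> M) \<and>
     (\<forall>\<epsilon>>0. \<exists>N. \<forall>m\<ge>N. \<forall>n\<ge>N. nc_norm \<phi> p (u m - u n) < \<epsilon>)"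

text \<open>
  The completion of \<open>M\<close> in the 1-norm consists of classes of Cauchy sequences.  For
  \<open>p \<ge> 1\<close> the canonical map from the completion in the \<open>p\<close>-norm to the one in the 1-norm is
  injective, and \<open>L\<^sup>p\<close> is taken to be its image, so that all the \<open>L\<^sup>p\<close> are subsets of
  \<open>L\<^sup>1\<close>: an element lies in \<open>L\<^sup>p\<close> iff some sequence representing it is Cauchy in the \<open>p\<close>-norm.
\<close>

type_synonym 'h nc_elem = "(nat \<Rightarrow> 'h op) set"

definition nc_class ::
    "'h::complex_hilbert op set \<Rightarrow> ('h op \<Rightarrow> complex) \<Rightarrow> (nat \<Rightarrow> 'h op) \<Rightarrow> 'h nc_elem" where
  "nc_class M \<phi> u = {v. nc_Cauchy M \<phi> 1 v \<and> (\<lambda>k. nc_norm \<phi> 1 (u k - v k)) \<longlonglongrightarrow> 0}"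

definition nc_Lp ::
    "'h::complex_hilbert op set \<Rightarrow> ('h op \<Rightarrow> complex) \<Rightarrow> nat \<Rightarrow> 'h nc_elem set" where
  "nc_Lp M \<phi> p = {nc_class M \<phi> u | u. nc_Cauchy M \<phi> p u}"

definition nc_embed ::
    "'h::complex_hilbert op set \<Rightarrow> ('h op \<Rightarrow> complex) \<Rightarrow> 'h op \<Rightarrow> 'h nc_elem" where
  "nc_embed M \<phi> a = nc_class M \<phi> (\<lambda>_. a)"

text \<open>Meaningful for \<open>x\<close> and \<open>y\<close> in \<open>L\<^sup>p\<close>; the limit does not depend on the representatives.\<close>

definition nc_dist ::
    "'h::complex_hilbert op set \<Rightarrow> ('h op \<Rightarrow> complex) \<Rightarrow> nat \<Rightarrow> 'h nc_elem \<Rightarrow> 'h nc_elem \<Rightarrow> real" where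
  "nc_dist M \<phi> p x y = (THE d. \<forall>u\<in>x. \<forall>v\<in>y. nc_Cauchy M \<phi> p u \<longrightarrow> nc_Cauchy M \<phi> p v \<longrightarrow>
     (\<lambda>k. nc_norm \<phi> p (u k - v k)) \<longlonglongrightarrow> d)"

text \<open>
  The moment \<open>\<phi>(x\<^sup>j)\<close> of an element \<open>x\<close> of the intersection of all \<open>L\<^sup>p\<close>: the limit of
  \<open>\<phi>(u\<^sub>k\<^sup>j)\<close> along sequences in \<open>M\<close> converging to \<open>x\<close> in every \<open>p\<close>-norm.
\<close>

definition nc_moment ::
    "'h::complex_hilbert op set \<Rightarrow> ('h op \<Rightarrow> complex) \<Rightarrow> 'h nc_elem \<Rightarrow> nat \<Rightarrow> complex" where
  "nc_moment M \<phi> x j = (THE c. \<forall>u\<in>x. (\<forall>p\<ge>1. nc_Cauchy M \<phi> p u) \<longrightarrow>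
     (\<lambda>k. \<phi> (op_pow (u k) j)) \<longlonglongrightarrow> c)"

section \<open>Free cumulants and freeness\<close>

definition noncrossing_partitions :: "nat \<Rightarrow> nat set set set" where
  "noncrossing_partitions n = {P. partition_on {1..n} P \<and>
     \<not> (\<exists>B\<in>P. \<exists>C\<in>P. B \<noteq> C \<and>
         (\<exists>a b c d. a < b \<and> b < c \<and> c < d \<and> a \<in> B \<and> b \<in> C \<and> c \<in> B \<and> d \<in> C))}"

text \<open>
  The free cumulant sequence of a moment sequence \<open>m\<close>, the unique solution of the free
  moment-cumulant formula.  The entry at \<open>0\<close> is a dummy.
\<close>

definition free_cumulants :: "(nat \<Rightarrow> complex) \<Rightarrow> nat \<Rightarrow> complex" where
  "free_cumulants m = (THE \<kappa>. \<kappa> 0 = 0 \<and>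
     (\<forall>n\<ge>1. m n = (\<Sum>P\<in>noncrossing_partitions n. \<Prod>B\<in>P. \<kappa> (card B))))"

definition op_cumulant :: "('h::complex_hilbert op \<Rightarrow> complex) \<Rightarrow> 'h op \<Rightarrow> nat \<Rightarrow> complex" where
  "op_cumulant \<phi> a = free_cumulants (\<lambda>j. \<phi> (op_pow a j))"

definition nc_cumulant ::
    "'h::complex_hilbert op set \<Rightarrow> ('h op \<Rightarrow> complex) \<Rightarrow> 'h nc_elem \<Rightarrow> nat \<Rightarrow> complex" where
  "nc_cumulant M \<phi> x = free_cumulants (nc_moment M \<phi> x)"

inductive_set star_algebra :: "'h::complex_hilbert op \<Rightarrow> 'h op set" for a where
  one: "id_blinfun \<in> star_algebra a"
| gen: "a \<in> star_algebra a"
| add: "b \<in> star_algebra a \<Longrightarrow> c \<in> star_algebra a \<Longrightarrow> b + c \<in> star_algebra a"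
| scale: "b \<in> star_algebra a \<Longrightarrow> op_cscale z b \<in> star_algebra a"
| mult: "b \<in> star_algebra a \<Longrightarrow> c \<in> star_algebra a \<Longrightarrow> b o\<^sub>L c \<in> star_algebra a"
| star: "b \<in> star_algebra a \<Longrightarrow> adj b \<in> star_algebra a"

text \<open>
  Freeness of the family \<open>(x i)\<close>, \<open>i \<in> I\<close>: products of centred elements of the generated
  algebras have trace zero as soon as consecutive factors have distinct indices.
\<close>

definition freely_independent ::
    "('h::complex_hilbert op \<Rightarrow> complex) \<Rightarrow> 'i set \<Rightarrow> ('i \<Rightarrow> 'h op) \<Rightarrow> bool" where
  "freely_independent \<phi> I x \<longleftrightarrow>
     (\<forall>is as. is \<noteq> [] \<longrightarrow> set is \<subseteq> I \<longrightarrow> distinct_adj is \<longrightarrow>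
        list_all2 (\<lambda>i a. a \<in> star_algebra (x i) \<and> \<phi> a = 0) is as \<longrightarrow>
        \<phi> (foldr (o\<^sub>L) as id_blinfun) = 0)"

text \<open>
  The compound free Poisson distribution with rate \<open>r\<close> and (compactly supported) jump
  distribution \<open>\<nu>\<close>; the free cumulants of the distribution of an element are those of the
  element.  An element has a distribution on the real line if it is self-adjoint, i.e. a
  limit of self-adjoint elements of \<open>M\<close>.
\<close>

definition has_compound_free_poisson_distribution ::
    "'h::complex_hilbert op set \<Rightarrow> ('h op \<Rightarrow> complex) \<Rightarrow> 'h nc_elem \<Rightarrow> real \<Rightarrow> real measure \<Rightarrow> bool" where
  "has_compound_free_poisson_distribution M \<phi> x r \<nu> \<longleftrightarrow>
     x \<in> (\<Inter>n\<in>{1..}. nc_Lp M \<phi> n) \<and> (\<exists>u\<in>x. \<forall>k. adj (u k) = u k) \<and>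
     0 \<le> r \<and> prob_space \<nu> \<and> sets \<nu> = sets borel \<and>
     (\<exists>K. compact K \<and> emeasure \<nu> (- K) = 0) \<and>
     (\<forall>n\<ge>1. nc_cumulant M \<phi> x n = complex_of_real (r * (\<integral>t. t ^ n \<partial>\<nu>)))"

section \<open>Free Poisson random measures and the integral\<close>

definition finite_borel_sets :: "real set set" where
  "finite_borel_sets = {E \<in> sets borel. emeasure lborel E < \<infinity>}"

locale free_poisson_random_measure = wstar_probability_space M \<phi>
  for M :: "'h::complex_hilbert op set" and \<phi> :: "'h op \<Rightarrow> complex" +
  fixes X :: "real set \<Rightarrow> 'h op"
  assumes selfadjoint: "E \<in> finite_borel_sets \<Longrightarrow> X E \<in> selfadjoint_part M"
    and cumulants: "E \<in> finite_borel_sets \<Longrightarrow> n \<ge> 1 \<Longrightarrow>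
          op_cumulant \<phi> (X E) n = complex_of_real (measure lborel E)"
    and free: "k \<ge> 1 \<Longrightarrow> (\<forall>i\<in>{1..k::nat}. F i \<in> finite_borel_sets) \<Longrightarrow>
          disjoint_family_on F {1..k} \<Longrightarrow> freely_independent \<phi> {1..k} (\<lambda>i. X (F i))"
    and additive: "k \<ge> 1 \<Longrightarrow> (\<forall>i\<in>{1..k::nat}. F i \<in> finite_borel_sets) \<Longrightarrow>
          disjoint_family_on F {1..k} \<Longrightarrow> X (\<Union>i\<in>{1..k}. F i) = (\<Sum>i\<in>{1..k}. X (F i))"

definition L_norm :: "nat \<Rightarrow> (real \<Rightarrow> real) \<Rightarrow> real" where
  "L_norm p f = root p (\<integral>x. \<bar>f x\<bar> ^ p \<partial>lebesgue)"

definition L_space :: "nat \<Rightarrow> (real \<Rightarrow> real) set" where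
  "L_space p = {f \<in> borel_measurable lebesgue. integrable lebesgue (\<lambda>x. \<bar>f x\<bar> ^ p)}"

text \<open>
  The integral of a simple function is computed from its level sets; any other
  representation by disjoint sets of finite measure gives the same value by additivity.
  The level set of \<open>0\<close>, on which \<open>X\<close> is unspecified, contributes \<open>0\<close>.
\<close>

definition integral_simple :: "(real set \<Rightarrow> 'h::complex_hilbert op) \<Rightarrow> (real \<Rightarrow> real) \<Rightarrow> 'h op" where
  "integral_simple X s = (\<Sum>c\<in>range s. c *\<^sub>R X {x. s x = c})"

text \<open>
  For a square integrable \<open>f\<close> such that \<open>{t. f t \<noteq> 0}\<close> has finite measure: the 2-norm limit,
  common to all approximating sequences of simple functions supported in that set.
\<close>

definition integral_finite_support ::
    "'h::complex_hilbert op set \<Rightarrow> ('h op \<Rightarrow> complex) \<Rightarrow> (real set \<Rightarrow> 'h op) \<Rightarrow> (real \<Rightarrow> real) \<Rightarrow> 'h nc_elem" where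
  "integral_finite_support M \<phi> X f = (THE x. x \<in> nc_Lp M \<phi> 2 \<and>
     (\<forall>s. (\<forall>n. simple_function lborel (s n) \<and> emeasure lborel {t. s n t \<noteq> 0} < \<infinity> \<and>
              {t. s n t \<noteq> 0} \<subseteq> {t. f t \<noteq> 0}) \<longrightarrow>
        (\<lambda>n. L_norm 2 (\<lambda>t. s n t - f t)) \<longlonglongrightarrow> 0 \<longrightarrow>
        (\<lambda>n. nc_dist M \<phi> 2 (nc_embed M \<phi> (integral_simple X (s n))) x) \<longlonglongrightarrow> 0))"

text \<open>Only meaningful for \<open>f\<close> in \<open>L\<^sup>1(\<real>) \<inter> L\<^sup>2(\<real>)\<close>.\<close>

definition free_poisson_integral ::
    "'h::complex_hilbert op set \<Rightarrow> ('h op \<Rightarrow> complex) \<Rightarrow> (real set \<Rightarrow> 'h op) \<Rightarrow> (real \<Rightarrow> real) \<Rightarrow> 'h nc_elem" where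
  "free_poisson_integral M \<phi> X f = (THE x. x \<in> nc_Lp M \<phi> 2 \<and>
     ((\<lambda>t. nc_dist M \<phi> 2 (integral_finite_support M \<phi> X (\<lambda>y. f y * indicator {-t..t} y)) x)
        \<longlongrightarrow> 0) at_top)"

end

theory Submission
  imports Defs "HOL-Computational_Algebra.Formal_Power_Series"
begin

text \<open>
  For a simple function \<open>s\<close> with disjoint level sets the summands of \<open>X(s)\<close> are free, so
  additivity of free cumulants gives \<open>\<kappa>\<^sub>m(X(s)) = \<integral> s\<^sup>m\<close>.  Additivity itself is obtained
  by formal power series: if \<open>C\<close> generates the free cumulants of \<open>Y\<close>, then \<open>(C(z) - z Y)\<^sup>-\<^sup>1\<close> has
  trace \<open>1\<close>, and for free summands these resolvents combine through alternating products of centred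
  elements.

  Now let simple functions \<open>s\<^sub>k\<close>, dominated by \<open>2 |f|\<close>, converge to \<open>f\<close>.  By the moment-cumulant
  formula the moments of \<open>X(s\<^sub>k) - X(s\<^sub>l)\<close> are polynomials in the integrals
  \<open>\<integral> (s\<^sub>k - s\<^sub>l)\<^sup>m\<close>, which tend to \<open>0\<close>; hence \<open>X(s\<^sub>k)\<close> is Cauchy in every \<open>L\<^sup>p\<close>, its limit
  is \<open>X(f)\<close>, and the cumulants converge.  That moments and distances do not depend on the chosen
  representatives rests on a noncommutative Hoelder inequality for exponents \<open>2\<^sup>m\<close> and on the
  duality of \<open>L\<^sup>1\<close> with the operator norm.
\<close>

section \<open>Adjoints\<close>

text \<open>Adjoint, absolute value, distance, moment, cumulant and integral are definite
  descriptions, so each needs existence and uniqueness before anything can be computed. The operator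
  theory rests on the Riesz representation, a norm-convergent iteration for square roots and the
  Neumann series. Inequalities for the trace are proved where powers of the absolute value can be
  avoided: for the exponents 2, 4, 8, ..., where they are powers of
  \<open>adj a o\<^sub>L a\<close>, and for the exponent 1, by duality. Every other exponent p is
  reached by bounding the p-norm through the moment of order 2p, which for self-adjoint elements is
  a polynomial in the cumulants.

  Since elements are classes of 1-norm Cauchy sequences while the integral is a 2-norm limit, its
  uniqueness depends on the injectivity of the map from L^2 to L^1.\<close>

instance complex_hilbert \<subseteq> banach ..

lemma quadratic_nonneg_imp_zero:
  fixes b c :: real
  \<comment> \<open>The first-order condition for a quadratic polynomial that is minimal at t = 0;
    it turns minimality into orthogonality.\<close>
  assumes "\<And>t. 0 \<le> 2 * t * b + t\<^sup>2 * c" and "0 \<le> c"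
  shows "b = 0"
proof -
  \<comment> \<open>Nearly the minimiser - b / c; the added 1 keeps it defined for c = 0.\<close>
  have "0 \<le> 2 * (- b / (c + 1)) * b + (- b / (c + 1))\<^sup>2 * c"
    by (rule assms(1))
  also have "\<dots> = - (b\<^sup>2 * (c + 2)) / (c + 1)\<^sup>2"
  proof -
    have "c + 1 \<noteq> 0" using assms(2) by simp
    then show ?thesis
      by (simp add: divide_simps power2_eq_square) (simp add: algebra_simps)
  qed
  finally have "b\<^sup>2 * (c + 2) \<le> 0"
    using assms(2) by (simp add: divide_le_0_iff zero_le_divide_iff)
  then show ?thesis
    using assms(2) by (simp add: mult_le_0_iff)
qed

text \<open>The representing vector z is the minimiser of \<open>J\<close>, because
  \<open>J x\<close> is the squared distance of x and z up to a constant; completeness provides the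
  minimiser.\<close>

lemma riesz_representation:
  fixes f :: "'a::{real_inner,complete_space} \<Rightarrow> real"
  assumes "bounded_linear f"
  shows "\<exists>z. \<forall>x. f x = inner x z"
proof -
  interpret f: bounded_linear f by fact
  obtain K where K: "\<And>x. norm (f x) \<le> norm x * K" and "0 \<le> K"
    using f.nonneg_bounded by blast
  define J where "J x = inner x x - 2 * f x" for x
  have "- K\<^sup>2 \<le> J x" for x
  proof -
    have "f x \<le> norm x * K" using K[of x] by simp
    moreover have "0 \<le> (norm x - K)\<^sup>2" by simp
    ultimately show ?thesis
      by (simp add: J_def dot_square_norm power2_diff)
  qed
  then have bdd: "bdd_below (range J)" by (intro bdd_belowI2)
  define m where "m = (INF x. J x)"
  have m_le: "m \<le> J x" for x
    unfolding m_def by (rule cINF_lower[OF bdd]) simp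
  have "\<exists>x. J x < m + inverse (real (Suc n))" for n
    using cINF_less_iff[OF _ bdd, of "m + inverse (real (Suc n))"] by (auto simp: m_def)
  then obtain u where u: "\<And>n. J (u n) < m + inverse (real (Suc n))" by metis
  \<comment> \<open>The parallelogram law for \<open>J\<close>: the linear part cancels, so
    near-minimisers are close to each other.\<close>
  have par: "(norm (x - y))\<^sup>2 = 2 * J x + 2 * J y - 4 * J ((1/2) *\<^sub>R (x + y))" for x y
    by (simp add: J_def f.scaleR f.add power2_norm_eq_inner inner_add_left inner_add_right
        inner_diff_left inner_diff_right inner_commute algebra_simps)
  have dist_u: "(norm (u p - u q))\<^sup>2 \<le> 2 * inverse (real (Suc p)) + 2 * inverse (real (Suc q))" for p q
    using par[of "u p" "u q"] u[of p] u[of q] m_le[of "(1/2) *\<^sub>R (u p + u q)"] by linarith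
  have "Cauchy u"
  proof (rule CauchyI)
    fix e :: real assume "0 < e"
    then obtain N where N: "inverse (real (Suc N)) < e\<^sup>2 / 4"
      using reals_Archimedean[of "e\<^sup>2 / 4"] by auto
    show "\<exists>N. \<forall>p\<ge>N. \<forall>q\<ge>N. norm (u p - u q) < e"
    proof (intro exI allI impI)
      fix p q assume "N \<le> p" "N \<le> q"
      then have "inverse (real (Suc p)) \<le> inverse (real (Suc N))"
        "inverse (real (Suc q)) \<le> inverse (real (Suc N))"
        by simp_all
      then have "(norm (u p - u q))\<^sup>2 < e\<^sup>2"
        using dist_u[of p q] N by linarith
      then show "norm (u p - u q) < e"
        using \<open>0 < e\<close> power_less_imp_less_base[of _ 2 e] by auto
    qed
  qed
  then obtain z where z: "u \<longlonglongrightarrow> z"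
    using Cauchy_convergent convergent_def by blast
  have "(\<lambda>n. J (u n)) \<longlonglongrightarrow> J z"
    unfolding J_def by (intro tendsto_intros z f.tendsto)
  moreover have "(\<lambda>n. m + inverse (real (Suc n))) \<longlonglongrightarrow> m + 0"
    by (intro tendsto_intros LIMSEQ_inverse_real_of_nat)
  ultimately have "J z \<le> m + 0"
    by (rule LIMSEQ_le) (use u less_imp_le in blast)
  then have "J z \<le> J x" for x using m_le[of x] by simp
  have "f h = inner h z" for h
  proof -
    have "0 \<le> 2 * t * (inner z h - f h) + t\<^sup>2 * inner h h" for t
      using \<open>J z \<le> J (z + t *\<^sub>R h)\<close>
      by (simp add: J_def f.add f.scaleR inner_add_left inner_add_right inner_commute
          power2_eq_square algebra_simps)
    then have "inner z h - f h = 0" by (rule quadratic_nonneg_imp_zero) simp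
    then show ?thesis by (simp add: inner_commute)
  qed
  then show ?thesis by blast
qed

lemma ext_inner:
  assumes "\<And>x. inner x u = inner x v"
  shows "u = (v :: 'a::real_inner)"
  using assms[of "u - v"] by (metis inner_diff_right inner_eq_zero_iff right_minus_eq)

lemma real_adjoint_exists:
  fixes a :: "'a::{real_inner,complete_space} \<Rightarrow>\<^sub>L 'a"
  shows "\<exists>b :: 'a \<Rightarrow>\<^sub>L 'a. \<forall>x y. inner (a x) y = inner x (b y)"
proof -
  have "\<exists>z. \<forall>x. inner (a x) y = inner x z" for y
  proof (rule riesz_representation)
    show "bounded_linear (\<lambda>x. inner (a x) y)"
      by (intro bounded_linear_intros)
  qed
  then obtain b where b: "\<And>x y. inner (a x) y = inner x (b y)" by metis
  have "bounded_linear b"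
  proof (rule bounded_linear_intro)
    show "b (x + y) = b x + b y" for x y
      by (rule ext_inner) (simp add: b[symmetric] inner_add_right)
    show "b (r *\<^sub>R x) = r *\<^sub>R b x" for r x
      by (rule ext_inner) (simp add: b[symmetric])
    show "norm (b x) \<le> norm x * norm a" for x
    proof (cases "b x = 0")
      case False
      have "norm (b x) * norm (b x) = inner (a (b x)) x"
        by (simp add: b flip: power2_norm_eq_inner power2_eq_square)
      also have "\<dots> \<le> norm (a (b x)) * norm x"
        by (rule norm_cauchy_schwarz)
      also have "\<dots> \<le> (norm a * norm (b x)) * norm x"
        by (intro mult_right_mono norm_blinfun) simp
      finally have "norm (b x) * norm (b x) \<le> (norm x * norm a) * norm (b x)"
        by (simp add: algebra_simps)
      then show ?thesis using False by simp
    qed simp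
  qed
  then show ?thesis
    by (intro exI[of _ "Blinfun b"]) (simp add: b bounded_linear_Blinfun_apply)
qed

text \<open>Since Re (- i c) = Im c, the real inner product determines the complex one, and complex
  identities reduce to real ones.\<close>

lemma Im_cinner: "Im (cinner x y) = inner (cscale (- \<i>) x) (y :: 'a::complex_hilbert)"
  by (simp add: cinner_cscale_left flip: Re_cinner)

lemma cinner_eqI:
  assumes "inner x y = inner z w" and "inner (cscale (- \<i>) x) y = inner (cscale (- \<i>) z) w"
  shows "cinner x y = cinner z (w :: 'a::complex_hilbert)"
  using assms by (simp add: complex_eq_iff Re_cinner Im_cinner)

lemma bounded_opsD: "a \<in> bounded_ops \<Longrightarrow> a (cscale c x) = cscale c (a x)"
  by (simp add: bounded_ops_def)

lemma adj_equality:
  assumes "\<And>x y. cinner (blinfun_apply a x) y = cinner x (blinfun_apply b y)"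
  shows "adj a = b"
  unfolding adj_def
proof (rule the_equality)
  fix c assume "\<forall>x y. cinner (blinfun_apply a x) y = cinner x (blinfun_apply c y)"
  then have "inner x (blinfun_apply c y) = inner x (blinfun_apply b y)" for x y
    using assms by (metis Re_cinner)
  then show "c = b" by (metis blinfun_eqI ext_inner)
qed (simp add: assms)

text \<open>The adjoint for the real inner product is also the complex one, because a complex linear
  operator commutes with multiplication by - i.\<close>

lemma cinner_adj:
  fixes a :: "'h::complex_hilbert op"
  assumes "a \<in> bounded_ops"
  shows "cinner (a x) y = cinner x (adj a y)"
proof -
  obtain b :: "'h op" where b: "\<And>x y. inner (a x) y = inner x (b y)"
    using real_adjoint_exists[of a] by blast
  have eq: "cinner (a x) y = cinner x (b y)" for x y
    by (rule cinner_eqI) (simp_all add: b bounded_opsD[OF assms, symmetric])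
  then have "adj a = b" by (rule adj_equality)
  with eq show ?thesis by simp
qed

lemma inner_adj: "a \<in> bounded_ops \<Longrightarrow> inner (a x) y = inner x (adj a y)"
  using cinner_adj[of a x y] by (metis Re_cinner)

lemma inner_adj': "a \<in> bounded_ops \<Longrightarrow> inner x (a y) = inner (adj a x) y"
  by (metis inner_adj inner_commute)

lemma cinner_cscale_right: "cinner x (cscale c y) = cnj c * cinner x (y :: 'a::complex_hilbert)"
  by (metis cinner_commute cinner_cscale_left complex_cnj_mult)

lemma cinner_add_right: "cinner x (y + z) = cinner x y + cinner x (z :: 'a::complex_hilbert)"
  by (metis cinner_commute cinner_add_left complex_cnj_add)

lemma adj_equality_inner:
  assumes "a \<in> bounded_ops"
    and "\<And>x y. inner (blinfun_apply a x) y = inner x (blinfun_apply b y)"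
  shows "adj a = b"
  by (metis assms blinfun_eqI ext_inner inner_adj)

section \<open>The algebra of bounded operators and its involution\<close>

interpretation compose: bounded_bilinear "(o\<^sub>L) :: 'a::real_normed_vector \<Rightarrow>\<^sub>L 'a \<Rightarrow> 'a \<Rightarrow>\<^sub>L 'a \<Rightarrow> _"
  by (rule bounded_bilinear_blinfun_compose)

lemma compose_assoc: "(a o\<^sub>L b) o\<^sub>L c = a o\<^sub>L (b o\<^sub>L c)"
  by (rule blinfun_eqI) simp

lemma compose_id [simp]: "id_blinfun o\<^sub>L a = a" "a o\<^sub>L id_blinfun = a"
  by (rule blinfun_eqI, simp)+

lemma op_cscale_apply [simp]: "op_cscale c a x = cscale c (a x)"
  by transfer simp

lemma cscale_diff_right: "cscale c (x - y) = cscale c x - cscale c (y :: 'a::complex_hilbert)"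
  by (simp add: bounded_linear.linear[OF bounded_linear_cscale] linear_diff)

lemma cscale_zero [simp]: "cscale c 0 = (0 :: 'a::complex_hilbert)"
  using cscale_diff_right[of c 0 0] by simp

lemma cscale_scaleR: "cscale c (r *\<^sub>R x) = r *\<^sub>R cscale c (x :: 'a::complex_hilbert)"
  by (simp add: bounded_linear.linear[OF bounded_linear_cscale] linear_scale)

lemma op_cscale_of_real: "op_cscale (complex_of_real r) a = r *\<^sub>R a"
  by (rule blinfun_eqI) (simp add: cscale_of_real scaleR_blinfun.rep_eq)

lemma bounded_ops_intros:
  shows "id_blinfun \<in> bounded_ops" and "0 \<in> bounded_ops"
    and "a \<in> bounded_ops \<Longrightarrow> b \<in> bounded_ops \<Longrightarrow> a + b \<in> bounded_ops"
    and "a \<in> bounded_ops \<Longrightarrow> b \<in> bounded_ops \<Longrightarrow> a - b \<in> bounded_ops"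
    and "a \<in> bounded_ops \<Longrightarrow> b \<in> bounded_ops \<Longrightarrow> a o\<^sub>L b \<in> bounded_ops"
    and "a \<in> bounded_ops \<Longrightarrow> r *\<^sub>R a \<in> bounded_ops"
    and "a \<in> bounded_ops \<Longrightarrow> op_cscale c a \<in> bounded_ops"
  by (auto simp: bounded_ops_def plus_blinfun.rep_eq minus_blinfun.rep_eq scaleR_blinfun.rep_eq
      cscale_add_right cscale_diff_right cscale_scaleR cscale_cscale mult.commute)

lemma adj_simps:
  assumes "a \<in> bounded_ops"
  shows "adj (r *\<^sub>R a) = r *\<^sub>R adj a" and "adj (op_cscale c a) = op_cscale (cnj c) (adj a)"
    and "b \<in> bounded_ops \<Longrightarrow> adj (a + b) = adj a + adj b"
    and "b \<in> bounded_ops \<Longrightarrow> adj (a - b) = adj a - adj b"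
    and "b \<in> bounded_ops \<Longrightarrow> adj (a o\<^sub>L b) = adj b o\<^sub>L adj a"
proof -
  show "adj (r *\<^sub>R a) = r *\<^sub>R adj a"
    by (rule adj_equality_inner) (simp_all add: assms bounded_ops_intros scaleR_blinfun.rep_eq inner_adj)
  show "adj (op_cscale c a) = op_cscale (cnj c) (adj a)"
    by (rule adj_equality) (simp add: cinner_cscale_left cinner_cscale_right cinner_adj assms)
  assume b: "b \<in> bounded_ops"
  show "adj (a + b) = adj a + adj b"
    by (rule adj_equality_inner)
      (simp_all add: assms b bounded_ops_intros plus_blinfun.rep_eq inner_adj inner_add_left inner_add_right)
  show "adj (a - b) = adj a - adj b"
    by (rule adj_equality_inner)
      (simp_all add: assms b bounded_ops_intros minus_blinfun.rep_eq inner_adj inner_diff_left inner_diff_right)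
  show "adj (a o\<^sub>L b) = adj b o\<^sub>L adj a"
    by (rule adj_equality_inner) (simp_all add: assms b bounded_ops_intros inner_adj)
qed

lemma adj_id [simp]: "adj id_blinfun = id_blinfun"
  by (rule adj_equality) simp

lemma adj_in_bounded_ops:
  assumes "a \<in> bounded_ops"
  shows "adj a \<in> bounded_ops"
  unfolding bounded_ops_def
proof (intro CollectI allI, rule ext_inner)
  fix c x y
  have "cinner y (adj a (cscale c x)) = cinner y (cscale c (adj a x))"
    by (metis cinner_adj[OF assms] cinner_cscale_right)
  then show "inner y (adj a (cscale c x)) = inner y (cscale c (adj a x))"
    by (metis Re_cinner)
qed

lemma adj_adj: "a \<in> bounded_ops \<Longrightarrow> adj (adj a) = a"
  by (rule adj_equality_inner) (simp_all add: adj_in_bounded_ops inner_adj')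

lemma norm_adj_le:
  assumes "a \<in> bounded_ops"
  shows "norm (adj a) \<le> norm a"
proof (rule norm_blinfun_bound)
  fix x
  show "norm (adj a x) \<le> norm a * norm x"
  proof (cases "adj a x = 0")
    case False
    have "norm (adj a x) * norm (adj a x) = inner (a (adj a x)) x"
      by (simp add: inner_adj assms flip: power2_norm_eq_inner power2_eq_square)
    also have "\<dots> \<le> norm (a (adj a x)) * norm x"
      by (rule norm_cauchy_schwarz)
    also have "\<dots> \<le> (norm a * norm (adj a x)) * norm x"
      by (intro mult_right_mono norm_blinfun) simp
    finally have "norm (adj a x) * norm (adj a x) \<le> (norm a * norm x) * norm (adj a x)"
      by (simp add: algebra_simps)
    then show ?thesis using False by simp
  qed simp
qed simp

section \<open>Positive operators and their square roots\<close>

lemma op_positiveD: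
  assumes "op_positive a"
  shows "a \<in> bounded_ops" and "inner (a x) y = inner x (a y)" and "0 \<le> inner (a x) x"
    and "adj a = a" and "0 \<le> inner x (a x)"
proof -
  show a: "a \<in> bounded_ops" using assms by (simp add: op_positive_def)
  have Im0: "Im (cinner (a x) x) = 0" for x using assms by (simp add: op_positive_def)
  show "0 \<le> inner (a x) x" using assms by (simp add: op_positive_def Re_cinner)
  then show "0 \<le> inner x (a x)" by (simp add: inner_commute)
  have sym: "inner (a x) y = inner x (a y)" for x y
  proof -
    \<comment> \<open>Polarisation at x + i y: the quadratic form is real, so the imaginary parts of
      the two cross terms cancel, and this is symmetry for the real inner product.\<close>
    let ?y = "cscale \<i> y"
    have "cinner (a (x + ?y)) (x + ?y) =
        cinner (a x) x + cinner (a ?y) ?y + (- \<i>) * cinner (a x) y + \<i> * cinner (a y) x"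
      by (simp add: blinfun.add_right cinner_add_left cinner_add_right cinner_cscale_left
          cinner_cscale_right bounded_opsD[OF a] algebra_simps)
    from arg_cong[OF this, of Im] have "Re (cinner (a y) x) = Re (cinner (a x) y)"
      by (simp add: Im0)
    then show ?thesis by (simp add: Re_cinner inner_commute)
  qed
  then show "inner (a x) y = inner x (a y)" .
  show "adj a = a" by (rule adj_equality_inner[OF a sym])
qed

lemma op_positiveI:
  fixes a :: "'h::complex_hilbert op"
  assumes a: "a \<in> bounded_ops" and sym: "\<And>x y. inner (a x) y = inner x (a y)"
    and pos: "\<And>x. 0 \<le> inner (a x) x"
  shows "op_positive a"
  unfolding op_positive_def
proof (intro conjI allI a)
  fix x
  have "cinner (a x) x = cinner x (a x)"
    by (rule cinner_eqI) (simp_all add: sym bounded_opsD[OF a, symmetric])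
  then have "cinner (a x) x = cnj (cinner (a x) x)" by (metis cinner_commute)
  from arg_cong[OF this, of Im] show "Im (cinner (a x) x) = 0" by simp
  show "0 \<le> Re (cinner (a x) x)" by (simp add: Re_cinner pos)
qed

lemma op_positive_cauchy_schwarz:
  assumes "op_positive a"
  shows "(inner (a x) y)\<^sup>2 \<le> inner (a x) x * inner (a y) y"
proof -
  note sym = op_positiveD(2)[OF assms] and pos = op_positiveD(3)[OF assms]
  have *: "0 \<le> inner (a x) x + 2 * t * inner (a x) y + t\<^sup>2 * inner (a y) y" for t
    using pos[of "x + t *\<^sub>R y"] sym[of x y]
    by (simp add: blinfun.add_right blinfun.scaleR_right inner_add_left inner_add_right
        inner_commute power2_eq_square algebra_simps)
  show ?thesis
  proof (cases "inner (a y) y = 0")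
    case True
    show ?thesis
    proof (cases "inner (a x) y = 0")
      case False
      \<comment> \<open>An affine function that is nonnegative everywhere has slope 0; at this t it
        would take the value - 1.\<close>
      from *[of "- (inner (a x) x + 1) / (2 * inner (a x) y)"] True False show ?thesis
        by (simp add: field_simps)
    qed (simp add: True)
  next
    case False
    then have "0 < inner (a y) y" using pos[of y] by simp
    with *[of "- inner (a x) y / inner (a y) y"] show ?thesis
      by (simp add: field_simps power2_eq_square)
  qed
qed

lemma op_positive_zero:
  assumes "op_positive a" and "inner (a x) x = 0"
  shows "a x = 0"
  using op_positive_cauchy_schwarz[OF assms(1), of x "a x"] assms(2) by simp

text \<open>Cauchy-Schwarz for the form of a, applied to x and a x, upgrades a bound on the
  quadratic form to a bound on the norm.\<close>

lemma op_positive_norm_le: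
  fixes a :: "'h::complex_hilbert op"
  assumes "op_positive a" and "\<And>x. inner (a x) x \<le> (norm x)\<^sup>2"
  shows "norm a \<le> 1"
proof (rule norm_blinfun_bound)
  fix x
  have "(inner (a x) (a x))\<^sup>2 \<le> inner (a x) x * inner (a (a x)) (a x)"
    by (rule op_positive_cauchy_schwarz[OF assms(1)])
  also have "\<dots> \<le> (norm x)\<^sup>2 * (norm (a x))\<^sup>2"
    by (intro mult_mono assms)
      (simp_all add: op_positiveD(3)[OF assms(1)] power2_norm_eq_inner)
  finally have "(norm (a x) * norm (a x))\<^sup>2 \<le> (norm x * norm (a x))\<^sup>2"
    by (simp add: dot_square_norm power2_eq_square mult_ac)
  then have "norm (a x) * norm (a x) \<le> norm x * norm (a x)"
    by (rule power2_le_imp_le) simp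
  then show "norm (a x) \<le> 1 * norm x"
    by (cases "a x = 0") simp_all
qed simp

text \<open>Complex linearity is itself a commutation property; hence whatever commutes with
  everything that commutes with a complex linear operator is complex linear.\<close>

lemma bounded_ops_iff_commute:
  "a \<in> bounded_ops \<longleftrightarrow> (\<forall>c. op_cscale c id_blinfun o\<^sub>L a = a o\<^sub>L op_cscale c id_blinfun)"
proof
  assume "a \<in> bounded_ops"
  then show "\<forall>c. op_cscale c id_blinfun o\<^sub>L a = a o\<^sub>L op_cscale c id_blinfun"
    by (intro allI blinfun_eqI) (simp add: bounded_opsD)
next
  assume *: "\<forall>c. op_cscale c id_blinfun o\<^sub>L a = a o\<^sub>L op_cscale c id_blinfun"
  have "a (cscale c x) = cscale c (a x)" for c x
    using arg_cong[OF spec[OF *, of c], of "\<lambda>b. blinfun_apply b x"] by simp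
  then show "a \<in> bounded_ops" by (simp add: bounded_ops_def)
qed

text \<open>
  The iterates increase to \<open>1 - sqrt (1 - x)\<close>; as polynomials in \<open>x\<close> with nonnegative coefficients
  they are controlled in norm by the scalar iteration with \<open>x = 1\<close>.
\<close>

fun sqrt_iter :: "'a::real_normed_vector \<Rightarrow>\<^sub>L 'a \<Rightarrow> nat \<Rightarrow> 'a \<Rightarrow>\<^sub>L 'a" where
  "sqrt_iter x 0 = 0"
| "sqrt_iter x (Suc n) = (1/2) *\<^sub>R (x + (sqrt_iter x n o\<^sub>L sqrt_iter x n))"

fun sqrt_iter_one :: "nat \<Rightarrow> real" where
  "sqrt_iter_one 0 = 0"
| "sqrt_iter_one (Suc n) = (1 + (sqrt_iter_one n)\<^sup>2) / 2"

lemma sqrt_iter_one_bounds: "0 \<le> sqrt_iter_one n" "sqrt_iter_one n \<le> 1"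
proof -
  have "0 \<le> sqrt_iter_one n \<and> sqrt_iter_one n \<le> 1"
  proof (induction n)
    case (Suc n)
    then have "(sqrt_iter_one n)\<^sup>2 \<le> 1" by (simp add: power_le_one)
    with Suc show ?case by simp
  qed simp
  then show "0 \<le> sqrt_iter_one n" "sqrt_iter_one n \<le> 1" by auto
qed

lemma sqrt_iter_one_mono: "sqrt_iter_one n \<le> sqrt_iter_one (Suc n)"
proof -
  have "0 \<le> (sqrt_iter_one n - 1)\<^sup>2" by simp
  then show ?thesis by (simp add: power2_diff)
qed

lemma sqrt_iter_commute:
  assumes "T o\<^sub>L x = x o\<^sub>L T"
  shows "T o\<^sub>L sqrt_iter x n = sqrt_iter x n o\<^sub>L T"
proof (induction n)
  case (Suc n)
  then have "T o\<^sub>L (sqrt_iter x n o\<^sub>L sqrt_iter x n) = (sqrt_iter x n o\<^sub>L sqrt_iter x n) o\<^sub>L T"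
    by (metis compose_assoc)
  with assms show ?case
    by (simp add: compose.add_left compose.add_right compose.scaleR_left compose.scaleR_right)
qed (simp add: compose.zero_left compose.zero_right)

lemma norm_sqrt_iter:
  assumes "norm x \<le> 1"
  shows "norm (sqrt_iter x n) \<le> sqrt_iter_one n"
proof (induction n)
  case (Suc n)
  have "norm (x + (sqrt_iter x n o\<^sub>L sqrt_iter x n)) \<le> norm x + norm (sqrt_iter x n) * norm (sqrt_iter x n)"
    by (intro order_trans[OF norm_triangle_ineq] add_left_mono norm_blinfun_compose)
  also have "\<dots> \<le> 1 + sqrt_iter_one n * sqrt_iter_one n"
    by (intro add_mono mult_mono assms Suc) (simp_all add: sqrt_iter_one_bounds)
  finally show ?case by (simp add: power2_eq_square)
qed simp

text \<open>The iterates commute, so the difference of two squares factors. The scalar iteration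
  satisfies the same identity, hence its telescoping increments dominate those of the
  operators.\<close>

lemma norm_sqrt_iter_step:
  assumes "norm x \<le> 1"
  shows "norm (sqrt_iter x (Suc n) - sqrt_iter x n) \<le> sqrt_iter_one (Suc n) - sqrt_iter_one n"
proof (induction n)
  case 0
  then show ?case using assms by simp
next
  case (Suc n)
  let ?y = "sqrt_iter x n" and ?z = "sqrt_iter x (Suc n)"
  let ?s = "sqrt_iter_one n" and ?t = "sqrt_iter_one (Suc n)"
  have "?y o\<^sub>L x = x o\<^sub>L ?y" by (rule sqrt_iter_commute[symmetric]) simp
  then have comm: "?y o\<^sub>L ?z = ?z o\<^sub>L ?y" by (rule sqrt_iter_commute)
  have "sqrt_iter x (Suc (Suc n)) - ?z = (1/2) *\<^sub>R ((?z o\<^sub>L ?z) - (?y o\<^sub>L ?y))"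
    by (simp only: sqrt_iter.simps(2) scaleR_diff_right scaleR_add_right add_diff_cancel_left)
  also have "(?z o\<^sub>L ?z) - (?y o\<^sub>L ?y) = (?z - ?y) o\<^sub>L (?z + ?y)"
    by (simp only: compose.add_right compose.diff_left comm) simp
  finally have "norm (sqrt_iter x (Suc (Suc n)) - ?z) = (1/2) * norm ((?z - ?y) o\<^sub>L (?z + ?y))"
    by simp
  also have "\<dots> \<le> (1/2) * ((?t - ?s) * (?t + ?s))"
    by (intro mult_left_mono order_trans[OF norm_blinfun_compose] mult_mono Suc
        order_trans[OF norm_triangle_ineq] add_mono norm_sqrt_iter assms)
      (use sqrt_iter_one_mono[of n] in simp_all)
  also have "\<dots> = sqrt_iter_one (Suc (Suc n)) - ?t"
    by (simp only: sqrt_iter_one.simps(2)[of "Suc n"]) (simp add: power2_eq_square field_simps)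
  finally show ?case .
qed

lemma sqrt_iter_Cauchy:
  fixes x :: "'a::real_normed_vector \<Rightarrow>\<^sub>L 'a"
  assumes "norm x \<le> 1"
  shows "Cauchy (sqrt_iter x)"
proof -
  have "incseq sqrt_iter_one" by (rule incseq_SucI) (rule sqrt_iter_one_mono)
  then have "convergent sqrt_iter_one"
    by (intro Bseq_mono_convergent BseqI'[of _ 1]) (simp_all add: sqrt_iter_one_bounds incseq_def)
  then have Ct: "Cauchy sqrt_iter_one" by (rule convergent_Cauchy)
  have step: "norm (sqrt_iter x (n + k) - sqrt_iter x n) \<le> sqrt_iter_one (n + k) - sqrt_iter_one n" for n k
  proof (induction k)
    case (Suc k)
    have "norm (sqrt_iter x (n + Suc k) - sqrt_iter x n) \<le>
        norm (sqrt_iter x (Suc (n + k)) - sqrt_iter x (n + k)) + norm (sqrt_iter x (n + k) - sqrt_iter x n)"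
      by (rule order_trans[OF _ norm_triangle_ineq]) simp
    with Suc norm_sqrt_iter_step[OF assms, of "n + k"] show ?case by simp
  qed simp
  have le: "norm (sqrt_iter x p - sqrt_iter x q) \<le> \<bar>sqrt_iter_one p - sqrt_iter_one q\<bar>" for p q
  proof (cases "q \<le> p")
    case True
    then show ?thesis using step[of q "p - q"] by simp
  next
    case False
    then show ?thesis using step[of p "q - p"] by (simp add: norm_minus_commute)
  qed
  show ?thesis
  proof (rule CauchyI)
    fix e :: real assume "0 < e"
    with Ct obtain N where "\<forall>p\<ge>N. \<forall>q\<ge>N. norm (sqrt_iter_one p - sqrt_iter_one q) < e"
      by (metis CauchyD)
    with le show "\<exists>N. \<forall>p\<ge>N. \<forall>q\<ge>N. norm (sqrt_iter x p - sqrt_iter x q) < e"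
      by (metis order_le_less_trans real_norm_def)
  qed
qed

lemma symmetric_sqrt_iter:
  fixes x :: "'a::real_inner \<Rightarrow>\<^sub>L 'a"
  assumes "\<And>u v. inner (x u) v = inner u (x v)"
  shows "inner (sqrt_iter x n u) v = inner u (sqrt_iter x n v)"
  by (induction n arbitrary: u v)
    (simp_all add: assms plus_blinfun.rep_eq scaleR_blinfun.rep_eq inner_add_left inner_add_right)

text \<open>For x = 1 - a the limit y of the iteration satisfies x + y^2 = 2 y, that is (1 - y)^2 =
  a. The commutation clause is inherited from the iterates; it later yields both uniqueness of the
  root and its membership in the von Neumann algebra.\<close>

lemma op_positive_commute_sqrt_contraction:
  fixes a :: "'h::complex_hilbert op"
  assumes a: "op_positive a" and le: "\<And>x. inner (a x) x \<le> (norm x)\<^sup>2"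
  shows "\<exists>b. op_positive b \<and> b o\<^sub>L b = a \<and> (\<forall>T. T o\<^sub>L a = a o\<^sub>L T \<longrightarrow> T o\<^sub>L b = b o\<^sub>L T)"
proof -
  note aD = op_positiveD[OF a]
  define x where "x = id_blinfun - a"
  have x_apply: "x u = u - a u" for u by (simp add: x_def minus_blinfun.rep_eq)
  have xpos: "op_positive x"
    by (rule op_positiveI)
      (simp_all add: x_def bounded_ops_intros aD(1,2) minus_blinfun.rep_eq inner_diff_left inner_diff_right
        le[unfolded aD(2)] flip: power2_norm_eq_inner)
  have nx: "norm x \<le> 1"
    by (rule op_positive_norm_le[OF xpos]) (simp add: x_apply inner_diff_left aD(3) power2_norm_eq_inner)
  obtain y where y: "sqrt_iter x \<longlonglongrightarrow> y"
    using sqrt_iter_Cauchy[OF nx] by (metis Cauchy_convergent convergent_def)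
  have "(\<lambda>n. sqrt_iter x (Suc n)) \<longlonglongrightarrow> (1/2) *\<^sub>R (x + (y o\<^sub>L y))"
    unfolding sqrt_iter.simps by (intro tendsto_intros y compose.tendsto)
  then have "(1/2) *\<^sub>R (x + (y o\<^sub>L y)) = y"
    using LIMSEQ_Suc[OF y] LIMSEQ_unique by blast
  then have fixpt: "x + (y o\<^sub>L y) = 2 *\<^sub>R y"
    by (metis (no_types) divide_self_if mult.commute numeral_One scaleR_one scaleR_scaleR
        times_divide_eq_left zero_neq_numeral mult_1)
  have "norm y \<le> 1"
  proof (rule LIMSEQ_le_const2[OF tendsto_norm[OF y]])
    show "\<exists>N. \<forall>n\<ge>N. norm (sqrt_iter x n) \<le> 1"
      using norm_sqrt_iter[OF nx] sqrt_iter_one_bounds(2) order_trans by blast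
  qed
  have ycomm: "T o\<^sub>L y = y o\<^sub>L T" if "T o\<^sub>L a = a o\<^sub>L T" for T
  proof -
    have "T o\<^sub>L x = x o\<^sub>L T"
      using that by (simp add: x_def compose.diff_left compose.diff_right)
    then have eq: "T o\<^sub>L sqrt_iter x n = sqrt_iter x n o\<^sub>L T" for n
      by (rule sqrt_iter_commute)
    have "(\<lambda>n. T o\<^sub>L sqrt_iter x n) \<longlonglongrightarrow> (T o\<^sub>L y)"
      by (intro compose.tendsto tendsto_const y)
    moreover have "(\<lambda>n. T o\<^sub>L sqrt_iter x n) \<longlonglongrightarrow> (y o\<^sub>L T)"
      unfolding eq by (intro compose.tendsto tendsto_const y)
    ultimately show ?thesis by (rule LIMSEQ_unique)
  qed
  have yapp: "(\<lambda>n. sqrt_iter x n u) \<longlonglongrightarrow> y u" for u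
    by (intro tendsto_intros y)
  have ysym: "inner (y u) v = inner u (y v)" for u v
  proof (rule LIMSEQ_unique)
    show "(\<lambda>n. inner (sqrt_iter x n u) v) \<longlonglongrightarrow> inner (y u) v"
      by (intro tendsto_intros yapp)
    show "(\<lambda>n. inner (sqrt_iter x n u) v) \<longlonglongrightarrow> inner u (y v)"
      unfolding symmetric_sqrt_iter[OF op_positiveD(2)[OF xpos]] by (intro tendsto_intros yapp)
  qed
  have ybd: "y \<in> bounded_ops"
    using aD(1) ycomm by (simp add: bounded_ops_iff_commute)
  define b where "b = id_blinfun - y"
  have "op_positive b"
  proof (rule op_positiveI)
    show "b \<in> bounded_ops" by (simp add: b_def ybd bounded_ops_intros)
    show "inner (b u) v = inner u (b v)" for u v
      by (simp add: b_def minus_blinfun.rep_eq inner_diff_left inner_diff_right ysym)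
    show "0 \<le> inner (b u) u" for u
    proof -
      have "inner (y u) u \<le> norm (y u) * norm u" by (rule norm_cauchy_schwarz)
      also have "\<dots> \<le> (norm y * norm u) * norm u"
        by (intro mult_right_mono norm_blinfun) simp
      also have "\<dots> \<le> (1 * norm u) * norm u"
        by (intro mult_right_mono \<open>norm y \<le> 1\<close>) simp_all
      finally show ?thesis
        by (simp add: b_def minus_blinfun.rep_eq inner_diff_left flip: power2_norm_eq_inner power2_eq_square)
    qed
  qed
  moreover have "b o\<^sub>L b = a"
  proof -
    have "b o\<^sub>L b = id_blinfun - 2 *\<^sub>R y + (y o\<^sub>L y)"
      by (simp add: b_def compose.diff_left compose.diff_right scaleR_2)
    also have "\<dots> = a" using fixpt by (simp add: x_def algebra_simps)
    finally show ?thesis .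
  qed
  moreover have "T o\<^sub>L b = b o\<^sub>L T" if "T o\<^sub>L a = a o\<^sub>L T" for T
    using ycomm[OF that] by (simp add: b_def compose.diff_left compose.diff_right)
  ultimately show ?thesis by blast
qed

lemma op_positive_scaleR: "op_positive a \<Longrightarrow> 0 \<le> r \<Longrightarrow> op_positive (r *\<^sub>R a)"
  by (rule op_positiveI) (simp_all add: bounded_ops_intros scaleR_blinfun.rep_eq op_positiveD)

lemma op_positive_add: "op_positive a \<Longrightarrow> op_positive b \<Longrightarrow> op_positive (a + b)"
  by (rule op_positiveI)
    (simp_all add: bounded_ops_intros plus_blinfun.rep_eq inner_add_left inner_add_right op_positiveD)

lemma op_positive_sqrt:
  fixes a :: "'h::complex_hilbert op"
  assumes a: "op_positive a"
  shows "\<exists>b. op_positive b \<and> b o\<^sub>L b = a \<and> (\<forall>T. T o\<^sub>L a = a o\<^sub>L T \<longrightarrow> T o\<^sub>L b = b o\<^sub>L T)"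
proof -
  \<comment> \<open>Rescales to a contraction; the added 1 keeps K positive for a = 0.\<close>
  define K where "K = norm a + 1"
  have "0 < K" by (simp add: K_def add_nonneg_pos)
  have le: "inner ((inverse K *\<^sub>R a) x) x \<le> (norm x)\<^sup>2" for x
  proof -
    have "inner (a x) x \<le> norm (a x) * norm x" by (rule norm_cauchy_schwarz)
    also have "\<dots> \<le> (norm a * norm x) * norm x"
      by (intro mult_right_mono norm_blinfun) simp
    also have "\<dots> \<le> (K * norm x) * norm x"
      by (intro mult_right_mono) (simp_all add: K_def)
    finally show ?thesis
      using \<open>0 < K\<close> by (simp add: scaleR_blinfun.rep_eq field_simps power2_eq_square)
  qed
  have "op_positive (inverse K *\<^sub>R a)"
    using a \<open>0 < K\<close> by (intro op_positive_scaleR) simp_all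
  from op_positive_commute_sqrt_contraction[OF this le] obtain b where
    b: "op_positive b" "b o\<^sub>L b = inverse K *\<^sub>R a"
    and comm: "\<And>T. T o\<^sub>L (inverse K *\<^sub>R a) = (inverse K *\<^sub>R a) o\<^sub>L T \<Longrightarrow> T o\<^sub>L b = b o\<^sub>L T"
    by blast
  show ?thesis
  proof (intro exI[of _ "sqrt K *\<^sub>R b"] conjI allI impI)
    show "op_positive (sqrt K *\<^sub>R b)"
      using b \<open>0 < K\<close> by (intro op_positive_scaleR) simp_all
    show "(sqrt K *\<^sub>R b) o\<^sub>L (sqrt K *\<^sub>R b) = a"
      using \<open>0 < K\<close> by (simp add: compose.scaleR_left compose.scaleR_right b flip: mult.assoc)
    fix T assume "T o\<^sub>L a = a o\<^sub>L T"
    then show "T o\<^sub>L (sqrt K *\<^sub>R b) = (sqrt K *\<^sub>R b) o\<^sub>L T"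
      using comm[of T] by (simp add: compose.scaleR_left compose.scaleR_right)
  qed
qed

text \<open>As b and c commute, (b + c)(b - c) = 0. For y = (b - c) x the forms of b and c at y add
  up to 0, so both vanish, b y = c y = 0, and moving b - c across the inner product gives y =
  0.\<close>

lemma op_positive_sqrt_unique:
  fixes a :: "'h::complex_hilbert op"
  assumes "op_positive b" and "op_positive c" and "b o\<^sub>L b = c o\<^sub>L c"
    and comm: "b o\<^sub>L c = c o\<^sub>L b"
  shows "b = c"
proof (rule blinfun_eqI)
  fix x
  let ?y = "b x - c x"
  have "b (b x) = c (c x)" "b (c x) = c (b x)"
    using assms(3) comm by (metis blinfun_apply_blinfun_compose)+
  then have "b ?y + c ?y = 0" by (simp add: blinfun.diff_right)
  then have "inner (b ?y) ?y + inner (c ?y) ?y = 0"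
    by (metis inner_add_left inner_zero_left)
  then have "inner (b ?y) ?y = 0" "inner (c ?y) ?y = 0"
    using op_positiveD(3)[OF assms(1), of ?y] op_positiveD(3)[OF assms(2), of ?y] by linarith+
  then have "b ?y = 0" "c ?y = 0" using assms(1,2) op_positive_zero by blast+
  then have "inner ?y ?y = 0"
    by (metis (no_types) assms(1,2) inner_diff_left inner_zero_right op_positiveD(2) diff_self)
  then show "b x = c x" by simp
qed

lemma op_positive_adj_compose:
  assumes "a \<in> bounded_ops"
  shows "op_positive (adj a o\<^sub>L a)"
proof (rule op_positiveI)
  show "adj a o\<^sub>L a \<in> bounded_ops"
    by (simp add: assms bounded_ops_intros adj_in_bounded_ops)
  show "inner ((adj a o\<^sub>L a) x) y = inner x ((adj a o\<^sub>L a) y)" for x y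
    by (simp add: inner_adj'[OF assms, symmetric] inner_adj[OF assms, symmetric])
  show "0 \<le> inner ((adj a o\<^sub>L a) x) x" for x
    by (simp add: inner_adj'[OF assms, symmetric])
qed

lemma op_abs_props:
  fixes a :: "'h::complex_hilbert op"
  assumes "a \<in> bounded_ops"
  shows "op_positive (op_abs a)" and "op_abs a o\<^sub>L op_abs a = adj a o\<^sub>L a"
    and "T o\<^sub>L (adj a o\<^sub>L a) = (adj a o\<^sub>L a) o\<^sub>L T \<Longrightarrow> T o\<^sub>L op_abs a = op_abs a o\<^sub>L T"
proof -
  obtain b where b: "op_positive b" "b o\<^sub>L b = adj a o\<^sub>L a"
    and comm: "\<And>T. T o\<^sub>L (adj a o\<^sub>L a) = (adj a o\<^sub>L a) o\<^sub>L T \<Longrightarrow> T o\<^sub>L b = b o\<^sub>L T"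
    using op_positive_sqrt[OF op_positive_adj_compose[OF assms]] by blast
  have "op_abs a = b"
    unfolding op_abs_def
  proof (rule the_equality)
    \<comment> \<open>Any competing root commutes with its own square, hence with b, so uniqueness
      among commuting roots suffices.\<close>
    fix c assume c: "op_positive c \<and> c o\<^sub>L c = adj a o\<^sub>L a"
    then have "c o\<^sub>L (adj a o\<^sub>L a) = (adj a o\<^sub>L a) o\<^sub>L c" by (metis compose_assoc)
    then have "c o\<^sub>L b = b o\<^sub>L c" by (rule comm)
    with b c show "c = b" using op_positive_sqrt_unique[of c b] by auto
  qed (simp add: b)
  note eq = this
  show "op_positive (op_abs a)" "op_abs a o\<^sub>L op_abs a = adj a o\<^sub>L a"
    by (simp_all only: eq b)
  show "T o\<^sub>L op_abs a = op_abs a o\<^sub>L T" if "T o\<^sub>L (adj a o\<^sub>L a) = (adj a o\<^sub>L a) o\<^sub>L T"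
    unfolding eq by (rule comm[OF that])
qed

section \<open>Powers of operators and inverses by the Neumann series\<close>

lemma op_pow_0 [simp]: "op_pow a 0 = id_blinfun"
  by (simp add: op_pow_def)

lemma op_pow_Suc: "op_pow a (Suc n) = a o\<^sub>L op_pow a n"
  by (simp add: op_pow_def)

lemma op_pow_add: "op_pow a (m + n) = op_pow a m o\<^sub>L op_pow a n"
  by (induction m) (simp_all add: op_pow_Suc compose_assoc)

lemma op_pow_1 [simp]: "op_pow a (Suc 0) = a"
  by (simp add: op_pow_Suc)

lemma op_pow_Suc_right: "op_pow a (Suc n) = op_pow a n o\<^sub>L a"
  using op_pow_add[of a n 1] by simp

lemma op_pow_2: "op_pow a 2 = a o\<^sub>L a"
  by (simp add: numeral_2_eq_2 op_pow_Suc)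

lemma op_pow_mult: "op_pow a (m * n) = op_pow (op_pow a m) n"
  by (induction n) (simp_all add: op_pow_Suc op_pow_add)

lemma op_pow_scaleR: "op_pow (r *\<^sub>R a) n = r ^ n *\<^sub>R op_pow a n"
  by (induction n) (simp_all add: op_pow_Suc compose.scaleR_left compose.scaleR_right mult.commute)

lemma norm_op_pow_le:
  fixes a :: "'h::complex_hilbert op"
  shows "norm (op_pow a n) \<le> norm a ^ n"
proof (induction n)
  case 0
  show ?case using norm_blinfun_id_le[where 'a='h] by simp
next
  case (Suc n)
  then show ?case
    by (simp add: op_pow_Suc order_trans[OF norm_blinfun_compose] mult_left_mono)
qed

lemma neumann_inverse:
  fixes x :: "'h::complex_hilbert op"
  assumes "norm x < 1"
  shows "\<exists>s. (id_blinfun - x) o\<^sub>L s = id_blinfun \<and> s o\<^sub>L (id_blinfun - x) = id_blinfun"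
proof -
  have sm: "summable (\<lambda>n. op_pow x n)"
  proof (rule summable_comparison_test)
    show "\<exists>N. \<forall>n\<ge>N. norm (op_pow x n) \<le> norm x ^ n" using norm_op_pow_le by blast
    show "summable (\<lambda>n. norm x ^ n)" using assms by (intro summable_geometric) simp
  qed
  define s where "s = (\<Sum>n. op_pow x n)"
  have split: "s = id_blinfun + (\<Sum>n. op_pow x (Suc n))"
    unfolding s_def using suminf_split_head[OF sm] by simp
  have "x o\<^sub>L s = (\<Sum>n. op_pow x (Suc n))"
    unfolding s_def op_pow_Suc
    by (rule bounded_linear.suminf[OF compose.bounded_linear_right sm])
  moreover have "s o\<^sub>L x = (\<Sum>n. op_pow x (Suc n))"
    unfolding s_def op_pow_Suc_right
    by (rule bounded_linear.suminf[OF compose.bounded_linear_left sm])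
  ultimately show ?thesis
    using split by (intro exI[of _ s]) (simp add: compose.diff_left compose.diff_right)
qed

text \<open>With K = norm a + e one has a + e = K (1 - x) for x = (norm a - a) / K. Positivity of a
  bounds the norm of norm a - a by norm a, which is less than K.\<close>

lemma op_positive_shift_inverse:
  fixes a :: "'h::complex_hilbert op"
  assumes a: "op_positive a" and "0 < e"
  shows "\<exists>s. (a + e *\<^sub>R id_blinfun) o\<^sub>L s = id_blinfun \<and> s o\<^sub>L (a + e *\<^sub>R id_blinfun) = id_blinfun"
proof -
  define T where "T = a + e *\<^sub>R id_blinfun"
  define K where "K = norm a + e"
  have "e \<le> K" "0 < K" using \<open>0 < e\<close> by (simp_all add: K_def add_nonneg_pos)
  define x where "x = inverse K *\<^sub>R (norm a *\<^sub>R id_blinfun - a)"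
  have "op_positive (norm a *\<^sub>R id_blinfun - a)"
  proof (rule op_positiveI)
    show "0 \<le> inner ((norm a *\<^sub>R id_blinfun - a) u) u" for u
    proof -
      have "inner (a u) u \<le> norm (a u) * norm u" by (rule norm_cauchy_schwarz)
      also have "\<dots> \<le> (norm a * norm u) * norm u"
        by (intro mult_right_mono norm_blinfun) simp
      finally show ?thesis
        by (simp add: minus_blinfun.rep_eq scaleR_blinfun.rep_eq inner_diff_left mult.assoc
            flip: power2_norm_eq_inner power2_eq_square)
    qed
  qed (simp_all add: bounded_ops_intros op_positiveD(1,2)[OF a] minus_blinfun.rep_eq
      scaleR_blinfun.rep_eq inner_diff_left inner_diff_right)
  note pos = this
  have "norm x < 1"
  proof (cases "norm a = 0")
    case False
    have "norm (inverse (norm a) *\<^sub>R (norm a *\<^sub>R id_blinfun - a)) \<le> 1"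
    proof (rule op_positive_norm_le)
      show "op_positive (inverse (norm a) *\<^sub>R (norm a *\<^sub>R id_blinfun - a))"
        by (intro op_positive_scaleR pos) simp
      show "inner ((inverse (norm a) *\<^sub>R (norm a *\<^sub>R id_blinfun - a)) u) u \<le> (norm u)\<^sup>2" for u
        using False op_positiveD(3)[OF a, of u]
        by (simp add: minus_blinfun.rep_eq scaleR_blinfun.rep_eq inner_diff_left
            field_simps flip: power2_norm_eq_inner)
    qed
    then have "inverse (norm a) * norm (norm a *\<^sub>R id_blinfun - a) \<le> 1"
      by (simp only: norm_scaleR abs_inverse abs_norm_cancel)
    then have "norm (norm a *\<^sub>R id_blinfun - a) \<le> norm a"
      using False by (simp add: field_simps)
    also have "\<dots> < K" using \<open>0 < e\<close> by (simp add: K_def)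
    finally show ?thesis
      using \<open>0 < K\<close> unfolding x_def norm_scaleR by (simp add: field_simps)
  qed (simp add: x_def)
  then obtain s where s: "(id_blinfun - x) o\<^sub>L s = id_blinfun" "s o\<^sub>L (id_blinfun - x) = id_blinfun"
    using neumann_inverse by blast
  have "T = K *\<^sub>R (id_blinfun - x)"
  proof -
    have "K *\<^sub>R x = norm a *\<^sub>R id_blinfun - a" using \<open>0 < K\<close> by (simp add: x_def)
    then show ?thesis by (simp add: scaleR_diff_right T_def K_def scaleR_add_left)
  qed
  then have "T o\<^sub>L (inverse K *\<^sub>R s) = id_blinfun" "(inverse K *\<^sub>R s) o\<^sub>L T = id_blinfun"
    using s \<open>0 < K\<close> by (simp_all add: compose.scaleR_left compose.scaleR_right)
  then show ?thesis unfolding T_def by blast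
qed

section \<open>The trace: Cauchy-Schwarz and Hoelder inequalities\<close>

abbreviation op_prod :: "'h::complex_hilbert op list \<Rightarrow> 'h op" where
  "op_prod xs \<equiv> foldr (o\<^sub>L) xs id_blinfun"

lemma op_prod_append: "op_prod (xs @ ys) = op_prod xs o\<^sub>L op_prod ys"
  by (induction xs) (simp_all add: compose_assoc)

lemma op_prod_replicate: "op_prod (replicate n a) = op_pow a n"
  by (induction n) (simp_all add: op_pow_Suc)

lemma op_prod_replicate_pair:
  "op_prod (concat (replicate n [a, b])) = op_pow (a o\<^sub>L b) n"
  by (induction n) (simp_all add: op_pow_Suc compose_assoc)

lemma op_pow_id: "op_pow id_blinfun n = id_blinfun"
  by (induction n) (simp_all add: op_pow_Suc)

lemma op_pow_compose_shift: "a o\<^sub>L op_pow (b o\<^sub>L a) n = op_pow (a o\<^sub>L b) n o\<^sub>L a"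
  by (induction n) (simp_all add: op_pow_Suc flip: compose_assoc, simp add: compose_assoc)

lemma op_cscale_compose_left: "op_cscale c a o\<^sub>L b = op_cscale c (a o\<^sub>L b)"
  by (rule blinfun_eqI) simp

lemma op_cscale_op_cscale: "op_cscale c (op_cscale d a) = op_cscale (c * d) a"
  by (rule blinfun_eqI) (simp add: cscale_cscale)

lemma op_cscale_one: "op_cscale 1 a = a"
  using op_cscale_of_real[of 1 a] by simp

lemma op_cscale_compose_right: "a \<in> bounded_ops \<Longrightarrow> a o\<^sub>L op_cscale c b = op_cscale c (a o\<^sub>L b)"
  by (rule blinfun_eqI) (simp add: bounded_opsD)

context wstar_probability_space
begin

lemma von_neumann:
  shows "M \<subseteq> bounded_ops" and "a \<in> M \<Longrightarrow> adj a \<in> M" and "commutant (commutant M) = M"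
  using finite_vn by (auto simp: finite_von_neumann_algebra_def von_neumann_algebra_def)

lemma bounded_ops_M: "a \<in> M \<Longrightarrow> a \<in> bounded_ops"
  using von_neumann(1) by blast

lemma M_iff: "a \<in> M \<longleftrightarrow> a \<in> bounded_ops \<and> (\<forall>r\<in>commutant M. a o\<^sub>L r = r o\<^sub>L a)"
  by (subst von_neumann(3)[symmetric]) (simp add: commutant_def[of "commutant M"])

text \<open>The double commutant theorem enters in this form; square roots and inverses lie in M
  because they commute with everything that commutes with the given element.\<close>

lemma M_commute:
  assumes "a \<in> M" and "\<And>T. T o\<^sub>L a = a o\<^sub>L T \<Longrightarrow> T o\<^sub>L b = b o\<^sub>L T"
  shows "b \<in> M"
  unfolding M_iff
proof (intro conjI ballI)
  show "b \<in> bounded_ops"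
    using bounded_ops_M[OF assms(1)] assms(2) by (simp add: bounded_ops_iff_commute)
  fix r assume "r \<in> commutant M"
  then have "r o\<^sub>L a = a o\<^sub>L r" using assms(1) by (simp add: commutant_def)
  then show "b o\<^sub>L r = r o\<^sub>L b" using assms(2) by simp
qed

lemma M_intros:
  shows "id_blinfun \<in> M" and "0 \<in> M"
    and "a \<in> M \<Longrightarrow> b \<in> M \<Longrightarrow> a + b \<in> M" and "a \<in> M \<Longrightarrow> b \<in> M \<Longrightarrow> a - b \<in> M"
    and "a \<in> M \<Longrightarrow> b \<in> M \<Longrightarrow> a o\<^sub>L b \<in> M"
    and "a \<in> M \<Longrightarrow> r *\<^sub>R a \<in> M" and "a \<in> M \<Longrightarrow> op_cscale c a \<in> M"
    and "a \<in> M \<Longrightarrow> adj a \<in> M" and "a \<in> M \<Longrightarrow> op_abs a \<in> M" and "a \<in> M \<Longrightarrow> op_pow a n \<in> M"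
    and "a \<in> M \<Longrightarrow> - a \<in> M"
proof -
  show id: "id_blinfun \<in> M" by (auto simp: M_iff bounded_ops_intros)
  show "0 \<in> M" by (auto simp: M_iff bounded_ops_intros compose.zero_left compose.zero_right)
  show "a + b \<in> M" "a - b \<in> M" "a o\<^sub>L b \<in> M" if "a \<in> M" "b \<in> M" for a b
  proof -
    have ab: "a \<in> bounded_ops" "b \<in> bounded_ops"
      "\<And>r. r \<in> commutant M \<Longrightarrow> a o\<^sub>L r = r o\<^sub>L a" "\<And>r. r \<in> commutant M \<Longrightarrow> b o\<^sub>L r = r o\<^sub>L b"
      using that by (auto simp: M_iff)
    have "(a o\<^sub>L b) o\<^sub>L r = r o\<^sub>L (a o\<^sub>L b)" if "r \<in> commutant M" for r
      using ab(3)[OF that] ab(4)[OF that] by (metis compose_assoc)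
    then show "a o\<^sub>L b \<in> M" using ab by (simp add: M_iff bounded_ops_intros)
    show "a + b \<in> M" "a - b \<in> M"
      using ab by (simp_all add: M_iff bounded_ops_intros compose.add_left compose.add_right
          compose.diff_left compose.diff_right)
  qed
  note * = this
  show sc: "a \<in> M \<Longrightarrow> r *\<^sub>R a \<in> M" for r a
    by (simp add: M_iff bounded_ops_intros compose.scaleR_left compose.scaleR_right)
  have "r \<in> bounded_ops" if "r \<in> commutant M" for r
    using that by (simp add: commutant_def)
  then show "a \<in> M \<Longrightarrow> op_cscale c a \<in> M"
    by (simp add: M_iff bounded_ops_intros op_cscale_compose_left op_cscale_compose_right)
  show "a \<in> M \<Longrightarrow> - a \<in> M" using sc[of a "- 1"] by simp
  show adj: "a \<in> M \<Longrightarrow> adj a \<in> M" for a by (rule von_neumann(2))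
  show "a \<in> M \<Longrightarrow> op_abs a \<in> M"
    by (rule M_commute[of "adj a o\<^sub>L a"]) (simp_all add: * adj op_abs_props bounded_ops_M)
  show "a \<in> M \<Longrightarrow> op_pow a n \<in> M"
    by (induction n) (simp_all add: id op_pow_Suc *)
qed

lemma M_sum: "(\<And>i. i \<in> I \<Longrightarrow> f i \<in> M) \<Longrightarrow> sum f I \<in> M"
  by (induction I rule: infinite_finite_induct) (simp_all add: M_intros)

lemma M_op_prod: "set xs \<subseteq> M \<Longrightarrow> op_prod xs \<in> M"
  by (induction xs) (simp_all add: M_intros)

lemma phi_scaleR: "a \<in> M \<Longrightarrow> \<phi> (r *\<^sub>R a) = complex_of_real r * \<phi> a"
  using scale[of a "complex_of_real r"] by (simp add: op_cscale_of_real)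

lemma phi_zero [simp]: "\<phi> 0 = 0"
  using phi_scaleR[OF M_intros(2), of 0] by simp

lemma phi_uminus: "a \<in> M \<Longrightarrow> \<phi> (- a) = - \<phi> a"
  using phi_scaleR[of a "- 1"] by simp

lemma phi_diff: "a \<in> M \<Longrightarrow> b \<in> M \<Longrightarrow> \<phi> (a - b) = \<phi> a - \<phi> b"
  using add[of a "- b"] by (simp add: M_intros phi_uminus)

lemma phi_sum: "(\<And>i. i \<in> I \<Longrightarrow> f i \<in> M) \<Longrightarrow> \<phi> (sum f I) = (\<Sum>i\<in>I. \<phi> (f i))"
  by (induction I rule: infinite_finite_induct) (simp_all add: add M_sum)

lemma phi_adj_compose:
  assumes "a \<in> M"
  shows "Im (\<phi> (adj a o\<^sub>L a)) = 0" and "0 \<le> Re (\<phi> (adj a o\<^sub>L a))"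
  using positive[of "adj a o\<^sub>L a"] assms
  by (simp_all add: M_intros op_positive_adj_compose bounded_ops_M)

lemma adj_M_simps:
  assumes "a \<in> M"
  shows "adj (r *\<^sub>R a) = r *\<^sub>R adj a" and "adj (op_cscale c a) = op_cscale (cnj c) (adj a)"
    and "b \<in> M \<Longrightarrow> adj (a + b) = adj a + adj b"
    and "b \<in> M \<Longrightarrow> adj (a - b) = adj a - adj b"
    and "b \<in> M \<Longrightarrow> adj (a o\<^sub>L b) = adj b o\<^sub>L adj a"
    and "adj (adj a) = a"
  using assms by (simp_all add: adj_simps adj_adj bounded_ops_M)

lemma op_cscale_compose:
  "op_cscale c a o\<^sub>L b = op_cscale c (a o\<^sub>L b)"
  "a \<in> M \<Longrightarrow> a o\<^sub>L op_cscale c b = op_cscale c (a o\<^sub>L b)"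
  by (simp_all add: op_cscale_compose_left op_cscale_compose_right bounded_ops_M)

text \<open>The trace is real at \<open>adj b o\<^sub>L b\<close>. Taking b = a + 1 and b = a + i
  and looking at the cross terms gives the imaginary and the real part of the claim.\<close>

lemma phi_adj:
  assumes a: "a \<in> M"
  shows "\<phi> (adj a) = cnj (\<phi> a)"
proof -
  have id: "id_blinfun \<in> M" by (rule M_intros)
  note M = M_intros a id
  let ?i = "op_cscale \<i> id_blinfun"
  have "adj (a + id_blinfun) o\<^sub>L (a + id_blinfun) = (adj a o\<^sub>L a) + adj a + a + id_blinfun"
    by (simp add: adj_M_simps M compose.add_left compose.add_right)
  then have "\<phi> (adj (a + id_blinfun) o\<^sub>L (a + id_blinfun)) = \<phi> (adj a o\<^sub>L a) + \<phi> (adj a) + \<phi> a + 1"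
    by (simp add: M add unital)
  then have 1: "Im (\<phi> (adj a)) + Im (\<phi> a) = 0"
    using phi_adj_compose(1)[of "a + id_blinfun"] phi_adj_compose(1)[OF a] by (simp add: M)
  have "adj (a + ?i) o\<^sub>L (a + ?i) =
      (adj a o\<^sub>L a) + op_cscale \<i> (adj a) + op_cscale (cnj \<i>) a + id_blinfun"
    by (simp add: adj_M_simps M compose.add_left compose.add_right op_cscale_compose
        op_cscale_op_cscale op_cscale_one)
  then have "\<phi> (adj (a + ?i) o\<^sub>L (a + ?i)) = \<phi> (adj a o\<^sub>L a) + \<i> * \<phi> (adj a) - \<i> * \<phi> a + 1"
    by (simp add: M add scale unital)
  then have 2: "Re (\<phi> (adj a)) = Re (\<phi> a)"
    using phi_adj_compose(1)[of "a + ?i"] phi_adj_compose(1)[OF a] by (simp add: M)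
  from 1 2 show ?thesis by (simp add: complex_eq_iff)
qed

lemma phi_cauchy_schwarz:
  assumes a: "a \<in> M" and b: "b \<in> M"
  shows "(cmod (\<phi> (adj b o\<^sub>L a)))\<^sup>2 \<le> Re (\<phi> (adj a o\<^sub>L a)) * Re (\<phi> (adj b o\<^sub>L b))"
proof -
  note M = M_intros a b
  define h where "h = \<phi> (adj b o\<^sub>L a)"
  let ?A = "Re (\<phi> (adj a o\<^sub>L a))" and ?B = "Re (\<phi> (adj b o\<^sub>L b))"
  have h': "\<phi> (adj a o\<^sub>L b) = cnj h"
    unfolding h_def using phi_adj[of "adj b o\<^sub>L a"] by (simp add: M adj_M_simps)
  \<comment> \<open>The test element is a - t h b; the factor h makes the cross terms real, so that
    a real quadratic polynomial in t remains.\<close>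
  have *: "0 \<le> ?A - 2 * t * (cmod h)\<^sup>2 + t\<^sup>2 * (cmod h)\<^sup>2 * ?B" for t
  proof -
    let ?z = "complex_of_real t * h" and ?w = "complex_of_real t * cnj h"
    have "adj (a - op_cscale ?z b) o\<^sub>L (a - op_cscale ?z b) = (adj a o\<^sub>L a) - op_cscale ?z (adj a o\<^sub>L b)
        - (op_cscale ?w (adj b o\<^sub>L a) - op_cscale ?w (op_cscale ?z (adj b o\<^sub>L b)))"
      by (simp add: M adj_M_simps compose.diff_left compose.diff_right op_cscale_compose)
    then have eq: "\<phi> (adj (a - op_cscale ?z b) o\<^sub>L (a - op_cscale ?z b)) =
        \<phi> (adj a o\<^sub>L a) - ?z * cnj h - (?w * h - ?w * (?z * \<phi> (adj b o\<^sub>L b)))"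
      by (simp add: M phi_diff scale h' flip: h_def)
    have *: "?z * cnj h = complex_of_real (t * (cmod h)\<^sup>2)"
      "?w * h = complex_of_real (t * (cmod h)\<^sup>2)"
      "?w * (?z * x) = complex_of_real (t\<^sup>2 * (cmod h)\<^sup>2) * x" for x
      unfolding of_real_mult complex_norm_square by (simp_all add: power2_eq_square mult_ac)
    have "\<phi> (adj (a - op_cscale ?z b) o\<^sub>L (a - op_cscale ?z b)) =
        \<phi> (adj a o\<^sub>L a) - complex_of_real (2 * t * (cmod h)\<^sup>2)
          + complex_of_real (t\<^sup>2 * (cmod h)\<^sup>2) * \<phi> (adj b o\<^sub>L b)"
      unfolding eq * by (simp add: algebra_simps)
    then show ?thesis
      using phi_adj_compose(2)[of "a - op_cscale ?z b"] by (simp add: M)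
  qed
  have "(cmod h)\<^sup>2 \<le> ?A * ?B"
  proof (cases "?B = 0")
    case True
    have "h = 0"
    proof (rule ccontr)
      assume "h \<noteq> 0"
      then show False using *[of "(?A + 1) / (2 * (cmod h)\<^sup>2)"] True by simp
    qed
    then show ?thesis by (simp add: True)
  next
    case False
    then have "0 < ?B" using phi_adj_compose(2)[OF b] by simp
    with *[of "1 / ?B"] show ?thesis by (simp add: field_simps power2_eq_square)
  qed
  then show ?thesis by (simp add: h_def)
qed

lemma op_pow_symmetric: "a \<in> M \<Longrightarrow> adj a = a \<Longrightarrow> adj (op_pow a n) = op_pow a n"
  by (induction n) (simp_all add: op_pow_Suc adj_M_simps M_intros flip: op_pow_Suc_right)

lemma op_abs_M:
  assumes "a \<in> M"
  shows "op_positive (op_abs a)" and "op_abs a o\<^sub>L op_abs a = adj a o\<^sub>L a"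
    and "adj (op_abs a) = op_abs a" and "op_pow (op_abs a) (2 * n) = op_pow (adj a o\<^sub>L a) n"
  using op_abs_props(1,2)[OF bounded_ops_M[OF assms]] op_positiveD(4)
  by (simp_all add: op_pow_mult op_pow_2)

lemma phi_op_abs_pow_nonneg:
  assumes a: "a \<in> M"
  shows "0 \<le> Re (\<phi> (op_pow (adj a o\<^sub>L a) n))"
proof -
  have "op_pow (adj a o\<^sub>L a) n = adj (op_pow (op_abs a) n) o\<^sub>L op_pow (op_abs a) n"
    by (simp only: op_pow_symmetric M_intros(9) op_abs_M(3) op_abs_M(4)[symmetric] a mult_2 op_pow_add)
  then show ?thesis using phi_adj_compose(2) a by (simp add: M_intros)
qed

lemma nc_norm_even: "a \<in> M \<Longrightarrow> nc_norm \<phi> (2 * n) a = root (2 * n) (Re (\<phi> (op_pow (adj a o\<^sub>L a) n)))"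
  by (simp add: nc_norm_def op_abs_M)

lemma nc_norm_1: "nc_norm \<phi> 1 a = Re (\<phi> (op_abs a))"
  by (simp add: nc_norm_def)

lemma nc_norm_2: "a \<in> M \<Longrightarrow> nc_norm \<phi> 2 a = sqrt (Re (\<phi> (adj a o\<^sub>L a)))"
  using nc_norm_even[of a 1] by (simp add: sqrt_def)

lemma nc_norm_2_square: "a \<in> M \<Longrightarrow> (nc_norm \<phi> 2 a)\<^sup>2 = Re (\<phi> (adj a o\<^sub>L a))"
  by (simp add: nc_norm_2 phi_adj_compose)

lemma nc_norm_nonneg:
  assumes "a \<in> M" and "p = 1 \<or> even p"
  shows "0 \<le> nc_norm \<phi> p a"
  using assms(2)
proof
  assume "p = 1"
  then show ?thesis
    using positive[of "op_abs a"] assms(1) by (simp add: nc_norm_def op_abs_M M_intros)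
next
  assume "even p"
  then show ?thesis
    using phi_op_abs_pow_nonneg[OF assms(1)]
    by (auto simp: nc_norm_even assms(1) real_root_ge_zero elim!: evenE)
qed

lemma op_abs_uminus: "a \<in> M \<Longrightarrow> op_abs (- a) = op_abs a"
  using adj_M_simps(1)[of a "- 1"]
  by (simp add: op_abs_def compose.minus_left compose.minus_right)

lemma nc_norm_minus_commute: "a \<in> M \<Longrightarrow> b \<in> M \<Longrightarrow> nc_norm \<phi> p (a - b) = nc_norm \<phi> p (b - a)"
  using op_abs_uminus[of "a - b"] by (simp add: nc_norm_def M_intros)

text \<open>Cauchy-Schwarz against the identity. Doubling the exponent removes the absolute value
  from the right-hand side, which makes odd exponents accessible.\<close>

lemma nc_norm_le_double:
  assumes a: "a \<in> M" and p: "0 < p"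
  shows "nc_norm \<phi> p a \<le> root p (sqrt (Re (\<phi> (op_pow (adj a o\<^sub>L a) p))))"
proof -
  let ?b = "op_pow (op_abs a) p"
  have b: "?b \<in> M" "adj ?b = ?b" using a by (simp_all add: M_intros op_pow_symmetric op_abs_M)
  have "(cmod (\<phi> ?b))\<^sup>2 \<le> Re (\<phi> (op_pow (adj a o\<^sub>L a) p))"
    using phi_cauchy_schwarz[OF b(1) M_intros(1)] b(2) op_abs_M(4)[OF a, of p]
    by (simp add: unital mult_2 op_pow_add)
  then have "Re (\<phi> ?b) \<le> sqrt (Re (\<phi> (op_pow (adj a o\<^sub>L a) p)))"
    using complex_Re_le_cmod[of "\<phi> ?b"] real_le_rsqrt by fastforce
  then show ?thesis using p by (simp add: nc_norm_def)
qed

lemma nc_norm_1_le_2: "a \<in> M \<Longrightarrow> nc_norm \<phi> 1 a \<le> nc_norm \<phi> 2 a"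
  using nc_norm_le_double[of a 1] by (simp add: nc_norm_2)

lemma phi_compose_nc_norm_2:
  assumes a: "a \<in> M" and b: "b \<in> M"
  shows "cmod (\<phi> (adj b o\<^sub>L a)) \<le> nc_norm \<phi> 2 a * nc_norm \<phi> 2 b"
  using real_le_rsqrt[OF phi_cauchy_schwarz[OF a b]] assms
  by (simp add: nc_norm_2 real_sqrt_mult)

lemma nc_norm_2_triangle:
  assumes a: "a \<in> M" and b: "b \<in> M"
  shows "nc_norm \<phi> 2 (a + b) \<le> nc_norm \<phi> 2 a + nc_norm \<phi> 2 b"
proof (rule power2_le_imp_le)
  note M = M_intros a b
  have "\<phi> (adj (a + b) o\<^sub>L (a + b)) =
      \<phi> (adj a o\<^sub>L a) + \<phi> (adj b o\<^sub>L a) + (\<phi> (adj a o\<^sub>L b) + \<phi> (adj b o\<^sub>L b))"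
    by (simp add: M adj_M_simps compose.add_left compose.add_right add algebra_simps)
  moreover have "\<phi> (adj a o\<^sub>L b) = cnj (\<phi> (adj b o\<^sub>L a))"
    using phi_adj[of "adj b o\<^sub>L a"] by (simp add: M adj_M_simps)
  moreover have "Re (\<phi> (adj b o\<^sub>L a)) \<le> nc_norm \<phi> 2 a * nc_norm \<phi> 2 b"
    using phi_compose_nc_norm_2[OF a b] complex_Re_le_cmod order_trans by blast
  ultimately show "(nc_norm \<phi> 2 (a + b))\<^sup>2 \<le> (nc_norm \<phi> 2 a + nc_norm \<phi> 2 b)\<^sup>2"
    by (simp add: power2_sum nc_norm_2_square M)
qed (simp add: nc_norm_nonneg assms)

section \<open>Duality between the 1-norm and the operator norm\<close>

lemma Re_phi_compose_bound:
  assumes c: "c \<in> M" and h: "h \<in> M"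
  shows "Re (\<phi> (adj (c o\<^sub>L h) o\<^sub>L (c o\<^sub>L h))) \<le> (norm c)\<^sup>2 * Re (\<phi> (adj h o\<^sub>L h))"
proof -
  note M = M_intros c h
  let ?d = "(norm c)\<^sup>2 *\<^sub>R (adj h o\<^sub>L h) - (adj (c o\<^sub>L h) o\<^sub>L (c o\<^sub>L h))"
  have "op_positive ?d"
  proof (rule op_positiveI)
    show "?d \<in> bounded_ops" by (simp add: bounded_ops_M M)
    have "op_positive (adj h o\<^sub>L h)" "op_positive (adj (c o\<^sub>L h) o\<^sub>L (c o\<^sub>L h))"
      by (simp_all add: op_positive_adj_compose bounded_ops_M M)
    note sym = this[THEN op_positiveD(2)]
    show "inner (?d x) y = inner x (?d y)" for x y
      using sym[of x y] by (simp add: minus_blinfun.rep_eq scaleR_blinfun.rep_eq inner_diff_left inner_diff_right)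
    show "0 \<le> inner (?d x) x" for x
    proof -
      have "inner (?d x) x = (norm c)\<^sup>2 * (norm (h x))\<^sup>2 - (norm (c (h x)))\<^sup>2"
        using inner_adj'[of h "h x" x] inner_adj'[of "c o\<^sub>L h" "c (h x)" x]
        by (simp add: minus_blinfun.rep_eq scaleR_blinfun.rep_eq inner_diff_left bounded_ops_M M
            power2_norm_eq_inner)
      moreover have "(norm (c (h x)))\<^sup>2 \<le> (norm c * norm (h x))\<^sup>2"
        by (intro power_mono norm_blinfun) simp
      ultimately show ?thesis by (simp add: power_mult_distrib)
    qed
  qed
  then have "0 \<le> Re (\<phi> ?d)" using positive[of ?d] by (simp add: M)
  then show ?thesis by (simp add: M phi_diff phi_scaleR)
qed

text \<open>Write p = h^2 and move one factor h to the front by the trace property; Cauchy-Schwarz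
  for c h and h then leaves one factor \<open>norm c\<close>.\<close>

lemma phi_compose_positive:
  assumes c: "c \<in> M" and p: "p \<in> M" "op_positive p"
  shows "cmod (\<phi> (c o\<^sub>L p)) \<le> norm c * Re (\<phi> p)"
proof -
  obtain h where h: "op_positive h" "h o\<^sub>L h = p" "\<And>T. T o\<^sub>L p = p o\<^sub>L T \<Longrightarrow> T o\<^sub>L h = h o\<^sub>L T"
    using op_positive_sqrt[OF p(2)] by blast
  have hM: "h \<in> M" by (rule M_commute[OF p(1) h(3)])
  note M = M_intros c hM
  have adjh: "adj h = h" using h(1) by (rule op_positiveD)
  have "\<phi> (c o\<^sub>L p) = \<phi> (adj h o\<^sub>L (c o\<^sub>L h))"
    unfolding adjh h(2)[symmetric] using tracial[of "c o\<^sub>L h" h] by (simp add: M compose_assoc)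
  then have "(cmod (\<phi> (c o\<^sub>L p)))\<^sup>2 \<le> Re (\<phi> (adj (c o\<^sub>L h) o\<^sub>L (c o\<^sub>L h))) * Re (\<phi> (adj h o\<^sub>L h))"
    using phi_cauchy_schwarz[of "c o\<^sub>L h" h] by (simp add: M)
  also have "\<dots> \<le> ((norm c)\<^sup>2 * Re (\<phi> (adj h o\<^sub>L h))) * Re (\<phi> (adj h o\<^sub>L h))"
    by (intro mult_right_mono Re_phi_compose_bound c hM phi_adj_compose)
  also have "\<dots> = (norm c * Re (\<phi> p))\<^sup>2"
    by (simp add: adjh h(2) power2_eq_square)
  finally show ?thesis
    by (rule power2_le_imp_le) (use positive[OF p] in simp)
qed

lemma phi_norm_le: "a \<in> M \<Longrightarrow> cmod (\<phi> a) \<le> norm a"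
  using phi_compose_positive[of a id_blinfun]
  by (simp add: M_intros unital op_positiveI bounded_ops_intros)

text \<open>
  \<open>v = a (|a| + e)\<^sup>-\<^sup>1\<close> replaces the partial isometry of the polar decomposition of \<open>a\<close>.
\<close>

lemma approximate_polar_decomposition:
  assumes a: "a \<in> M" and e: "0 < e"
  obtains v where "v \<in> M" and "norm v \<le> 1" and "a = (v o\<^sub>L op_abs a) + e *\<^sub>R v"
    and "nc_norm \<phi> 1 a - e \<le> Re (\<phi> (adj v o\<^sub>L a))"
proof -
  define p where "p = op_abs a"
  have p: "op_positive p" "p o\<^sub>L p = adj a o\<^sub>L a" "p \<in> M"
    using a by (simp_all add: p_def op_abs_M M_intros)
  define T where "T = p + e *\<^sub>R id_blinfun"
  obtain s where s: "T o\<^sub>L s = id_blinfun" "s o\<^sub>L T = id_blinfun"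
    using op_positive_shift_inverse[OF p(1) e] unfolding T_def by blast
  have TM: "T \<in> M" by (simp add: T_def M_intros p)
  have T: "op_positive T"
    unfolding T_def using e
    by (intro op_positive_add op_positive_scaleR p) (simp_all add: op_positiveI bounded_ops_intros)
  have sM: "s \<in> M"
  proof (rule M_commute[OF TM])
    fix R assume "R o\<^sub>L T = T o\<^sub>L R"
    then show "R o\<^sub>L s = s o\<^sub>L R" using s by (metis compose_assoc compose_id)
  qed
  have Ts: "T (s x) = x" for x
    using s(1) by (metis blinfun_apply_blinfun_compose id_blinfun.rep_eq)
  have spos: "op_positive s"
  proof (rule op_positiveI)
    show "s \<in> bounded_ops" by (rule bounded_ops_M[OF sM])
    show "inner (s x) y = inner x (s y)" for x y
      by (metis Ts T op_positiveD(2))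
    show "0 \<le> inner (s x) x" for x
      by (metis Ts T op_positiveD(5))
  qed
  have sp: "s o\<^sub>L p = id_blinfun - e *\<^sub>R s"
    using s(2) by (simp add: T_def compose.add_right compose.scaleR_right algebra_simps)
  define v where "v = a o\<^sub>L s"
  have vM: "v \<in> M" by (simp add: v_def M_intros a sM)
  have "norm v \<le> 1"
  proof (rule norm_blinfun_bound)
    fix x
    \<comment> \<open>With y = (p + e)^-1 x the vectors v x = a y and p y have equal length, and p y
      is no longer than p y + e y = x because p is positive.\<close>
    define y where "y = s x"
    have "(norm (v x))\<^sup>2 = inner y ((adj a o\<^sub>L a) y)"
      by (simp add: v_def y_def power2_norm_eq_inner inner_adj bounded_ops_M a)
    also have "\<dots> = (norm (p y))\<^sup>2"
      by (simp add: p(2)[symmetric] power2_norm_eq_inner op_positiveD(2)[OF p(1)])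
    also have "\<dots> \<le> (norm (p y + e *\<^sub>R y))\<^sup>2"
    proof -
      have "(norm (p y + e *\<^sub>R y))\<^sup>2 = (norm (p y))\<^sup>2 + 2 * e * inner (p y) y + e\<^sup>2 * (norm y)\<^sup>2"
        unfolding power2_norm_eq_inner inner_add_left inner_add_right inner_commute[of y "p y"]
        by (simp add: power2_eq_square inner_commute[of y "p y"])
      then show ?thesis using e op_positiveD(3)[OF p(1), of y] by simp
    qed
    also have "p y + e *\<^sub>R y = x"
      using Ts[of x] by (simp add: T_def y_def plus_blinfun.rep_eq scaleR_blinfun.rep_eq)
    finally have "norm (v x) \<le> norm x" by (rule power2_le_imp_le) simp
    then show "norm (v x) \<le> 1 * norm x" by simp
  qed simp
  moreover have "a = (v o\<^sub>L op_abs a) + e *\<^sub>R v"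
    by (simp add: v_def compose_assoc sp compose.diff_right compose.scaleR_right flip: p_def)
  moreover have "nc_norm \<phi> 1 a - e \<le> Re (\<phi> (adj v o\<^sub>L a))"
  proof -
    have "adj v o\<^sub>L a = s o\<^sub>L (p o\<^sub>L p)"
      using op_positiveD(4)[OF spos] by (simp add: v_def adj_M_simps a sM compose_assoc p(2))
    also have "\<dots> = p - e *\<^sub>R (id_blinfun - e *\<^sub>R s)"
      by (simp add: sp compose.diff_left compose.scaleR_left flip: compose_assoc)
    finally have "\<phi> (adj v o\<^sub>L a) = \<phi> p - complex_of_real e * (1 - complex_of_real e * \<phi> s)"
      by (simp add: M_intros p sM phi_diff phi_scaleR unital)
    moreover have "0 \<le> Re (\<phi> s)" using positive[OF sM spos] by simp
    ultimately show ?thesis using e by (simp add: nc_norm_def p_def right_diff_distrib)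
  qed
  ultimately show thesis using that vM by blast
qed

text \<open>Insert the approximate polar decomposition of a: the contraction v is absorbed into b,
  the positive factor is handled by \<open>phi_compose_positive\<close>, and the error is of order
  e.\<close>

lemma phi_compose_nc_norm_1:
  assumes a: "a \<in> M" and b: "b \<in> M"
  shows "cmod (\<phi> (b o\<^sub>L a)) \<le> norm b * nc_norm \<phi> 1 a"
proof (rule field_le_epsilon)
  fix d :: real assume "0 < d"
  \<comment> \<open>Chosen so that e * norm b is at most d; the added 1 covers b = 0.\<close>
  define e where "e = d / (norm b + 1)"
  have "0 < e" using \<open>0 < d\<close> by (simp add: e_def add_nonneg_pos)
  from approximate_polar_decomposition[OF a this] obtain v where
    v: "v \<in> M" "norm v \<le> 1" "a = (v o\<^sub>L op_abs a) + e *\<^sub>R v" by blast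
  note M = M_intros a b v(1)
  have "norm (b o\<^sub>L v) \<le> norm b"
    using order_trans[OF norm_blinfun_compose mult_left_mono[OF v(2)], of b] by simp
  have "\<phi> (b o\<^sub>L a) = \<phi> ((b o\<^sub>L v) o\<^sub>L op_abs a) + complex_of_real e * \<phi> (b o\<^sub>L v)"
    by (subst v(3)) (simp add: compose.add_right compose.scaleR_right add phi_scaleR M compose_assoc)
  then have "cmod (\<phi> (b o\<^sub>L a)) \<le> cmod (\<phi> ((b o\<^sub>L v) o\<^sub>L op_abs a)) + e * cmod (\<phi> (b o\<^sub>L v))"
    using norm_triangle_ineq[of "\<phi> ((b o\<^sub>L v) o\<^sub>L op_abs a)" "complex_of_real e * \<phi> (b o\<^sub>L v)"] \<open>0 < e\<close>
    by (simp add: norm_mult)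
  also have "\<dots> \<le> norm (b o\<^sub>L v) * nc_norm \<phi> 1 a + e * norm (b o\<^sub>L v)"
    using \<open>0 < e\<close> unfolding nc_norm_1
    by (intro add_mono mult_left_mono phi_compose_positive phi_norm_le) (simp_all add: M op_abs_M)
  also have "\<dots> \<le> norm b * nc_norm \<phi> 1 a + e * norm b"
    using \<open>0 < e\<close> \<open>norm (b o\<^sub>L v) \<le> norm b\<close>
    by (intro add_mono mult_left_mono mult_right_mono) (simp_all add: nc_norm_nonneg a)
  also have "e * norm b \<le> d"
  proof -
    have "norm b / (norm b + 1) \<le> 1" by (simp add: divide_le_eq add_nonneg_pos)
    then have "d * (norm b / (norm b + 1)) \<le> d"
      using \<open>0 < d\<close> by (intro mult_left_le) simp_all
    then show ?thesis by (simp add: e_def)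
  qed
  finally show "cmod (\<phi> (b o\<^sub>L a)) \<le> norm b * nc_norm \<phi> 1 a + d" by simp
qed

text \<open>Up to e, the 1-norm of a + b is attained by pairing with a contraction, and such a
  pairing is additive and bounded by the 1-norm of each summand.\<close>

lemma nc_norm_1_triangle:
  assumes a: "a \<in> M" and b: "b \<in> M"
  shows "nc_norm \<phi> 1 (a + b) \<le> nc_norm \<phi> 1 a + nc_norm \<phi> 1 b"
proof (rule field_le_epsilon)
  fix e :: real assume "0 < e"
  from approximate_polar_decomposition[OF _ this, of "a + b"] obtain v where
    v: "v \<in> M" "norm v \<le> 1" "nc_norm \<phi> 1 (a + b) - e \<le> Re (\<phi> (adj v o\<^sub>L (a + b)))"
    by (metis M_intros(3) a b)
  note M = M_intros a b v(1)
  have bound: "Re (\<phi> (adj v o\<^sub>L c)) \<le> nc_norm \<phi> 1 c" if "c \<in> M" for c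
  proof -
    have "cmod (\<phi> (adj v o\<^sub>L c)) \<le> norm (adj v) * nc_norm \<phi> 1 c"
      by (rule phi_compose_nc_norm_1) (simp_all add: that M)
    also have "\<dots> \<le> 1 * nc_norm \<phi> 1 c"
      using norm_adj_le[OF bounded_ops_M[OF v(1)]] v(2)
      by (intro mult_right_mono) (simp_all add: nc_norm_nonneg that)
    finally show ?thesis using complex_Re_le_cmod[of "\<phi> (adj v o\<^sub>L c)"] by simp
  qed
  have "Re (\<phi> (adj v o\<^sub>L (a + b))) = Re (\<phi> (adj v o\<^sub>L a)) + Re (\<phi> (adj v o\<^sub>L b))"
    by (simp add: compose.add_right add M)
  with v(3) bound[OF a] bound[OF b]
  show "nc_norm \<phi> 1 (a + b) \<le> nc_norm \<phi> 1 a + nc_norm \<phi> 1 b + e" by simp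
qed

end

section \<open>Hoelder and Minkowski inequalities for dyadic exponents\<close>

fun pair_up :: "'h::complex_hilbert op list \<Rightarrow> 'h op list" where
  "pair_up (x # y # xs) = (x o\<^sub>L y) # pair_up xs"
| "pair_up xs = xs"

lemma op_prod_pair_up: "op_prod (pair_up xs) = op_prod xs"
  by (induction xs rule: pair_up.induct) (simp_all add: compose_assoc)

lemma length_pair_up: "even (length xs) \<Longrightarrow> length (pair_up xs) = length xs div 2"
  by (induction xs rule: pair_up.induct) auto

context wstar_probability_space
begin

lemma set_pair_up: "set xs \<subseteq> M \<Longrightarrow> set (pair_up xs) \<subseteq> M"
  by (induction xs rule: pair_up.induct) (simp_all add: M_intros)

text \<open>The exponents start at 2, so that the norm is always expressed by a moment of
  \<open>adj a o\<^sub>L a\<close>.\<close>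

abbreviation dyadic_norm :: "nat \<Rightarrow> 'h op \<Rightarrow> real" where
  "dyadic_norm m a \<equiv> nc_norm \<phi> (2 ^ Suc m) a"

lemma dyadic_norm_power:
  assumes "a \<in> M"
  shows "dyadic_norm m a ^ (2 ^ Suc m) = Re (\<phi> (op_pow (adj a o\<^sub>L a) (2 ^ m)))"
proof -
  have "dyadic_norm m a = root (2 ^ Suc m) (Re (\<phi> (op_pow (adj a o\<^sub>L a) (2 ^ m))))"
    using nc_norm_even[OF assms, of "2 ^ m"] by simp
  then show ?thesis by (simp add: phi_op_abs_pow_nonneg assms)
qed

lemma dyadic_norm_nonneg: "a \<in> M \<Longrightarrow> 0 \<le> dyadic_norm m a"
  by (rule nc_norm_nonneg) simp_all

lemma phi_op_pow_compose_commute: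
  assumes "a \<in> M" and "b \<in> M"
  shows "\<phi> (op_pow (a o\<^sub>L b) n) = \<phi> (op_pow (b o\<^sub>L a) n)"
proof (cases n)
  case (Suc k)
  have "op_pow (a o\<^sub>L b) n = a o\<^sub>L (b o\<^sub>L op_pow (a o\<^sub>L b) k)"
    by (simp add: Suc op_pow_Suc compose_assoc)
  also have "b o\<^sub>L op_pow (a o\<^sub>L b) k = op_pow (b o\<^sub>L a) k o\<^sub>L b"
    by (rule op_pow_compose_shift)
  finally have "\<phi> (op_pow (a o\<^sub>L b) n) = \<phi> ((op_pow (b o\<^sub>L a) k o\<^sub>L b) o\<^sub>L a)"
    using assms by (simp add: tracial M_intros)
  then show ?thesis by (simp add: Suc op_pow_Suc_right compose_assoc)
qed simp

lemma dyadic_norm_adj: "a \<in> M \<Longrightarrow> dyadic_norm m (adj a) = dyadic_norm m a"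
  using nc_norm_even[of "adj a" "2 ^ m"] nc_norm_even[of a "2 ^ m"]
    phi_op_pow_compose_commute[of a "adj a" "2 ^ m"]
  by (simp add: M_intros adj_M_simps)

lemma dyadic_norm_adj_compose:
  assumes a: "a \<in> M"
  shows "dyadic_norm m (adj a o\<^sub>L a) = (dyadic_norm (Suc m) a)\<^sup>2"
proof (rule power_eq_imp_eq_base)
  have "dyadic_norm m (adj a o\<^sub>L a) ^ 2 ^ Suc m
      = Re (\<phi> (op_pow (op_pow (adj a o\<^sub>L a) 2) (2 ^ m)))"
    using a by (simp only: dyadic_norm_power M_intros) (simp add: adj_M_simps M_intros op_pow_2)
  also have "\<dots> = Re (\<phi> (op_pow (adj a o\<^sub>L a) (2 ^ Suc m)))"
    by (simp add: op_pow_mult[symmetric])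
  also have "\<dots> = dyadic_norm (Suc m) a ^ 2 ^ Suc (Suc m)"
    using a by (simp only: dyadic_norm_power)
  also have "\<dots> = ((dyadic_norm (Suc m) a)\<^sup>2) ^ 2 ^ Suc m"
    by (simp add: power_mult)
  finally show "dyadic_norm m (adj a o\<^sub>L a) ^ 2 ^ Suc m = ((dyadic_norm (Suc m) a)\<^sup>2) ^ 2 ^ Suc m" .
  show "0 \<le> dyadic_norm m (adj a o\<^sub>L a)"
    by (intro dyadic_norm_nonneg M_intros a)
qed simp_all

lemma dyadic_norm_id: "dyadic_norm m id_blinfun = 1"
  using nc_norm_even[OF M_intros(1), of "2 ^ m"] by (simp add: op_pow_id unital)

text \<open>Induction by grouping neighbours into pairs. For a pair, the q-norm of a b to the power
  q is the trace of a word of length q that alternates between \<open>adj a o\<^sub>L a\<close> and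
  \<open>b o\<^sub>L adj b\<close>; the induction hypothesis applies to this word too, and
  \<open>dyadic_norm_adj_compose\<close> converts the result to the exponent 2 q.\<close>

lemma holder_dyadic:
  assumes "set xs \<subseteq> M" and "length xs = 2 ^ Suc m"
  shows "cmod (\<phi> (op_prod xs)) \<le> prod_list (map (dyadic_norm m) xs)"
  using assms
proof (induction m arbitrary: xs)
  case 0
  then obtain x y where xs: "xs = [x, y]"
    by (auto simp: length_Suc_conv numeral_2_eq_2)
  then have "x \<in> M" "y \<in> M" using 0 by auto
  then have "cmod (\<phi> (x o\<^sub>L y)) \<le> nc_norm \<phi> 2 y * nc_norm \<phi> 2 (adj x)"
    using phi_compose_nc_norm_2[of y "adj x"] by (simp add: M_intros adj_M_simps)
  also have "nc_norm \<phi> 2 (adj x) = nc_norm \<phi> 2 x"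
    using dyadic_norm_adj[OF \<open>x \<in> M\<close>, of 0] by simp
  finally show ?case by (simp add: xs mult.commute)
next
  case (Suc m)
  have pair: "dyadic_norm m (a o\<^sub>L b) \<le> dyadic_norm (Suc m) a * dyadic_norm (Suc m) b"
    if a: "a \<in> M" and b: "b \<in> M" for a b
  proof (rule power_le_imp_le_base[of _ "2 ^ Suc m - 1"])
    note M = M_intros a b
    let ?P = "adj a o\<^sub>L a" and ?Q = "b o\<^sub>L adj b"
    let ?l = "concat (replicate (2 ^ m) [?P, ?Q])"
    have "dyadic_norm m (a o\<^sub>L b) ^ 2 ^ Suc m = Re (\<phi> (op_pow (adj b o\<^sub>L (?P o\<^sub>L b)) (2 ^ m)))"
      by (simp only: dyadic_norm_power M) (simp add: adj_M_simps M compose_assoc)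
    also have "\<phi> (op_pow (adj b o\<^sub>L (?P o\<^sub>L b)) (2 ^ m)) = \<phi> (op_pow (?P o\<^sub>L ?Q) (2 ^ m))"
      by (subst phi_op_pow_compose_commute) (simp_all add: M compose_assoc)
    also have "Re (\<phi> (op_pow (?P o\<^sub>L ?Q) (2 ^ m))) \<le> cmod (\<phi> (op_prod ?l))"
      by (simp only: op_prod_replicate_pair complex_Re_le_cmod)
    also have "\<dots> \<le> prod_list (map (dyadic_norm m) ?l)"
    proof (rule Suc.IH)
      show "set ?l \<subseteq> M" by (auto simp: M)
      have "length (concat (replicate n [?P, ?Q])) = 2 * n" for n by (induction n) auto
      then show "length ?l = 2 ^ Suc m" by simp
    qed
    also have "\<dots> = (dyadic_norm m ?P * dyadic_norm m ?Q) ^ 2 ^ m"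
    proof -
      have "prod_list (map (dyadic_norm m) (concat (replicate n [?P, ?Q])))
          = (dyadic_norm m ?P * dyadic_norm m ?Q) ^ n" for n
        by (induction n) (simp_all add: mult_ac)
      then show ?thesis .
    qed
    also have "dyadic_norm m ?Q = (dyadic_norm (Suc m) b)\<^sup>2"
      using dyadic_norm_adj_compose[of "adj b" m] dyadic_norm_adj[of b "Suc m"]
      by (simp add: M adj_M_simps)
    also have "dyadic_norm m ?P = (dyadic_norm (Suc m) a)\<^sup>2"
      by (rule dyadic_norm_adj_compose[OF a])
    also have "((dyadic_norm (Suc m) a)\<^sup>2 * (dyadic_norm (Suc m) b)\<^sup>2) ^ 2 ^ m
        = (dyadic_norm (Suc m) a * dyadic_norm (Suc m) b) ^ 2 ^ Suc m"
      by (simp add: power_mult_distrib power_mult)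
    finally show "dyadic_norm m (a o\<^sub>L b) ^ Suc (2 ^ Suc m - 1)
        \<le> (dyadic_norm (Suc m) a * dyadic_norm (Suc m) b) ^ Suc (2 ^ Suc m - 1)"
      by (simp add: Suc_diff_Suc[symmetric] del: power_Suc)
    show "0 \<le> dyadic_norm (Suc m) a * dyadic_norm (Suc m) b"
      by (intro mult_nonneg_nonneg dyadic_norm_nonneg a b)
  qed
  have bound: "prod_list (map (dyadic_norm m) (pair_up ys)) \<le> prod_list (map (dyadic_norm (Suc m)) ys)
      \<and> 0 \<le> prod_list (map (dyadic_norm m) (pair_up ys))"
    if "set ys \<subseteq> M" "even (length ys)" for ys
    using that
  proof (induction ys rule: pair_up.induct)
    case (1 x y ys)
    then have M: "x \<in> M" "y \<in> M" by auto
    have IH: "prod_list (map (dyadic_norm m) (pair_up ys)) \<le> prod_list (map (dyadic_norm (Suc m)) ys)"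
      "0 \<le> prod_list (map (dyadic_norm m) (pair_up ys))"
      using 1 by auto
    have "dyadic_norm m (x o\<^sub>L y) * prod_list (map (dyadic_norm m) (pair_up ys))
        \<le> (dyadic_norm (Suc m) x * dyadic_norm (Suc m) y) * prod_list (map (dyadic_norm (Suc m)) ys)"
      by (intro mult_mono pair M IH mult_nonneg_nonneg dyadic_norm_nonneg)
    with IH(2) M show ?case by (simp add: mult.assoc dyadic_norm_nonneg M_intros del: power_Suc)
  qed auto
  have "cmod (\<phi> (op_prod (pair_up xs))) \<le> prod_list (map (dyadic_norm m) (pair_up xs))"
    using Suc.prems by (intro Suc.IH set_pair_up) (simp_all add: length_pair_up)
  also have "\<dots> \<le> prod_list (map (dyadic_norm (Suc m)) xs)"
    using bound[of xs] Suc.prems by simp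
  finally show ?case by (simp only: op_prod_pair_up)
qed

text \<open>As for functions: with c = a + b, the q-th power of the norm of c is the trace of an
  alternating word in c and its adjoint. Splitting only the first letter and applying Hoelder leaves
  q - 1 factors equal to the norm of c, which cancel.\<close>

lemma dyadic_norm_triangle:
  assumes a: "a \<in> M" and b: "b \<in> M"
  shows "dyadic_norm m (a + b) \<le> dyadic_norm m a + dyadic_norm m b"
proof (cases "dyadic_norm m (a + b) = 0")
  case True
  then show ?thesis using dyadic_norm_nonneg a b by (simp del: power_Suc)
next
  case False
  define c where "c = a + b"
  define q :: nat where "q = 2 ^ m - 1"
  have q: "2 ^ m = Suc q" by (simp add: q_def)
  have cM: "c \<in> M" by (simp add: c_def M_intros a b)
  note M = M_intros a b cM
  \<comment> \<open>The word without its first letter; its length Suc (2 q) is one less than the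
    exponent.\<close>
  define l where "l = c # concat (replicate q [adj c, c])"
  have l: "set l \<subseteq> M" "length l = Suc (2 * q)"
    "prod_list (map (dyadic_norm m) l) = dyadic_norm m c ^ Suc (2 * q)"
  proof -
    have "prod_list (map f (concat (replicate q [adj c, c]))) = f c ^ (2 * q)"
      if "f (adj c) = f c" for f :: "'h op \<Rightarrow> real"
      by (induction q) (simp_all add: that)
    from this[of "dyadic_norm m", OF dyadic_norm_adj[OF cM]] show "prod_list (map (dyadic_norm m) l) = dyadic_norm m c ^ Suc (2 * q)"
      by (simp only: l_def list.map prod_list.Cons power_Suc)
    have "length (concat (replicate q [adj c, c])) = 2 * q" by (induction q) auto
    then show "length l = Suc (2 * q)" by (simp add: l_def)
    show "set l \<subseteq> M" by (auto simp: l_def M)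
  qed
  have "op_pow (adj c o\<^sub>L c) (2 ^ m) = op_prod (adj c # l)"
    by (simp only: q l_def op_pow_Suc foldr.simps o_apply op_prod_replicate_pair compose_assoc)
  also have "\<dots> = op_prod (adj a # l) + op_prod (adj b # l)"
    by (simp add: c_def adj_M_simps M compose.add_left)
  finally have "dyadic_norm m c ^ 2 ^ Suc m = Re (\<phi> (op_prod (adj a # l)) + \<phi> (op_prod (adj b # l)))"
    using M_op_prod[OF l(1)] by (simp only: dyadic_norm_power cM) (simp add: add M)
  also have "\<dots> \<le> cmod (\<phi> (op_prod (adj a # l))) + cmod (\<phi> (op_prod (adj b # l)))"
    using complex_Re_le_cmod norm_triangle_ineq order_trans by blast
  also have "\<dots> \<le> prod_list (map (dyadic_norm m) (adj a # l)) + prod_list (map (dyadic_norm m) (adj b # l))"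
    using l by (intro add_mono holder_dyadic) (simp_all add: M q)
  also have "\<dots> = (dyadic_norm m a + dyadic_norm m b) * dyadic_norm m c ^ Suc (2 * q)"
    by (simp add: l dyadic_norm_adj a b distrib_right del: power_Suc)
  finally have "dyadic_norm m c * dyadic_norm m c ^ Suc (2 * q)
      \<le> (dyadic_norm m a + dyadic_norm m b) * dyadic_norm m c ^ Suc (2 * q)"
    by (simp add: q)
  moreover have "0 < dyadic_norm m c"
    using False dyadic_norm_nonneg[OF cM, of m] by (simp add: c_def del: power_Suc)
  ultimately show ?thesis by (simp add: c_def del: power_Suc)
qed

text \<open>Hoelder for words of any length up to the exponent: they are padded with identities,
  which have norm 1.\<close>

lemma op_prod_bound:
  assumes "set xs \<subseteq> M" and "length xs \<le> 2 ^ Suc m"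
    and "\<And>x. x \<in> set xs \<Longrightarrow> dyadic_norm m x \<le> B"
  shows "cmod (\<phi> (op_prod xs)) \<le> B ^ length xs"
proof -
  define ys where "ys = xs @ replicate (2 ^ Suc m - length xs) id_blinfun"
  have "op_prod ys = op_prod xs"
    unfolding ys_def op_prod_append op_prod_replicate op_pow_id by simp
  moreover have "cmod (\<phi> (op_prod ys)) \<le> prod_list (map (dyadic_norm m) ys)"
    using assms by (intro holder_dyadic) (auto simp: ys_def M_intros)
  moreover have "prod_list (map (dyadic_norm m) ys) = prod_list (map (dyadic_norm m) xs)"
    by (simp add: ys_def dyadic_norm_id map_replicate_const prod_list_replicate del: power_Suc)
  moreover have "prod_list (map (dyadic_norm m) xs) \<le> B ^ length xs \<and> 0 \<le> prod_list (map (dyadic_norm m) xs)"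
    using assms(1,3)
  proof (induction xs)
    case (Cons x xs)
    then have "x \<in> M" "dyadic_norm m x \<le> B" by auto
    moreover from \<open>x \<in> M\<close> have "0 \<le> dyadic_norm m x" by (rule dyadic_norm_nonneg)
    moreover have "prod_list (map (dyadic_norm m) xs) \<le> B ^ length xs"
      "0 \<le> prod_list (map (dyadic_norm m) xs)"
      using Cons by simp_all
    ultimately have "dyadic_norm m x * prod_list (map (dyadic_norm m) xs) \<le> B * B ^ length xs"
      "0 \<le> dyadic_norm m x * prod_list (map (dyadic_norm m) xs)"
      by (auto intro!: mult_mono simp del: power_Suc)
    then show ?case by simp
  qed simp
  ultimately show ?thesis by simp
qed

section \<open>The noncommutative \<open>L\<^sup>p\<close> spaces\<close>

lemma nc_CauchyD: "nc_Cauchy M \<phi> p u \<Longrightarrow> u k \<in> M"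
  by (simp add: nc_Cauchy_def)

lemma nc_Cauchy_2_imp_1: "nc_Cauchy M \<phi> 2 u \<Longrightarrow> nc_Cauchy M \<phi> 1 u"
  unfolding nc_Cauchy_def by (meson M_intros(4) nc_norm_1_le_2 order_le_less_trans)

lemma nc_norm_zero: "nc_norm \<phi> 2 0 = 0" "nc_norm \<phi> 1 0 = 0"
proof -
  show "nc_norm \<phi> 2 0 = 0" by (simp add: nc_norm_2 M_intros compose.zero_right)
  then show "nc_norm \<phi> 1 0 = 0"
    using nc_norm_1_le_2[OF M_intros(2)] nc_norm_nonneg[OF M_intros(2), of 1] by simp
qed

lemma nc_norm_triangle_diff:
  assumes "p = 1 \<or> (\<exists>m. p = 2 ^ Suc m)" and "a \<in> M" and "b \<in> M" and "c \<in> M"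
  shows "nc_norm \<phi> p (a - c) \<le> nc_norm \<phi> p (a - b) + nc_norm \<phi> p (b - c)"
  using assms(1)
proof
  assume "p = 1"
  then show ?thesis
    using nc_norm_1_triangle[of "a - b" "b - c"] assms by (simp add: M_intros)
next
  assume "\<exists>m. p = 2 ^ Suc m"
  then show ?thesis
    using dyadic_norm_triangle[of "a - b" "b - c"] assms by (auto simp: M_intros simp del: power_Suc)
qed

lemma nc_norm_null_trans:
  assumes p: "p = 1 \<or> p = 2" and "\<And>k. u k \<in> M" "\<And>k. v k \<in> M" "\<And>k. w k \<in> M"
    and "(\<lambda>k. nc_norm \<phi> p (u k - v k)) \<longlonglongrightarrow> 0" and "(\<lambda>k. nc_norm \<phi> p (v k - w k)) \<longlonglongrightarrow> 0"
  shows "(\<lambda>k. nc_norm \<phi> p (u k - w k)) \<longlonglongrightarrow> 0"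
proof (rule tendsto_sandwich[OF _ _ tendsto_const])
  have p': "p = 1 \<or> (\<exists>m. p = 2 ^ Suc m)" using p by (auto intro: exI[of _ 0])
  show "\<forall>\<^sub>F k in sequentially. nc_norm \<phi> p (u k - w k)
      \<le> nc_norm \<phi> p (u k - v k) + nc_norm \<phi> p (v k - w k)"
    by (intro always_eventually allI nc_norm_triangle_diff[OF p'] assms)
  show "(\<lambda>k. nc_norm \<phi> p (u k - v k) + nc_norm \<phi> p (v k - w k)) \<longlonglongrightarrow> 0"
    using tendsto_add[OF assms(5,6)] by simp
  show "\<forall>\<^sub>F k in sequentially. 0 \<le> nc_norm \<phi> p (u k - w k)"
    using p by (intro always_eventually allI nc_norm_nonneg M_intros assms) auto
qed

lemma nc_norm_null_sym:
  assumes "\<And>k. u k \<in> M" "\<And>k. v k \<in> M" and "(\<lambda>k. nc_norm \<phi> p (u k - v k)) \<longlonglongrightarrow> 0"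
  shows "(\<lambda>k. nc_norm \<phi> p (v k - u k)) \<longlonglongrightarrow> 0"
  using assms(3) by (simp only: nc_norm_minus_commute assms(1,2))

lemma nc_class_self: "nc_Cauchy M \<phi> 1 u \<Longrightarrow> u \<in> nc_class M \<phi> u"
  using nc_norm_zero(2) by (simp add: nc_class_def)

lemma nc_class_eqI:
  assumes "nc_Cauchy M \<phi> 1 u" and "nc_Cauchy M \<phi> 1 v"
    and null: "(\<lambda>k. nc_norm \<phi> 1 (u k - v k)) \<longlonglongrightarrow> 0"
  shows "nc_class M \<phi> u = nc_class M \<phi> v"
proof -
  have sub: "nc_class M \<phi> v \<subseteq> nc_class M \<phi> u"
    if "nc_Cauchy M \<phi> 1 u" "nc_Cauchy M \<phi> 1 v" "(\<lambda>k. nc_norm \<phi> 1 (u k - v k)) \<longlonglongrightarrow> 0" for u v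
  proof
    fix w assume "w \<in> nc_class M \<phi> v"
    then have w: "nc_Cauchy M \<phi> 1 w" "(\<lambda>k. nc_norm \<phi> 1 (v k - w k)) \<longlonglongrightarrow> 0"
      by (auto simp: nc_class_def)
    have "(\<lambda>k. nc_norm \<phi> 1 (u k - w k)) \<longlonglongrightarrow> 0"
      by (rule nc_norm_null_trans[of 1 u v w])
        (use that(3) w nc_CauchyD[OF that(1)] nc_CauchyD[OF that(2)] nc_CauchyD[OF w(1)] in simp_all)
    with w show "w \<in> nc_class M \<phi> u" by (simp add: nc_class_def)
  qed
  have "(\<lambda>k. nc_norm \<phi> 1 (v k - u k)) \<longlonglongrightarrow> 0"
    by (rule nc_norm_null_sym) (use null nc_CauchyD[OF assms(1)] nc_CauchyD[OF assms(2)] in simp_all)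
  with sub[of u v] sub[of v u] assms show ?thesis by blast
qed

lemma nc_class_diff_null:
  assumes "nc_Cauchy M \<phi> 1 u" and "v \<in> nc_class M \<phi> u" and "w \<in> nc_class M \<phi> u"
  shows "(\<lambda>k. nc_norm \<phi> 1 (v k - w k)) \<longlonglongrightarrow> 0"
proof -
  have vw: "nc_Cauchy M \<phi> 1 v" "nc_Cauchy M \<phi> 1 w" "(\<lambda>k. nc_norm \<phi> 1 (u k - v k)) \<longlonglongrightarrow> 0"
    "(\<lambda>k. nc_norm \<phi> 1 (u k - w k)) \<longlonglongrightarrow> 0"
    using assms by (auto simp: nc_class_def)
  have "(\<lambda>k. nc_norm \<phi> 1 (v k - u k)) \<longlonglongrightarrow> 0"
    by (rule nc_norm_null_sym) (use vw nc_CauchyD[OF assms(1)] nc_CauchyD[OF vw(1)] in simp_all)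
  then show ?thesis
    by (rule nc_norm_null_trans[of 1 v u w, rotated 4])
      (use vw nc_CauchyD[OF assms(1)] nc_CauchyD[OF vw(1)] nc_CauchyD[OF vw(2)] in simp_all)
qed

lemma nc_Cauchy_bounded:
  assumes u: "nc_Cauchy M \<phi> (2 ^ Suc m) u"
  shows "\<exists>B\<ge>1. \<forall>k. dyadic_norm m (u k) \<le> B"
proof -
  note M = nc_CauchyD[OF u]
  obtain N where N: "\<And>k. k \<ge> N \<Longrightarrow> dyadic_norm m (u k - u N) < 1"
    using u unfolding nc_Cauchy_def by (metis order_refl zero_less_one)
  define B where "B = 1 + dyadic_norm m (u N) + (\<Sum>k<N. dyadic_norm m (u k))"
  have nn: "0 \<le> dyadic_norm m (u k)" for k by (rule dyadic_norm_nonneg[OF M])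
  have "0 \<le> (\<Sum>k<N. dyadic_norm m (u k))" by (intro sum_nonneg nn)
  show ?thesis
  proof (intro exI[of _ B] conjI allI)
    show "1 \<le> B" using nn[of N] \<open>0 \<le> (\<Sum>k<N. _ k)\<close> unfolding B_def by linarith
    fix k
    show "dyadic_norm m (u k) \<le> B"
    proof (cases "k < N")
      case True
      then have "dyadic_norm m (u k) \<le> (\<Sum>k<N. dyadic_norm m (u k))"
        by (intro member_le_sum nn) auto
      then show ?thesis using nn[of N] unfolding B_def by linarith
    next
      case False
      have "dyadic_norm m (u k) \<le> dyadic_norm m (u k - u N) + dyadic_norm m (u N)"
        using dyadic_norm_triangle[of "u k - u N" "u N" m] by (simp add: M M_intros del: power_Suc)
      then show ?thesis
        using N[of k] False \<open>0 \<le> (\<Sum>k<N. _ k)\<close> unfolding B_def by linarith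
    qed
  qed
qed

text \<open>
  Injectivity of the map from \<open>L\<^sup>2\<close> to \<open>L\<^sup>1\<close>: limits in \<open>L\<^sup>2\<close> may be computed with any
  representatives of a class of \<open>L\<^sup>1\<close>.
\<close>

lemma nc_norm_1_null_imp_2_null:
  assumes w: "nc_Cauchy M \<phi> 2 w" and null: "(\<lambda>k. nc_norm \<phi> 1 (w k)) \<longlonglongrightarrow> 0"
  shows "(\<lambda>k. nc_norm \<phi> 2 (w k)) \<longlonglongrightarrow> 0"
proof -
  note M = nc_CauchyD[OF w]
  obtain B where "1 \<le> B" and B: "\<And>k. nc_norm \<phi> 2 (w k) \<le> B"
    using nc_Cauchy_bounded[of 0 w] w by auto
  have nn: "0 \<le> nc_norm \<phi> 2 (w k)" for k by (rule nc_norm_nonneg[OF M]) simp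
  have "(\<lambda>k. (nc_norm \<phi> 2 (w k))\<^sup>2) \<longlonglongrightarrow> 0"
  proof (rule LIMSEQ_I)
    fix e :: real assume "0 < e"
    then have "0 < e / (2 * B)" using \<open>1 \<le> B\<close> by simp
    with w obtain N where N: "\<And>k. k \<ge> N \<Longrightarrow> nc_norm \<phi> 2 (w k - w N) < e / (2 * B)"
      unfolding nc_Cauchy_def by (metis order_refl)
    have "(\<lambda>k. norm (adj (w N)) * nc_norm \<phi> 1 (w k)) \<longlonglongrightarrow> norm (adj (w N)) * 0"
      by (intro tendsto_intros null)
    then have "\<forall>\<^sub>F k in sequentially. norm (adj (w N)) * nc_norm \<phi> 1 (w k) < e / 2"
      using \<open>0 < e\<close> by (intro order_tendstoD(2)) auto
    then obtain N' where N': "\<And>k. k \<ge> N' \<Longrightarrow> norm (adj (w N)) * nc_norm \<phi> 1 (w k) < e / 2"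
      by (auto simp: eventually_sequentially)
    show "\<exists>N. \<forall>k\<ge>N. norm ((nc_norm \<phi> 2 (w k))\<^sup>2 - 0) < e"
    proof (intro exI[of _ "max N N'"] allI impI)
      fix k assume k: "max N N' \<le> k"
      \<comment> \<open>The first summand is small by the Cauchy property and boundedness in the
        2-norm. In the second one \<open>w N\<close> is a fixed bounded operator, so duality with
        the 1-norm applies.\<close>
      have "\<phi> (adj (w k) o\<^sub>L w k) = \<phi> (adj (w k) o\<^sub>L (w k - w N)) + \<phi> (adj (w k) o\<^sub>L w N)"
        by (simp add: compose.diff_right phi_diff M M_intros)
      then have "(nc_norm \<phi> 2 (w k))\<^sup>2 \<le> cmod (\<phi> (adj (w k) o\<^sub>L (w k - w N))) + cmod (\<phi> (adj (w k) o\<^sub>L w N))"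
        unfolding nc_norm_2_square[OF M] by (metis complex_Re_le_cmod norm_triangle_ineq order_trans)
      moreover have "cmod (\<phi> (adj (w k) o\<^sub>L (w k - w N))) \<le> nc_norm \<phi> 2 (w k - w N) * nc_norm \<phi> 2 (w k)"
        by (intro phi_compose_nc_norm_2 M M_intros)
      moreover have "nc_norm \<phi> 2 (w k - w N) * nc_norm \<phi> 2 (w k) \<le> e / (2 * B) * B"
        using N[of k] k B[of k] nn[of k] \<open>0 < e / (2 * B)\<close> by (intro mult_mono) auto
      moreover have "cmod (\<phi> (adj (w k) o\<^sub>L w N)) \<le> norm (adj (w N)) * nc_norm \<phi> 1 (w k)"
      proof -
        have "\<phi> (adj (w k) o\<^sub>L w N) = cnj (\<phi> (adj (w N) o\<^sub>L w k))"
          using phi_adj[of "adj (w N) o\<^sub>L w k"] by (simp add: M M_intros adj_M_simps)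
        then show ?thesis
          using phi_compose_nc_norm_1[of "w k" "adj (w N)"] by (simp add: M M_intros)
      qed
      moreover have "norm (adj (w N)) * nc_norm \<phi> 1 (w k) < e / 2" using N' k by simp
      moreover have "e / (2 * B) * B = e / 2" using \<open>1 \<le> B\<close> by simp
      ultimately have "(nc_norm \<phi> 2 (w k))\<^sup>2 < e" by linarith
      then show "norm ((nc_norm \<phi> 2 (w k))\<^sup>2 - 0) < e" by simp
    qed
  qed
  then have "(\<lambda>k. sqrt ((nc_norm \<phi> 2 (w k))\<^sup>2)) \<longlonglongrightarrow> sqrt 0"
    by (intro tendsto_intros)
  then show ?thesis by (simp add: nn)
qed

lemma nc_Cauchy_diff:
  assumes u: "nc_Cauchy M \<phi> 2 u" and v: "nc_Cauchy M \<phi> 2 v"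
  shows "nc_Cauchy M \<phi> 2 (\<lambda>k. u k - v k)"
  unfolding nc_Cauchy_def
proof (intro conjI allI impI)
  note M = nc_CauchyD[OF u] nc_CauchyD[OF v] M_intros
  show "u k - v k \<in> M" for k by (simp add: M)
  fix e :: real assume "0 < e"
  then have "0 < e / 2" by simp
  then obtain N N' where N: "\<And>m n. m \<ge> N \<Longrightarrow> n \<ge> N \<Longrightarrow> nc_norm \<phi> 2 (u m - u n) < e / 2"
    and N': "\<And>m n. m \<ge> N' \<Longrightarrow> n \<ge> N' \<Longrightarrow> nc_norm \<phi> 2 (v m - v n) < e / 2"
    using u v unfolding nc_Cauchy_def by metis
  show "\<exists>N. \<forall>m\<ge>N. \<forall>n\<ge>N. nc_norm \<phi> 2 (u m - v m - (u n - v n)) < e"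
  proof (intro exI[of _ "max N N'"] allI impI)
    fix m n assume "max N N' \<le> m" "max N N' \<le> n"
    then have "nc_norm \<phi> 2 (u m - u n) < e / 2" "nc_norm \<phi> 2 (v n - v m) < e / 2"
      using N N' by auto
    moreover have "u m - v m - (u n - v n) = (u m - u n) + (v n - v m)" by simp
    moreover have "nc_norm \<phi> 2 ((u m - u n) + (v n - v m)) \<le> nc_norm \<phi> 2 (u m - u n) + nc_norm \<phi> 2 (v n - v m)"
      by (intro nc_norm_2_triangle M)
    ultimately show "nc_norm \<phi> 2 (u m - v m - (u n - v n)) < e" by (simp only:)
  qed
qed

lemma nc_class_diff_null_2:
  assumes "nc_Cauchy M \<phi> 1 u" and "v \<in> nc_class M \<phi> u" and "w \<in> nc_class M \<phi> u"
    and "nc_Cauchy M \<phi> 2 v" and "nc_Cauchy M \<phi> 2 w"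
  shows "(\<lambda>k. nc_norm \<phi> 2 (v k - w k)) \<longlonglongrightarrow> 0"
  using assms by (intro nc_norm_1_null_imp_2_null nc_Cauchy_diff nc_class_diff_null[of u])

section \<open>Distances and moments do not depend on representatives\<close>

lemma nc_norm_2_diff_bound:
  assumes "a \<in> M" "b \<in> M" "c \<in> M" "d \<in> M"
  shows "\<bar>nc_norm \<phi> 2 (a - b) - nc_norm \<phi> 2 (c - d)\<bar> \<le> nc_norm \<phi> 2 (a - c) + nc_norm \<phi> 2 (b - d)"
proof -
  have tri: "nc_norm \<phi> 2 (x - z) \<le> nc_norm \<phi> 2 (x - y) + nc_norm \<phi> 2 (y - z)"
    if "x \<in> M" "y \<in> M" "z \<in> M" for x y z
    using that by (intro nc_norm_triangle_diff) (auto intro: exI[of _ 0])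
  show ?thesis
    using tri[of a c b] tri[of c d b] tri[of c a d] tri[of a b d] assms
      nc_norm_minus_commute[of a c 2] nc_norm_minus_commute[of b d 2]
    by simp
qed

text \<open>Two representatives of a class that are Cauchy in the 2-norm differ by a null sequence
  in the 2-norm, so any pair of representatives yields the same limit.\<close>

lemma nc_dist_eqI:
  assumes u: "nc_Cauchy M \<phi> 2 u" and v: "nc_Cauchy M \<phi> 2 v"
    and d: "(\<lambda>k. nc_norm \<phi> 2 (u k - v k)) \<longlonglongrightarrow> d"
  shows "nc_dist M \<phi> 2 (nc_class M \<phi> u) (nc_class M \<phi> v) = d"
  unfolding nc_dist_def
proof (rule the_equality)
  have self: "u \<in> nc_class M \<phi> u" "v \<in> nc_class M \<phi> v"
    using nc_class_self[OF nc_Cauchy_2_imp_1[OF u]] nc_class_self[OF nc_Cauchy_2_imp_1[OF v]]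
    by auto
  then show "e = d" if "\<forall>u\<in>nc_class M \<phi> u. \<forall>v\<in>nc_class M \<phi> v. nc_Cauchy M \<phi> 2 u \<longrightarrow>
      nc_Cauchy M \<phi> 2 v \<longrightarrow> (\<lambda>k. nc_norm \<phi> 2 (u k - v k)) \<longlonglongrightarrow> e" for e
    using that u v d LIMSEQ_unique by blast
  show "\<forall>u'\<in>nc_class M \<phi> u. \<forall>v'\<in>nc_class M \<phi> v. nc_Cauchy M \<phi> 2 u' \<longrightarrow>
      nc_Cauchy M \<phi> 2 v' \<longrightarrow> (\<lambda>k. nc_norm \<phi> 2 (u' k - v' k)) \<longlonglongrightarrow> d"
  proof (intro ballI impI)
    fix u' v' assume *: "u' \<in> nc_class M \<phi> u" "v' \<in> nc_class M \<phi> v" "nc_Cauchy M \<phi> 2 u'" "nc_Cauchy M \<phi> 2 v'"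
    have null: "(\<lambda>k. nc_norm \<phi> 2 (u' k - u k) + nc_norm \<phi> 2 (v' k - v k)) \<longlonglongrightarrow> 0 + 0"
      by (intro tendsto_add nc_class_diff_null_2[OF nc_Cauchy_2_imp_1[OF u]]
          nc_class_diff_null_2[OF nc_Cauchy_2_imp_1[OF v]] * u v self)
    have "(\<lambda>k. nc_norm \<phi> 2 (u' k - v' k) - nc_norm \<phi> 2 (u k - v k)) \<longlonglongrightarrow> 0"
    proof (rule Lim_null_comparison)
      show "\<forall>\<^sub>F k in sequentially. norm (nc_norm \<phi> 2 (u' k - v' k) - nc_norm \<phi> 2 (u k - v k))
          \<le> nc_norm \<phi> 2 (u' k - u k) + nc_norm \<phi> 2 (v' k - v k)"
        using nc_norm_2_diff_bound nc_CauchyD *(3,4) u v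
        by (intro always_eventually) (auto simp del: of_nat_numeral)
      show "(\<lambda>k. nc_norm \<phi> 2 (u' k - u k) + nc_norm \<phi> 2 (v' k - v k)) \<longlonglongrightarrow> 0"
        using null by simp
    qed
    from tendsto_add[OF this d] show "(\<lambda>k. nc_norm \<phi> 2 (u' k - v' k)) \<longlonglongrightarrow> d" by simp
  qed
qed

lemma nc_norm_2_diff_convergent:
  assumes u: "nc_Cauchy M \<phi> 2 u" and v: "nc_Cauchy M \<phi> 2 v"
  shows "convergent (\<lambda>k. nc_norm \<phi> 2 (u k - v k))"
proof -
  note M = nc_CauchyD[OF u] nc_CauchyD[OF v]
  have "Cauchy (\<lambda>k. nc_norm \<phi> 2 (u k - v k))"
  proof (rule CauchyI)
    fix e :: real assume "0 < e"
    then have "0 < e / 2" by simp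
    then obtain N N' where N: "\<And>m n. m \<ge> N \<Longrightarrow> n \<ge> N \<Longrightarrow> nc_norm \<phi> 2 (u m - u n) < e / 2"
      and N': "\<And>m n. m \<ge> N' \<Longrightarrow> n \<ge> N' \<Longrightarrow> nc_norm \<phi> 2 (v m - v n) < e / 2"
      using u v unfolding nc_Cauchy_def by metis
    show "\<exists>N. \<forall>m\<ge>N. \<forall>n\<ge>N. norm (nc_norm \<phi> 2 (u m - v m) - nc_norm \<phi> 2 (u n - v n)) < e"
    proof (intro exI[of _ "max N N'"] allI impI)
      fix m n assume "max N N' \<le> m" "max N N' \<le> n"
      then have "nc_norm \<phi> 2 (u m - u n) < e / 2" "nc_norm \<phi> 2 (v m - v n) < e / 2"
        using N N' by auto
      then show "norm (nc_norm \<phi> 2 (u m - v m) - nc_norm \<phi> 2 (u n - v n)) < e"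
        using nc_norm_2_diff_bound[OF M(1) M(2) M(1) M(2), of m m n n] by simp
    qed
  qed
  then show ?thesis by (rule Cauchy_convergent)
qed

text \<open>Factors u are exchanged for v one at a time. Each exchange costs the 2-norm of u - v
  times the 2-norm of the remaining word, which Hoelder bounds uniformly in k.\<close>

lemma phi_op_pow_diff_null:
  assumes u: "\<And>p. 1 \<le> p \<Longrightarrow> nc_Cauchy M \<phi> p u" and v: "\<And>p. 1 \<le> p \<Longrightarrow> nc_Cauchy M \<phi> p v"
    and null: "(\<lambda>k. nc_norm \<phi> 2 (u k - v k)) \<longlonglongrightarrow> 0"
  shows "(\<lambda>k. \<phi> (op_pow (u k) j) - \<phi> (op_pow (v k) j)) \<longlonglongrightarrow> 0"
proof -
  have uM: "u k \<in> M" and vM: "v k \<in> M" for k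
    using u[of 1] v[of 1] by (auto intro: nc_CauchyD)
  note M = uM vM M_intros
  have step: "(\<lambda>k. \<phi> (op_pow (u k) (Suc i) o\<^sub>L op_pow (v k) l)
      - \<phi> (op_pow (u k) i o\<^sub>L op_pow (v k) (Suc l))) \<longlonglongrightarrow> 0" for i l
  proof -
    define m where "m = i + l"
    \<comment> \<open>The word \<open>xs\<close> below has 2 m letters and has to fit into the
      exponent \<open>2 ^ Suc m\<close>.\<close>
    have m: "2 * m \<le> 2 ^ Suc m" using less_exp[of m] by simp
    obtain Bu Bv where Bu: "1 \<le> Bu" "\<And>k. dyadic_norm m (u k) \<le> Bu"
      and Bv: "1 \<le> Bv" "\<And>k. dyadic_norm m (v k) \<le> Bv"
      using nc_Cauchy_bounded[OF u] nc_Cauchy_bounded[OF v]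
      by (metis one_le_numeral one_le_power)
    define B where "B = max Bu Bv"
    let ?a = "\<lambda>k. op_pow (v k) l o\<^sub>L op_pow (u k) i"
    have bound: "nc_norm \<phi> 2 (?a k) \<le> B ^ m" for k
    proof -
      define xs where "xs = replicate i (adj (u k)) @ replicate l (adj (v k)) @ replicate l (v k) @ replicate i (u k)"
      have adj_pow: "adj (op_pow b n) = op_pow (adj b) n" if "b \<in> M" for b n
      proof (induction n)
        case (Suc n)
        have "adj (op_pow b (Suc n)) = adj b o\<^sub>L adj (op_pow b n)"
          using that by (simp only: op_pow_Suc_right adj_M_simps(5) M_intros)
        with Suc show ?case by (simp add: op_pow_Suc)
      qed simp
      have "adj (?a k) o\<^sub>L ?a k = op_prod xs"
        unfolding xs_def op_prod_append op_prod_replicate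
        by (simp add: adj_M_simps adj_pow M compose_assoc)
      moreover have "cmod (\<phi> (op_prod xs)) \<le> B ^ length xs"
      proof (rule op_prod_bound)
        show "set xs \<subseteq> M" by (auto simp: xs_def M)
        show "length xs \<le> 2 ^ Suc m" using m by (simp add: xs_def m_def)
        show "dyadic_norm m x \<le> B" if "x \<in> set xs" for x
          using that Bu(2)[of k] Bv(2)[of k]
          by (auto simp: xs_def B_def dyadic_norm_adj M simp del: power_Suc split: if_splits)
      qed
      moreover have "length xs = m * 2" by (simp add: xs_def m_def)
      ultimately have "(nc_norm \<phi> 2 (?a k))\<^sup>2 \<le> (B ^ m)\<^sup>2"
        using complex_Re_le_cmod[of "\<phi> (op_prod xs)"] by (simp add: nc_norm_2_square M power_mult)
      then show ?thesis by (rule power2_le_imp_le) (use Bu(1) in \<open>simp add: B_def\<close>)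
    qed
    show ?thesis
    proof (rule Lim_null_comparison)
      show "\<forall>\<^sub>F k in sequentially. norm (\<phi> (op_pow (u k) (Suc i) o\<^sub>L op_pow (v k) l)
          - \<phi> (op_pow (u k) i o\<^sub>L op_pow (v k) (Suc l))) \<le> B ^ m * nc_norm \<phi> 2 (u k - v k)"
      proof (intro always_eventually allI)
        fix k
        let ?d = "u k - v k"
        have "(op_pow (u k) (Suc i) o\<^sub>L op_pow (v k) l) - (op_pow (u k) i o\<^sub>L op_pow (v k) (Suc l))
            = op_pow (u k) i o\<^sub>L (?d o\<^sub>L op_pow (v k) l)"
          by (simp add: op_pow_Suc_right[of "u k"] op_pow_Suc[of "v k"] compose_assoc
              compose.diff_left compose.diff_right)
        then have "\<phi> (op_pow (u k) (Suc i) o\<^sub>L op_pow (v k) l) - \<phi> (op_pow (u k) i o\<^sub>L op_pow (v k) (Suc l))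
            = \<phi> (op_pow (u k) i o\<^sub>L (?d o\<^sub>L op_pow (v k) l))"
          by (simp add: M flip: phi_diff)
        \<comment> \<open>Cyclicity moves the power of u to the end, so that one Cauchy-Schwarz
          separates the difference from the bounded word.\<close>
        also have "\<dots> = \<phi> (adj (adj ?d) o\<^sub>L ?a k)"
          using tracial[of "op_pow (u k) i" "?d o\<^sub>L op_pow (v k) l"] adj_M_simps(6)[of ?d]
          by (simp add: M compose_assoc)
        finally have "norm (\<phi> (op_pow (u k) (Suc i) o\<^sub>L op_pow (v k) l) - \<phi> (op_pow (u k) i o\<^sub>L op_pow (v k) (Suc l)))
            \<le> nc_norm \<phi> 2 (?a k) * nc_norm \<phi> 2 (adj ?d)"
          by (simp only:) (intro phi_compose_nc_norm_2 M)
        also have "nc_norm \<phi> 2 (adj ?d) = nc_norm \<phi> 2 ?d"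
          using dyadic_norm_adj[of ?d 0] by (simp add: M)
        also have "nc_norm \<phi> 2 (?a k) * nc_norm \<phi> 2 ?d \<le> B ^ m * nc_norm \<phi> 2 ?d"
          by (intro mult_right_mono bound nc_norm_nonneg M) simp
        finally show "norm (\<phi> (op_pow (u k) (Suc i) o\<^sub>L op_pow (v k) l)
          - \<phi> (op_pow (u k) i o\<^sub>L op_pow (v k) (Suc l))) \<le> B ^ m * nc_norm \<phi> 2 ?d" .
      qed
      show "(\<lambda>k. B ^ m * nc_norm \<phi> 2 (u k - v k)) \<longlonglongrightarrow> 0"
        using tendsto_mult_left[OF null, of "B ^ m"] by simp
    qed
  qed
  have "(\<lambda>k. \<phi> (op_pow (u k) (i + l)) - \<phi> (op_pow (u k) i o\<^sub>L op_pow (v k) l)) \<longlonglongrightarrow> 0" for i l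
  proof (induction l arbitrary: i)
    case (Suc l)
    from tendsto_add[OF Suc[of "Suc i"] step[of i l]] show ?case by simp
  qed simp
  from this[of 0 j] show ?thesis by simp
qed

lemma nc_moment_eqI:
  assumes u: "\<And>p. 1 \<le> p \<Longrightarrow> nc_Cauchy M \<phi> p u"
    and c: "(\<lambda>k. \<phi> (op_pow (u k) j)) \<longlonglongrightarrow> c"
  shows "nc_moment M \<phi> (nc_class M \<phi> u) j = c"
  unfolding nc_moment_def
proof (rule the_equality)
  have self: "u \<in> nc_class M \<phi> u" using u[of 1] by (simp add: nc_class_self)
  then show "d = c" if "\<forall>v\<in>nc_class M \<phi> u. (\<forall>p\<ge>1. nc_Cauchy M \<phi> p v) \<longrightarrow>
      (\<lambda>k. \<phi> (op_pow (v k) j)) \<longlonglongrightarrow> d" for d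
    using that u c LIMSEQ_unique by blast
  show "\<forall>v\<in>nc_class M \<phi> u. (\<forall>p\<ge>1. nc_Cauchy M \<phi> p v) \<longrightarrow> (\<lambda>k. \<phi> (op_pow (v k) j)) \<longlonglongrightarrow> c"
  proof (intro ballI impI)
    fix v assume v: "v \<in> nc_class M \<phi> u" "\<forall>p\<ge>1. nc_Cauchy M \<phi> p v"
    have "(\<lambda>k. nc_norm \<phi> 2 (v k - u k)) \<longlonglongrightarrow> 0"
      using u v self by (intro nc_class_diff_null_2[of u]) auto
    then have "(\<lambda>k. \<phi> (op_pow (v k) j) - \<phi> (op_pow (u k) j)) \<longlonglongrightarrow> 0"
      using u v by (intro phi_op_pow_diff_null) auto
    from tendsto_add[OF this c] show "(\<lambda>k. \<phi> (op_pow (v k) j)) \<longlonglongrightarrow> c" by simp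
  qed
qed

text \<open>For self-adjoint elements the bound of \<open>nc_norm_le_double\<close> is an ordinary
  moment of order 2 p. The product filter expresses that both indices tend to infinity
  independently.\<close>

lemma nc_Cauchy_selfadjointI:
  assumes M: "\<And>k. u k \<in> M" and sa: "\<And>k. adj (u k) = u k" and p: "1 \<le> p"
    and lim: "((\<lambda>(k, l). Re (\<phi> (op_pow (u k - u l) (2 * p)))) \<longlongrightarrow> 0) (sequentially \<times>\<^sub>F sequentially)"
  shows "nc_Cauchy M \<phi> p u"
  unfolding nc_Cauchy_def
proof (intro conjI allI impI M)
  fix e :: real assume "0 < e"
  have "((\<lambda>z. root p (sqrt (case z of (k, l) \<Rightarrow> Re (\<phi> (op_pow (u k - u l) (2 * p))))))
      \<longlongrightarrow> root p (sqrt 0)) (sequentially \<times>\<^sub>F sequentially)"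
    by (intro tendsto_real_root tendsto_real_sqrt lim)
  then have "\<forall>\<^sub>F z in sequentially \<times>\<^sub>F sequentially.
      root p (sqrt (case z of (k, l) \<Rightarrow> Re (\<phi> (op_pow (u k - u l) (2 * p))))) < e"
    using \<open>0 < e\<close> by (intro order_tendstoD(2)) auto
  then obtain N where N: "\<And>k l. k \<ge> N \<Longrightarrow> l \<ge> N \<Longrightarrow> root p (sqrt (Re (\<phi> (op_pow (u k - u l) (2 * p))))) < e"
    by (auto simp: eventually_prod_sequentially)
  show "\<exists>N. \<forall>m\<ge>N. \<forall>n\<ge>N. nc_norm \<phi> p (u m - u n) < e"
  proof (intro exI[of _ N] allI impI)
    fix k l assume "N \<le> k" "N \<le> l"
    have "adj (u k - u l) = u k - u l" by (simp add: adj_M_simps M sa)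
    then have "nc_norm \<phi> p (u k - u l) \<le> root p (sqrt (Re (\<phi> (op_pow (u k - u l) (2 * p)))))"
      using nc_norm_le_double[of "u k - u l" p] p by (simp add: M M_intros op_pow_mult op_pow_2)
    also have "\<dots> < e" using N \<open>N \<le> k\<close> \<open>N \<le> l\<close> by simp
    finally show "nc_norm \<phi> p (u k - u l) < e" .
  qed
qed

end

unbundle no vec_syntax
unbundle fps_syntax

section \<open>Noncrossing partitions and free cumulants\<close>

definition noncrossing :: "nat set set \<Rightarrow> bool" where
  "noncrossing P \<longleftrightarrow> (\<forall>B\<in>P. \<forall>C\<in>P. \<forall>x y z w. x < y \<longrightarrow> y < z \<longrightarrow> z < w \<longrightarrow>
     x \<in> B \<longrightarrow> z \<in> B \<longrightarrow> y \<in> C \<longrightarrow> w \<in> C \<longrightarrow> B = C)"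

lemma noncrossingD:
  "noncrossing P \<Longrightarrow> B \<in> P \<Longrightarrow> C \<in> P \<Longrightarrow> x < y \<Longrightarrow> y < z \<Longrightarrow> z < w \<Longrightarrow>
    x \<in> B \<Longrightarrow> z \<in> B \<Longrightarrow> y \<in> C \<Longrightarrow> w \<in> C \<Longrightarrow> B = C"
  unfolding noncrossing_def by blast

definition nc_part :: "nat set \<Rightarrow> nat set set set" where
  "nc_part A = {P. partition_on A P \<and> noncrossing P}"

lemma noncrossing_partitions_eq: "noncrossing_partitions n = nc_part {1..n}"
  unfolding noncrossing_partitions_def nc_part_def noncrossing_def by blast

lemma finite_nc_part: "finite A \<Longrightarrow> finite (nc_part A)"
  unfolding nc_part_def by (rule finite_subset[OF _ finitely_many_partition_on[of A]]) auto

lemma nc_partD: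
  assumes "P \<in> nc_part A"
  shows "\<Union>P = A" and "B \<in> P \<Longrightarrow> C \<in> P \<Longrightarrow> x \<in> B \<Longrightarrow> x \<in> C \<Longrightarrow> B = C" and "{} \<notin> P"
    and "noncrossing P" and "B \<in> P \<Longrightarrow> B \<subseteq> A" and "finite A \<Longrightarrow> B \<in> P \<Longrightarrow> finite B"
    and "finite A \<Longrightarrow> finite P"
proof -
  have P: "partition_on A P" "noncrossing P" using assms by (auto simp: nc_part_def)
  show "\<Union>P = A" "{} \<notin> P" "B \<in> P \<Longrightarrow> B \<subseteq> A" using P by (auto simp: partition_on_def)
  then show "finite A \<Longrightarrow> B \<in> P \<Longrightarrow> finite B" by (metis finite_subset)
  show "B \<in> P \<Longrightarrow> C \<in> P \<Longrightarrow> x \<in> B \<Longrightarrow> x \<in> C \<Longrightarrow> B = C"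
    using P(1) by (auto simp: partition_on_def disjoint_def)
  show "noncrossing P" by (rule P)
  show "finite A \<Longrightarrow> finite P" using P(1) by (rule finite_elements[rotated])
qed

lemma nc_partI:
  assumes "\<Union>P = A" and "\<And>B C x. B \<in> P \<Longrightarrow> C \<in> P \<Longrightarrow> x \<in> B \<Longrightarrow> x \<in> C \<Longrightarrow> B = C" and "{} \<notin> P"
    and "noncrossing P"
  shows "P \<in> nc_part A"
  using assms unfolding nc_part_def partition_on_def disjoint_def by blast

definition nc_sum :: "(nat \<Rightarrow> 'a::comm_ring_1) \<Rightarrow> nat set \<Rightarrow> 'a" where
  "nc_sum \<kappa> A = (\<Sum>P\<in>nc_part A. \<Prod>B\<in>P. \<kappa> (card B))"

text \<open>
  The block of \<open>a\<close> counts as if it had \<open>s\<close> further elements.  Cutting this block after \<open>a\<close> yields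
  a recursion in which no other quantities occur.
\<close>

definition nc_sum_open :: "(nat \<Rightarrow> 'a::comm_ring_1) \<Rightarrow> nat \<Rightarrow> nat \<Rightarrow> nat set \<Rightarrow> 'a" where
  "nc_sum_open \<kappa> s a A = (\<Sum>P\<in>nc_part A. \<Prod>B\<in>P. \<kappa> (card B + (if a \<in> B then s else 0)))"

lemma nc_sum_open_0: "nc_sum_open \<kappa> 0 a A = nc_sum \<kappa> A"
  by (simp add: nc_sum_open_def nc_sum_def)

lemma nc_sum_empty: "nc_sum \<kappa> {} = 1"
proof -
  have "nc_part {} = {{}}"
    by (auto simp: nc_part_def noncrossing_def partition_on_def)
  then show ?thesis by (simp add: nc_sum_def)
qed

text \<open>A noncrossing partition of \<open>{a..<c}\<close> in which a is not alone arises exactly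
  once in this way, where b is the successor of a in its block: P fills the gap between a and b, and
  a is attached to the block of b. The next three definitions recover b, P and Q.\<close>

definition nc_join :: "nat \<Rightarrow> nat \<Rightarrow> nat set set \<Rightarrow> nat set set \<Rightarrow> nat set set" where
  "nc_join a b P Q = P \<union> (\<lambda>B. if b \<in> B then insert a B else B) ` Q"

definition nc_next :: "nat \<Rightarrow> nat set set \<Rightarrow> nat" where
  "nc_next a P = Min {x. x \<noteq> a \<and> (\<exists>B\<in>P. a \<in> B \<and> x \<in> B)}"

definition nc_lower :: "nat \<Rightarrow> nat \<Rightarrow> nat set set \<Rightarrow> nat set set" where
  "nc_lower a b P = {B \<in> P. B \<subseteq> {Suc a..<b}}"

definition nc_upper :: "nat \<Rightarrow> nat \<Rightarrow> nat set set \<Rightarrow> nat set set" where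
  "nc_upper a b P = (\<lambda>B. B - {a}) ` (P - nc_lower a b P)"

text \<open>The first half of the bijection. In the weight, the element a removed from its block is
  remembered by passing from s to \<open>Suc s\<close>.\<close>

lemma nc_join:
  assumes b: "b \<in> {Suc a..<c}" and P: "P \<in> nc_part {Suc a..<b}" and Q: "Q \<in> nc_part {b..<c}"
  shows "nc_join a b P Q \<in> nc_part {a..<c}" and "{a} \<notin> nc_join a b P Q"
    and "nc_next a (nc_join a b P Q) = b" and "nc_lower a b (nc_join a b P Q) = P"
    and "nc_upper a b (nc_join a b P Q) = Q"
    and "(\<Prod>B\<in>nc_join a b P Q. \<kappa> (card B + (if a \<in> B then s else 0))) =
      (\<Prod>B\<in>P. \<kappa> (card B)) * (\<Prod>B\<in>Q. \<kappa> (card B + (if b \<in> B then Suc s else 0)))"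
proof -
  define g where "g B = (if b \<in> B then insert a B else B)" for B
  let ?J = "nc_join a b P Q"
  have J: "?J = P \<union> g ` Q" by (simp add: nc_join_def g_def)
  note PD = nc_partD[OF P] and QD = nc_partD[OF Q]
  have Psub: "x \<in> B \<Longrightarrow> a < x \<and> x < b" if "B \<in> P" for x B
    using PD(5)[OF that] by auto
  have Qsub: "x \<in> B \<Longrightarrow> b \<le> x \<and> x < c" if "B \<in> Q" for x B
    using QD(5)[OF that] by auto
  have g_iff: "x \<in> g B \<longleftrightarrow> x \<in> B \<or> (x = a \<and> b \<in> B)" for x B
    by (auto simp: g_def)
  have g_minus: "g B - {a} = B" if "B \<in> Q" for B
  proof -
    have "a \<notin> B" using Qsub[OF that, of a] b by auto
    then show ?thesis by (auto simp: g_def)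
  qed
  obtain B0 where B0: "B0 \<in> Q" "b \<in> B0"
    using QD(1) b by (metis UnionE atLeastLessThan_iff order_refl)
  show "?J \<in> nc_part {a..<c}"
  proof (rule nc_partI)
    show "\<Union>?J = {a..<c}"
    proof -
      have "\<Union>(g ` Q) = insert a (\<Union>Q)" using B0 by (auto simp: g_iff)
      then have "\<Union>?J = {Suc a..<b} \<union> insert a {b..<c}" by (simp add: J PD(1) QD(1))
      then show ?thesis using b by auto
    qed
    show "{} \<notin> ?J" using PD(3) QD(3) by (auto simp: J g_def)
    show "B = C" if BC: "B \<in> ?J" "C \<in> ?J" "x \<in> B" "x \<in> C" for B C x
    proof -
      have "B = C" if "B \<in> P" "C \<in> P" using PD(2) that BC by blast
      moreover have False if "B \<in> P" "C \<in> g ` Q" "x \<in> B" "x \<in> C" for B C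
        using Psub[OF that(1,3)] that(2,4) Qsub by (fastforce simp: g_iff)
      moreover have "B = C" if gQ: "B \<in> g ` Q" "C \<in> g ` Q"
      proof -
        obtain B' C' where B': "B' \<in> Q" "B = g B'" "C' \<in> Q" "C = g C'"
          using gQ by (meson imageE)
        have "a \<notin> B'" "a \<notin> C'" using Qsub[OF B'(1), of a] Qsub[OF B'(3), of a] b by auto
        moreover have "x \<in> g B'" "x \<in> g C'" using BC(3,4) B' by simp_all
        ultimately have "\<exists>y. y \<in> B' \<and> y \<in> C'" unfolding g_iff by auto
        then have "B' = C'" using QD(2)[OF B'(1,3)] by blast
        then show ?thesis using B' by simp
      qed
      ultimately show ?thesis using BC unfolding J by blast
    qed
    show "noncrossing ?J"
      unfolding noncrossing_def
    proof (intro ballI allI impI)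
      fix B C x y z w
      assume BC: "B \<in> ?J" "C \<in> ?J" and lt: "x < y" "y < z" "z < w"
        and mem: "x \<in> B" "z \<in> B" "y \<in> C" "w \<in> C"
      \<comment> \<open>Blocks of P lie strictly between a and b, the others avoid this gap; hence
        blocks of different kinds cannot interleave.\<close>
      consider "B \<in> P" "C \<in> P" | "B \<in> P" "C \<in> g ` Q" | "B \<in> g ` Q" "C \<in> P"
        | "B \<in> g ` Q" "C \<in> g ` Q" using BC unfolding J by blast
      then show "B = C"
      proof cases
        case 1
        then show ?thesis using noncrossingD[OF PD(4)] lt mem by blast
      next
        case 2
        then have "a < x" "z < b" using Psub mem by blast+
        then have "y \<noteq> a" "\<not> b \<le> y" using lt by auto
        then show ?thesis using 2 mem(3) Qsub by (auto simp: g_iff)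
      next
        case 3
        then have "a < y" "w < b" using Psub mem by blast+
        then have "z \<noteq> a" "\<not> b \<le> z" using lt by auto
        then show ?thesis using 3 mem(2) Qsub by (auto simp: g_iff)
      next
        case 4
        then obtain B' C' where B': "B' \<in> Q" "B = g B'" "C' \<in> Q" "C = g C'"
          by (meson imageE)
        have xa: "a \<le> x" using mem(1) Qsub[OF B'(1), of x] b by (auto simp: B'(2) g_iff)
        then have mem': "z \<in> B'" "y \<in> C'" "w \<in> C'" using lt mem by (auto simp: B' g_iff)
        have "B' = C'"
        proof (cases "x = a")
          case False
          then have "x \<in> B'" using mem by (auto simp: B' g_iff)
          then show ?thesis using noncrossingD[OF QD(4) B'(1,3) lt] mem' by blast
        next
          \<comment> \<open>A crossing that starts in a can be started in b instead, unless y = b,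
            in which case the two blocks meet.\<close>
          case True
          then have bB: "b \<in> B'" using mem(1) Qsub[OF B'(1), of a] b by (auto simp: B'(2) g_iff)
          show ?thesis
          proof (cases "y = b")
            case True
            then show ?thesis using QD(2) B' bB mem' by blast
          next
            case False
            then have "b < y" using Qsub[OF B'(3) mem'(2)] by simp
            then show ?thesis using noncrossingD[OF QD(4) B'(1,3) _ lt(2,3) bB] mem' by blast
          qed
        qed
        then show ?thesis using B' by simp
      qed
    qed
  qed
  show "{a} \<notin> ?J"
  proof
    assume "{a} \<in> ?J"
    then consider "{a} \<in> P" | B where "B \<in> Q" "{a} = g B" unfolding J by blast
    then show False
    proof cases
      case 1
      then show False using Psub by blast
    next
      case 2
      then have "B = {}" using g_minus by (metis Diff_cancel)
      then show False using 2 QD(3) by simp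
    qed
  qed
  have block: "B = g B0" if "B \<in> ?J" "a \<in> B" for B
  proof -
    have "B \<notin> P" using Psub that(2) by blast
    then have "B \<in> g ` Q" using that(1) unfolding J by blast
    then obtain B' where B': "B' \<in> Q" "B = g B'" by (meson imageE)
    then have "b \<in> B'" using that(2) Qsub b by (fastforce simp: g_iff)
    then show ?thesis using QD(2) B' B0 by blast
  qed
  have "g B0 \<in> ?J" "a \<in> g B0" using B0 by (auto simp: J g_iff)
  then have "{x. x \<noteq> a \<and> (\<exists>B\<in>?J. a \<in> B \<and> x \<in> B)} = g B0 - {a}"
    using block by blast
  then have "nc_next a ?J = Min B0" by (simp add: nc_next_def g_minus B0)
  also have "\<dots> = b"
    using B0 Qsub QD(6) by (intro Min_eqI) auto
  finally show "nc_next a ?J = b" .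
  have notlow: "\<not> g B \<subseteq> {Suc a..<b}" if B: "B \<in> Q" for B
  proof -
    obtain x where "x \<in> B" using QD(3) B by (metis ex_in_conv)
    then show ?thesis using Qsub[OF B, of x] by (auto simp: g_def)
  qed
  show low: "nc_lower a b ?J = P"
    unfolding nc_lower_def J using notlow PD(5) by blast
  have "?J - P = g ` Q" using notlow PD(5) unfolding J by blast
  then show "nc_upper a b ?J = Q"
    unfolding nc_upper_def low by (simp add: image_image g_minus)
  have inj: "inj_on g Q" by (rule inj_on_inverseI[where g = "\<lambda>B. B - {a}"]) (rule g_minus)
  have "(\<Prod>B\<in>?J. \<kappa> (card B + (if a \<in> B then s else 0))) =
      (\<Prod>B\<in>P. \<kappa> (card B + (if a \<in> B then s else 0))) * (\<Prod>B\<in>g ` Q. \<kappa> (card B + (if a \<in> B then s else 0)))"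
    unfolding J using notlow PD(5,7) QD(7) by (intro prod.union_disjoint) auto
  also have "(\<Prod>B\<in>P. \<kappa> (card B + (if a \<in> B then s else 0))) = (\<Prod>B\<in>P. \<kappa> (card B))"
    using Psub by (intro prod.cong) auto
  also have "(\<Prod>B\<in>g ` Q. \<kappa> (card B + (if a \<in> B then s else 0)))
      = (\<Prod>B\<in>Q. \<kappa> (card B + (if b \<in> B then Suc s else 0)))"
    unfolding prod.reindex[OF inj] o_def
  proof (intro prod.cong refl)
    fix B assume B: "B \<in> Q"
    have "a \<notin> B" using Qsub[OF B, of a] b by auto
    then show "\<kappa> (card (g B) + (if a \<in> g B then s else 0)) = \<kappa> (card B + (if b \<in> B then Suc s else 0))"
      using QD(6)[OF _ B] by (simp add: g_def)
  qed
  finally show "(\<Prod>B\<in>?J. \<kappa> (card B + (if a \<in> B then s else 0))) =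
      (\<Prod>B\<in>P. \<kappa> (card B)) * (\<Prod>B\<in>Q. \<kappa> (card B + (if b \<in> B then Suc s else 0)))" .
qed

text \<open>The second half of the bijection. Since a and b lie in one block, a block that meets the
  gap between them and also leaves it would cross that block.\<close>

lemma nc_split:
  assumes R: "R \<in> nc_part {a..<c}" and "a < c" and na: "{a} \<notin> R"
  defines "b \<equiv> nc_next a R"
  shows "b \<in> {Suc a..<c}" and "nc_lower a b R \<in> nc_part {Suc a..<b}"
    and "nc_upper a b R \<in> nc_part {b..<c}" and "nc_join a b (nc_lower a b R) (nc_upper a b R) = R"
proof -
  note RD = nc_partD[OF R]
  obtain B0 where B0: "B0 \<in> R" "a \<in> B0"
    using RD(1) \<open>a < c\<close> by (metis UnionE atLeastLessThan_iff order_refl)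
  have Rsub: "x \<in> B \<Longrightarrow> a \<le> x \<and> x < c" if "B \<in> R" for x B
    using RD(5)[OF that] by auto
  have "{x. x \<noteq> a \<and> (\<exists>B\<in>R. a \<in> B \<and> x \<in> B)} = B0 - {a}"
    using RD(2)[OF B0(1)] B0 by blast
  then have b_Min: "b = Min (B0 - {a})" by (simp add: b_def nc_next_def)
  have fin: "finite (B0 - {a})" using RD(6) B0 by simp
  have "B0 - {a} \<noteq> {}"
  proof
    assume "B0 - {a} = {}"
    then have "B0 = {a}" using B0 by auto
    then show False using na B0 by simp
  qed
  then have bB: "b \<in> B0" "b \<noteq> a" using Min_in[OF fin] by (auto simp: b_Min)
  have b_le: "b \<le> x" if "x \<in> B0" "x \<noteq> a" for x
    using Min_le[OF fin] that by (simp add: b_Min)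
  show b: "b \<in> {Suc a..<c}" using Rsub[OF B0(1) bB(1)] bB(2) by auto
  have dich: "B \<subseteq> {Suc a..<b} \<or> B \<inter> {Suc a..<b} = {}" if B: "B \<in> R" for B
  proof (cases "B = B0")
    case True
    have "B0 \<inter> {Suc a..<b} = {}" using b_le by fastforce
    then show ?thesis using True by simp
  next
    case False
    have aB: "a \<notin> B" "b \<notin> B" using False RD(2) B B0 bB by blast+
    show ?thesis
    proof (rule disjCI)
      assume "B \<inter> {Suc a..<b} \<noteq> {}"
      then obtain x where x: "x \<in> B" "a < x" "x < b"
        by (metis IntE Suc_le_eq atLeastLessThan_iff ex_in_conv)
      show "B \<subseteq> {Suc a..<b}"
      proof
        fix y assume y: "y \<in> B"
        have "\<not> b < y"
          using noncrossingD[OF RD(4) B0(1) B x(2,3) _ B0(2) bB(1) x(1) y] False by blast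
        moreover have "y \<noteq> b" "y \<noteq> a" using y aB by auto
        ultimately show "y \<in> {Suc a..<b}" using Rsub[OF B y] by auto
      qed
    qed
  qed
  let ?L = "nc_lower a b R" and ?U = "nc_upper a b R"
  have notL: "B \<subseteq> insert a {b..<c}" if "B \<in> R" "B \<notin> ?L" for B
  proof
    fix x assume "x \<in> B"
    moreover have "B \<inter> {Suc a..<b} = {}" using dich that by (auto simp: nc_lower_def)
    ultimately show "x \<in> insert a {b..<c}" using Rsub[OF that(1)] by fastforce
  qed
  have B0L: "B0 \<notin> ?L" using B0 by (auto simp: nc_lower_def)
  show "?L \<in> nc_part {Suc a..<b}"
  proof (rule nc_partI)
    show "\<Union>?L = {Suc a..<b}"
    proof
      show "{Suc a..<b} \<subseteq> \<Union>?L"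
      proof
        fix x assume x: "x \<in> {Suc a..<b}"
        then have "x \<in> \<Union>R" using b RD(1) by auto
        then obtain B where B: "B \<in> R" "x \<in> B" by blast
        then have "B \<subseteq> {Suc a..<b}" using dich x by blast
        then show "x \<in> \<Union>?L" using B by (auto simp: nc_lower_def)
      qed
    qed (auto simp: nc_lower_def)
    show "noncrossing ?L" using RD(4) unfolding nc_lower_def noncrossing_def by blast
  qed (use RD(2,3) in \<open>auto simp: nc_lower_def\<close>)
  have U_elim: "\<exists>B\<in>R. B \<notin> ?L \<and> C = B - {a}" if "C \<in> ?U" for C
    using that by (auto simp: nc_upper_def)
  show "?U \<in> nc_part {b..<c}"
  proof (rule nc_partI)
    show "\<Union>?U = {b..<c}"
    proof
      show "\<Union>?U \<subseteq> {b..<c}" using notL by (fastforce simp: nc_upper_def)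
      show "{b..<c} \<subseteq> \<Union>?U"
      proof
        fix x assume x: "x \<in> {b..<c}"
        then have "x \<in> \<Union>R" using b RD(1) by auto
        then obtain B where B: "B \<in> R" "x \<in> B" by blast
        then have "B \<notin> ?L" using x by (auto simp: nc_lower_def)
        moreover have "x \<noteq> a" using x b by auto
        ultimately show "x \<in> \<Union>?U" using B by (auto simp: nc_upper_def)
      qed
    qed
    show "{} \<notin> ?U"
    proof
      assume "{} \<in> ?U"
      then obtain B where B: "B \<in> R" "{} = B - {a}" using U_elim by blast
      then have "B \<subseteq> {a}" "B \<noteq> {}" using RD(3) by auto
      then have "B = {a}" by (simp add: subset_singleton_iff)
      then show False using B na by simp
    qed
    show "B = C" if "B \<in> ?U" "C \<in> ?U" "x \<in> B" "x \<in> C" for B C x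
      using U_elim[OF that(1)] U_elim[OF that(2)] that(3,4) RD(2) by blast
    show "noncrossing ?U"
      unfolding noncrossing_def
    proof (intro ballI allI impI)
      fix B C x y z w
      assume BC: "B \<in> ?U" "C \<in> ?U" and lt: "x < y" "y < z" "z < w"
        and mem: "x \<in> B" "z \<in> B" "y \<in> C" "w \<in> C"
      obtain B' C' where B': "B' \<in> R" "B = B' - {a}" and C': "C' \<in> R" "C = C' - {a}"
        using U_elim BC by blast
      then have "B' = C'" using noncrossingD[OF RD(4) B'(1) C'(1) lt] mem by blast
      then show "B = C" using B' C' by simp
    qed
  qed
  have "(\<lambda>B. if b \<in> B then insert a B else B) (B - {a}) = B" if B: "B \<in> R" for B
  proof (cases "B = B0")
    case True
    then show ?thesis using B0 bB by auto
  next
    case False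
    then have "a \<notin> B" "b \<notin> B" using RD(2) B B0 bB by blast+
    then show ?thesis by simp
  qed
  then have "(\<lambda>B. if b \<in> B then insert a B else B) ` ?U = R - ?L"
    unfolding nc_upper_def image_image by force
  moreover have "?L \<subseteq> R" by (auto simp: nc_lower_def)
  ultimately show "nc_join a b ?L ?U = R"
    unfolding nc_join_def by blast
qed

text \<open>The remaining case of the recursion, where a is a block of its own and therefore counts
  as a block of size \<open>Suc s\<close>.\<close>

lemma nc_insert:
  assumes P: "P \<in> nc_part {Suc a..<c}" and "a < c"
  shows "insert {a} P \<in> nc_part {a..<c}" and "{a} \<notin> P"
    and "(\<Prod>B\<in>insert {a} P. \<kappa> (card B + (if a \<in> B then s else 0))) = \<kappa> (Suc s) * (\<Prod>B\<in>P. \<kappa> (card B))"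
proof -
  note PD = nc_partD[OF P]
  have Psub: "x \<in> B \<Longrightarrow> a < x \<and> x < c" if "B \<in> P" for x B
    using PD(5)[OF that] by auto
  show na: "{a} \<notin> P" using Psub by blast
  show "insert {a} P \<in> nc_part {a..<c}"
  proof (rule nc_partI)
    show "\<Union>(insert {a} P) = {a..<c}" using PD(1) \<open>a < c\<close> by auto
    show "{} \<notin> insert {a} P" using PD(3) by auto
    show "B = C" if "B \<in> insert {a} P" "C \<in> insert {a} P" "x \<in> B" "x \<in> C" for B C x
      using that PD(2) Psub by blast
    show "noncrossing (insert {a} P)"
      unfolding noncrossing_def
    proof (intro ballI allI impI)
      fix B C x y z w
      assume BC: "B \<in> insert {a} P" "C \<in> insert {a} P" and lt: "x < y" "y < z" "z < w"
        and mem: "x \<in> B" "z \<in> B" "y \<in> C" "w \<in> C"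
      have "B \<noteq> {a}" "C \<noteq> {a}" using lt mem by auto
      then show "B = C" using BC noncrossingD[OF PD(4) _ _ lt mem] by blast
    qed
  qed
  have "(\<Prod>B\<in>P. \<kappa> (card B + (if a \<in> B then s else 0))) = (\<Prod>B\<in>P. \<kappa> (card B))"
    using Psub by (intro prod.cong) auto
  then show "(\<Prod>B\<in>insert {a} P. \<kappa> (card B + (if a \<in> B then s else 0))) = \<kappa> (Suc s) * (\<Prod>B\<in>P. \<kappa> (card B))"
    using PD(7) na by simp
qed

lemma nc_delete:
  assumes R: "R \<in> nc_part {a..<c}" and aR: "{a} \<in> R"
  shows "R - {{a}} \<in> nc_part {Suc a..<c}"
proof (rule nc_partI)
  note RD = nc_partD[OF R]
  have "\<Union>(R - {{a}}) = \<Union>R - {a}" using RD(2)[OF aR] by blast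
  then show "\<Union>(R - {{a}}) = {Suc a..<c}" using RD(1) by auto
  show "noncrossing (R - {{a}})" using RD(4) unfolding noncrossing_def by blast
qed (use nc_partD(2,3)[OF R] in auto)

lemma nc_sum_open_rec:
  assumes "a < c"
  shows "nc_sum_open \<kappa> s a {a..<c} = \<kappa> (Suc s) * nc_sum \<kappa> {Suc a..<c} +
    (\<Sum>b\<in>{Suc a..<c}. nc_sum \<kappa> {Suc a..<b} * nc_sum_open \<kappa> (Suc s) b {b..<c})"
proof -
  let ?w = "\<lambda>P. \<Prod>B\<in>P. \<kappa> (card B + (if a \<in> B then s else 0))"
  let ?N = "nc_part {a..<c}"
  have "nc_sum_open \<kappa> s a {a..<c} = (\<Sum>P\<in>{P\<in>?N. {a} \<in> P} \<union> {P\<in>?N. {a} \<notin> P}. ?w P)"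
    unfolding nc_sum_open_def by (intro sum.cong) auto
  also have "\<dots> = (\<Sum>P\<in>{P\<in>?N. {a} \<in> P}. ?w P) + (\<Sum>P\<in>{P\<in>?N. {a} \<notin> P}. ?w P)"
    by (intro sum.union_disjoint) (auto simp: finite_nc_part)
  also have "(\<Sum>P\<in>{P\<in>?N. {a} \<in> P}. ?w P) = (\<Sum>P\<in>nc_part {Suc a..<c}. \<kappa> (Suc s) * (\<Prod>B\<in>P. \<kappa> (card B)))"
  proof (rule sum.reindex_bij_witness[where i = "insert {a}" and j = "\<lambda>P. P - {{a}}"])
    fix P assume "P \<in> {P \<in> ?N. {a} \<in> P}"
    then have P: "P \<in> ?N" "{a} \<in> P" by auto
    show ins: "insert {a} (P - {{a}}) = P" using P by auto
    show "P - {{a}} \<in> nc_part {Suc a..<c}" using P by (rule nc_delete)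
    from nc_insert(3)[OF this assms, of \<kappa> s]
    show "\<kappa> (Suc s) * (\<Prod>B\<in>P - {{a}}. \<kappa> (card B)) = ?w P"
      unfolding ins by (rule sym)
  next
    fix P assume P: "P \<in> nc_part {Suc a..<c}"
    show "insert {a} P - {{a}} = P" using nc_insert(2)[OF P assms] by auto
    show "insert {a} P \<in> {P \<in> ?N. {a} \<in> P}" using nc_insert(1)[OF P assms] by auto
  qed
  also have "\<dots> = \<kappa> (Suc s) * nc_sum \<kappa> {Suc a..<c}"
    by (simp add: nc_sum_def sum_distrib_left)
  also have "(\<Sum>P\<in>{P\<in>?N. {a} \<notin> P}. ?w P) =
      (\<Sum>(b, P, Q)\<in>(SIGMA b:{Suc a..<c}. nc_part {Suc a..<b} \<times> nc_part {b..<c}).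
        (\<Prod>B\<in>P. \<kappa> (card B)) * (\<Prod>B\<in>Q. \<kappa> (card B + (if b \<in> B then Suc s else 0))))"
  proof (rule sum.reindex_bij_witness[where i = "\<lambda>(b, P, Q). nc_join a b P Q" and
        j = "\<lambda>R. (nc_next a R, nc_lower a (nc_next a R) R, nc_upper a (nc_next a R) R)"], goal_cases)
    case (1 R)
    then show ?case using nc_split(4)[of R a c] assms by simp
  next
    case (2 R)
    then show ?case using nc_split(1-3)[of R a c] assms by simp
  next
    case (3 t)
    then show ?case using nc_join(3-5) by auto
  next
    case (4 t)
    then show ?case using nc_join(1,2) by auto
  next
    case (5 R)
    then have R: "R \<in> ?N" "{a} \<notin> R" by auto
    note sp = nc_split[OF R(1) assms R(2)]
    show ?case
      using nc_join(6)[OF sp(1-3), of \<kappa> s] by (simp add: sp(4))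
  qed
  also have "\<dots> = (\<Sum>b\<in>{Suc a..<c}. nc_sum \<kappa> {Suc a..<b} * nc_sum_open \<kappa> (Suc s) b {b..<c})"
    by (subst sum.Sigma[symmetric])
      (simp_all add: finite_nc_part nc_sum_def nc_sum_open_def sum_product sum.cartesian_product)
  finally show ?thesis .
qed


text \<open>Here t is the true size of the block of a. Each of its t elements is followed by a gap,
  and the gaps are partitioned independently, which produces the t-th power of the moment series.
  Translation invariance is part of the same induction because the recursion needs it for shorter
  intervals.\<close>

lemma nc_sum_of_length:
  "nc_sum_open \<kappa> s a {a..<a + Suc n} =
      (\<Sum>t=1..Suc n. \<kappa> (t + s) * (Abs_fps (\<lambda>n. nc_sum \<kappa> {0..<n}) ^ t) $ (Suc n - t)) \<and>
    nc_sum \<kappa> {a..<a + n} = nc_sum \<kappa> {0..<n}"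
proof (induction n arbitrary: a s rule: less_induct)
  case (less n)
  define m where "m n = nc_sum \<kappa> {0..<n}" for n
  define F where "F = Abs_fps m"
  have F: "Abs_fps (\<lambda>n. nc_sum \<kappa> {0..<n}) = F" by (simp add: F_def m_def[abs_def])
  have IH: "nc_sum_open \<kappa> s a {a..<a + Suc k} = (\<Sum>t=1..Suc k. \<kappa> (t + s) * (F ^ t) $ (Suc k - t))"
    "nc_sum \<kappa> {a..<a + k} = m k" if "k < n" for k a s
    using less[OF that] unfolding F by (auto simp: m_def)
  have len: "nc_sum \<kappa> {a..<a + n} = m n" for a
  proof (cases n)
    case 0
    then show ?thesis by (simp add: m_def)
  next
    case (Suc k)
    then show ?thesis
      using IH(1)[of k 0 a] IH(1)[of k 0 0] by (simp add: nc_sum_open_0 m_def)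
  qed
  have len': "nc_sum \<kappa> {a..<a + k} = m k" if "k \<le> n" for k a
    using len IH(2) that by (cases "k = n") auto
  have "nc_sum_open \<kappa> s a {a..<a + Suc n} = \<kappa> (Suc s) * nc_sum \<kappa> {Suc a..<Suc a + n} +
      (\<Sum>b\<in>{Suc a..<Suc a + n}. nc_sum \<kappa> {Suc a..<b} * nc_sum_open \<kappa> (Suc s) b {b..<Suc a + n})"
    using nc_sum_open_rec[of a "a + Suc n" \<kappa> s] by simp
  also have "(\<Sum>b\<in>{Suc a..<Suc a + n}. nc_sum \<kappa> {Suc a..<b} * nc_sum_open \<kappa> (Suc s) b {b..<Suc a + n})
      = (\<Sum>j<n. m j * (\<Sum>t=1..n - j. \<kappa> (t + Suc s) * (F ^ t) $ (n - j - t)))"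
  proof (rule sum.reindex_bij_witness[where i = "\<lambda>j. Suc a + j" and j = "\<lambda>b. b - Suc a"])
    fix b assume b: "b \<in> {Suc a..<Suc a + n}"
    define j where "j = b - Suc a"
    have j: "b = Suc a + j" "j < n" using b by (auto simp: j_def)
    obtain k where k: "n = Suc (j + k)" using \<open>j < n\<close> less_imp_Suc_add by blast
    have "{b..<Suc a + n} = {b..<b + Suc k}" by (simp add: j k add_ac)
    then show "m (b - Suc a) * (\<Sum>t=1..n - (b - Suc a). \<kappa> (t + Suc s) * (F ^ t) $ (n - (b - Suc a) - t))
        = nc_sum \<kappa> {Suc a..<b} * nc_sum_open \<kappa> (Suc s) b {b..<Suc a + n}"
      using IH(1)[of k "Suc s" b] len'[of j "Suc a"] by (simp add: j k)
  qed auto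
  also have "\<dots> = (\<Sum>j<n. \<Sum>t=1..n - j. \<kappa> (t + Suc s) * (m j * (F ^ t) $ (n - j - t)))"
    by (simp add: sum_distrib_left mult_ac)
  also have "\<dots> = (\<Sum>(j, t)\<in>(SIGMA j:{..<n}. {1..n - j}). \<kappa> (t + Suc s) * (m j * (F ^ t) $ (n - j - t)))"
    by (simp add: sum.Sigma)
  also have "\<dots> = (\<Sum>(t, j)\<in>(SIGMA t:{1..n}. {0..n - t}). \<kappa> (t + Suc s) * (m j * (F ^ t) $ (n - j - t)))"
    by (rule sum.reindex_bij_witness[where i = "\<lambda>(t, j). (j, t)" and j = "\<lambda>(j, t). (t, j)"]) auto
  also have "\<dots> = (\<Sum>t=1..n. \<kappa> (t + Suc s) * (\<Sum>j=0..n - t. m j * (F ^ t) $ (n - t - j)))"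
    by (simp add: sum.Sigma[symmetric] sum_distrib_left add.commute)
  \<comment> \<open>The inner sum is a Cauchy product: the gap right after a adds one more factor
    F.\<close>
  also have "\<dots> = (\<Sum>t=1..n. \<kappa> (Suc t + s) * (F ^ Suc t) $ (Suc n - Suc t))"
    by (simp add: fps_mult_nth F_def)
  also have "\<dots> = (\<Sum>t=2..Suc n. \<kappa> (t + s) * (F ^ t) $ (Suc n - t))"
    using sum.shift_bounds_cl_Suc_ivl[of "\<lambda>t. \<kappa> (t + s) * (F ^ t) $ (Suc n - t)" 1 n]
    by (simp add: numeral_2_eq_2 del: power_Suc)
  also have "nc_sum \<kappa> {Suc a..<Suc a + n} = (F ^ 1) $ n"
    using len[of "Suc a"] by (simp add: F_def)
  also have "\<kappa> (Suc s) * (F ^ 1) $ n + (\<Sum>t=2..Suc n. \<kappa> (t + s) * (F ^ t) $ (Suc n - t))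
      = (\<Sum>t=1..Suc n. \<kappa> (t + s) * (F ^ t) $ (Suc n - t))"
    using sum.atLeast_Suc_atMost[of 1 "Suc n" "\<lambda>t. \<kappa> (t + s) * (F ^ t) $ (Suc n - t)"]
    by (simp add: numeral_2_eq_2 del: power_Suc sum.cl_ivl_Suc)
  finally show ?case using len[of a] unfolding F m_def by blast
qed

section \<open>Moments as functions of cumulants and their generating series\<close>

definition nc_moments :: "(nat \<Rightarrow> 'a::comm_ring_1) \<Rightarrow> nat \<Rightarrow> 'a" where
  "nc_moments \<kappa> n = nc_sum \<kappa> {0..<n}"

lemma nc_moments_0: "nc_moments \<kappa> 0 = 1"
  by (simp add: nc_moments_def nc_sum_empty)

lemma nc_moments_eq:
  "nc_moments \<kappa> n = (\<Sum>P\<in>noncrossing_partitions n. \<Prod>B\<in>P. \<kappa> (card B))"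
  using nc_sum_of_length[of \<kappa> 0 1 n]
  by (simp add: noncrossing_partitions_eq nc_moments_def nc_sum_def flip: atLeastLessThanSuc_atLeastAtMost)

lemma nc_moments_rec:
  assumes "0 < n"
  shows "nc_moments \<kappa> n = (\<Sum>t=1..n. \<kappa> t * (Abs_fps (nc_moments \<kappa>) ^ t) $ (n - t))"
  using nc_sum_of_length[of \<kappa> 0 0 "n - 1"] assms
  by (simp add: nc_sum_open_0 nc_moments_def[abs_def])

lemma nc_moments_1: "nc_moments \<kappa> 1 = \<kappa> 1"
  using nc_moments_rec[of 1 \<kappa>] by (simp add: nc_moments_0)

lemma nc_moments_2: "nc_moments \<kappa> 2 = \<kappa> 2 + (\<kappa> 1)\<^sup>2"
proof -
  have "{1..2::nat} = {1, 2}" by auto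
  then show ?thesis
    using nc_moments_rec[of 2 \<kappa>] nc_moments_1[of \<kappa>]
    by (simp add: power2_eq_square fps_mult_nth nc_moments_0)
qed

text \<open>
  In terms of generating functions, the moment-cumulant formula says \<open>M = C \<circ> (X M)\<close>, where
  \<open>C = 1 + \<Sum> \<kappa>\<^sub>n X\<^sup>n\<close>; hence \<open>X / C\<close> is the compositional inverse of \<open>X M\<close>, and
  \<open>M \<circ> (X / C) = C\<close>.
\<close>

lemma nc_moments_inversion:
  fixes \<kappa> :: "nat \<Rightarrow> 'a::field"
  defines "R \<equiv> inverse (Abs_fps (\<lambda>n. if n = 0 then 1 else \<kappa> n))"
  shows "(\<Sum>k=0..n. nc_moments \<kappa> k * (R ^ Suc k) $ (n - k)) = (if n = 0 then 1 else 0)"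
proof -
  define C where "C = Abs_fps (\<lambda>n. if n = 0 then 1 else \<kappa> n)"
  define F where "F = Abs_fps (nc_moments \<kappa>)"
  define Q where "Q = fps_X * F"
  define Z where "Z = fps_inv Q"
  have C0: "C $ 0 \<noteq> 0" by (simp add: C_def)
  have RC: "R * C = 1" unfolding R_def C_def[symmetric] by (rule inverse_mult_eq_1[OF C0])
  have Q0: "Q $ 0 = 0" and Q1: "Q $ 1 \<noteq> 0" by (simp_all add: Q_def F_def nc_moments_0)
  have Z0: "Z $ 0 = 0" by (simp add: Z_def fps_inv_def)
  have "F = C oo Q"
  proof (rule fps_ext)
    fix n
    show "F $ n = (C oo Q) $ n"
    proof (cases "n = 0")
      case True
      then show ?thesis by (simp add: F_def C_def nc_moments_0)
    next
      case False
      have "(C oo Q) $ n = (\<Sum>i=0..n. C $ i * (F ^ i) $ (n - i))"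
        by (simp add: fps_compose_nth Q_def power_mult_distrib fps_X_power_mult_nth)
      also have "\<dots> = (\<Sum>i=1..n. \<kappa> i * (F ^ i) $ (n - i))"
        using False by (simp add: sum.atLeast_Suc_atMost[of 0] C_def)
      finally show ?thesis using False by (simp add: nc_moments_rec F_def)
    qed
  qed
  then have "F oo Z = C oo (Q oo Z)"
    using Q0 Z0 by (simp add: fps_compose_assoc)
  then have FZ: "F oo Z = C"
    using fps_inv_right[OF Q0 Q1] by (simp add: Z_def)
  have "Q oo Z = Z * (F oo Z)"
    using Z0 by (simp add: Q_def fps_compose_mult_distrib)
  moreover have "Q oo Z = fps_X"
    unfolding Z_def by (rule fps_inv_right[OF Q0 Q1])
  ultimately have "Z * C = fps_X" by (simp add: FZ)
  then have Z: "Z = fps_X * R"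
    using RC by (metis mult.assoc mult.commute mult.right_neutral)
  \<comment> \<open>Since Z^k R = X^k R^(k+1), the sum is the n-th coefficient of (F oo Z) R = C R =
    1.\<close>
  have "(\<Sum>k=0..n. nc_moments \<kappa> k * (R ^ Suc k) $ (n - k)) = (\<Sum>k=0..n. F $ k * (Z ^ k * R) $ n)"
    by (intro sum.cong refl) (simp add: F_def Z power_mult_distrib mult.assoc fps_X_power_mult_nth
        power_Suc2 del: power_Suc)
  also have "\<dots> = (\<Sum>k=0..n. \<Sum>j=0..n. F $ k * (Z ^ k) $ j * R $ (n - j))"
    by (simp add: fps_mult_nth sum_distrib_left mult.assoc)
  also have "\<dots> = (\<Sum>j=0..n. (\<Sum>k=0..n. F $ k * (Z ^ k) $ j) * R $ (n - j))"
    by (subst sum.swap) (simp add: sum_distrib_right)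
  also have "\<dots> = (\<Sum>j=0..n. (F oo Z) $ j * R $ (n - j))"
  proof (intro sum.cong refl arg_cong2[where f = "(*)"])
    fix j assume "j \<in> {0..n}"
    have "(Z ^ k) $ j = 0" if "j < k" for k
      using that by (simp add: Z power_mult_distrib fps_X_power_mult_nth)
    then show "(\<Sum>k=0..n. F $ k * (Z ^ k) $ j) = (F oo Z) $ j"
      unfolding fps_compose_nth using \<open>j \<in> {0..n}\<close> by (intro sum.mono_neutral_right) auto
  qed
  also have "\<dots> = (C * R) $ n" by (simp add: FZ fps_mult_nth)
  also have "\<dots> = (if n = 0 then 1 else 0)" using RC by (simp add: mult.commute)
  finally show ?thesis .
qed

lemma nc_moments_of_real: "nc_moments (\<lambda>n. of_real (\<kappa> n)) n = of_real (nc_moments \<kappa> n)"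
  by (simp add: nc_moments_def nc_sum_def)

text \<open>The block sizes of a partition of n points add up to n.\<close>

lemma nc_moments_scale:
  "nc_moments (\<lambda>n. c ^ n * \<kappa> n) n = c ^ n * nc_moments \<kappa> n"
proof -
  have "(\<Prod>B\<in>P. c ^ card B * \<kappa> (card B)) = c ^ n * (\<Prod>B\<in>P. \<kappa> (card B))"
    if P: "P \<in> nc_part {0..<n}" for P
  proof -
    note PD = nc_partD[OF P]
    have "(\<Sum>B\<in>P. card B) = card (\<Union>P)"
      by (rule card_Union_disjoint[symmetric])
        (use PD(2,6) in \<open>auto simp: pairwise_def disjnt_def\<close>)
    then have "(\<Prod>B\<in>P. c ^ card B) = c ^ n" by (simp add: PD(1) flip: power_sum)
    then show ?thesis by (simp add: prod.distrib)
  qed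
  then show ?thesis by (simp add: nc_moments_def nc_sum_def sum_distrib_left)
qed

text \<open>Moments are polynomials in the cumulants of positive order, because blocks are nonempty.
  The filter is arbitrary so that single sequences and pairs of indices are both covered.\<close>

lemma tendsto_nc_moments:
  fixes \<kappa> :: "'b \<Rightarrow> nat \<Rightarrow> real"
  assumes "\<And>n. 1 \<le> n \<Longrightarrow> ((\<lambda>x. \<kappa> x n) \<longlongrightarrow> \<mu> n) F"
  shows "((\<lambda>x. nc_moments (\<kappa> x) n) \<longlongrightarrow> nc_moments \<mu> n) F"
  unfolding nc_moments_def nc_sum_def
proof (intro tendsto_sum tendsto_prod assms)
  fix P B assume P: "P \<in> nc_part {0..<n}" and B: "B \<in> P"
  have "finite B" "B \<noteq> {}" using nc_partD(3,6)[OF P] B by auto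
  then show "1 \<le> card B" by (simp add: Suc_le_eq card_gt_0_iff)
qed

lemma nc_moments_cong:
  assumes "\<And>k. 1 \<le> k \<Longrightarrow> \<kappa> k = \<kappa>' k"
  shows "nc_moments \<kappa> n = nc_moments \<kappa>' n"
  unfolding nc_moments_def nc_sum_def
proof (intro sum.cong prod.cong refl assms)
  fix P B assume P: "P \<in> nc_part {0..<n}" and B: "B \<in> P"
  have "finite B" "B \<noteq> {}" using nc_partD(3,6)[OF P] B by auto
  then show "1 \<le> card B" by (simp add: Suc_le_eq card_gt_0_iff)
qed

lemma nc_moments_zero:
  assumes "\<And>k. 1 \<le> k \<Longrightarrow> \<kappa> k = 0" and "0 < n"
  shows "nc_moments \<kappa> n = 0"
  using assms by (simp add: nc_moments_rec)

text \<open>Splitting off the one-block partition shows that the moment-cumulant formula is a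
  triangular system with unit diagonal; existence and uniqueness of cumulants follow by
  recursion.\<close>

lemma nc_moments_leading:
  assumes "0 < n"
  shows "nc_moments \<kappa> n = \<kappa> n + (\<Sum>P\<in>nc_part {0..<n} - {{{0..<n}}}. \<Prod>B\<in>P. \<kappa> (card B))"
proof -
  have "{{0..<n}} \<in> nc_part {0..<n}"
    using assms by (intro nc_partI) (auto simp: noncrossing_def)
  then show ?thesis
    unfolding nc_moments_def nc_sum_def by (simp add: sum.remove finite_nc_part)
qed

lemma nc_part_card_less:
  assumes P: "P \<in> nc_part {0..<n} - {{{0..<n}}}" and B: "B \<in> P"
  shows "card B < n" and "0 < card B"
proof -
  note PD = nc_partD[of P "{0..<n}"]
  have sub: "B \<subseteq> {0..<n}" using PD(5) P B by auto
  have "B \<noteq> {0..<n}"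
  proof
    assume eq: "B = {0..<n}"
    have "C = B" if "C \<in> P" for C
    proof -
      obtain x where "x \<in> C" using PD(3) P \<open>C \<in> P\<close> by (metis DiffD1 ex_in_conv)
      moreover have "x \<in> B" using PD(5)[of C] P \<open>C \<in> P\<close> \<open>x \<in> C\<close> eq by auto
      ultimately show ?thesis using PD(2) P B \<open>C \<in> P\<close> by blast
    qed
    then have "P = {{0..<n}}" using B eq by blast
    then show False using P by simp
  qed
  then have "B \<subset> {0..<n}" using sub by blast
  then show "card B < n" using psubset_card_mono[of "{0..<n}" B] by simp
  show "0 < card B" using PD(3,6) P B by (auto simp: card_gt_0_iff)
qed

lemma nc_moments_inj:
  assumes "\<And>n. 1 \<le> n \<Longrightarrow> nc_moments \<kappa> n = nc_moments \<kappa>' n" and "1 \<le> n"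
  shows "\<kappa> n = \<kappa>' n"
  using assms(2)
proof (induction n rule: less_induct)
  case (less n)
  have "(\<Sum>P\<in>nc_part {0..<n} - {{{0..<n}}}. \<Prod>B\<in>P. \<kappa> (card B))
      = (\<Sum>P\<in>nc_part {0..<n} - {{{0..<n}}}. \<Prod>B\<in>P. \<kappa>' (card B))"
    by (intro sum.cong prod.cong refl less.IH) (simp_all add: nc_part_card_less Suc_le_eq)
  then show ?case
    using assms(1)[of n] less.prems nc_moments_leading[of n \<kappa>] nc_moments_leading[of n \<kappa>'] by simp
qed

lemma nc_moments_surj:
  fixes m :: "nat \<Rightarrow> 'a::comm_ring_1"
  shows "\<exists>\<kappa>. \<kappa> 0 = 0 \<and> (\<forall>n\<ge>1. nc_moments \<kappa> n = m n)"
proof -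
  define rest where "rest \<kappa> n = (\<Sum>P\<in>nc_part {0..<n} - {{{0..<n}}}. \<Prod>B\<in>P. \<kappa> (card B))"
    for \<kappa> :: "nat \<Rightarrow> 'a" and n
  have "\<exists>\<kappa>. \<forall>n. \<kappa> n = (if n = 0 then 0 else m n - rest \<kappa> n)"
  proof (rule dependent_wf_choice[OF wf_less_than, of "\<lambda>\<kappa> n r. r = (if n = 0 then 0 else m n - rest \<kappa> n)"])
    fix r and f g :: "nat \<Rightarrow> 'a" and x
    assume "\<And>z. (z, x) \<in> less_than \<Longrightarrow> f z = g z"
    then have "rest f x = rest g x"
      unfolding rest_def by (intro sum.cong prod.cong refl) (simp_all add: nc_part_card_less)
    then show "(r = (if x = 0 then 0 else m x - rest f x)) = (r = (if x = 0 then 0 else m x - rest g x))"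
      by simp
  qed simp
  then obtain \<kappa> where "\<And>n. \<kappa> n = (if n = 0 then 0 else m n - rest \<kappa> n)" by blast
  then have "\<kappa> 0 = 0" "\<And>n. 1 \<le> n \<Longrightarrow> \<kappa> n + rest \<kappa> n = m n"
    by (metis, metis diff_add_cancel not_one_le_zero)
  then show ?thesis
    by (intro exI[of _ \<kappa>]) (simp add: nc_moments_leading rest_def)
qed

lemma free_cumulants_eqI:
  assumes "\<And>n. 1 \<le> n \<Longrightarrow> m n = nc_moments \<kappa> n" and "1 \<le> n"
  shows "free_cumulants m n = \<kappa> n"
proof -
  \<comment> \<open>The definition fixes the entry at 0 to be 0, so the candidate is \<kappa> reset
    there.\<close>
  have "free_cumulants m = (\<lambda>n. if n = 0 then 0 else \<kappa> n)"
    unfolding free_cumulants_def nc_moments_eq[symmetric]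
  proof (rule the_equality)
    show "(if (0::nat) = 0 then 0 else \<kappa> 0) = 0 \<and>
        (\<forall>n\<ge>1. m n = nc_moments (\<lambda>n. if n = 0 then 0 else \<kappa> n) n)"
      using assms(1) nc_moments_cong[of "\<lambda>n. if n = 0 then 0 else \<kappa> n" \<kappa>] by simp
    fix \<kappa>' assume "\<kappa>' 0 = 0 \<and> (\<forall>n\<ge>1. m n = nc_moments \<kappa>' n)"
    then show "\<kappa>' = (\<lambda>n. if n = 0 then 0 else \<kappa> n)"
      using nc_moments_inj[of \<kappa>' \<kappa>] assms(1) by (intro ext) (simp add: Suc_le_eq)
  qed
  then show ?thesis using assms(2) by simp
qed

lemma nc_moments_free_cumulants:
  assumes "1 \<le> n"
  shows "nc_moments (free_cumulants m) n = m n"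
proof -
  obtain \<kappa> where "\<kappa> 0 = 0" "\<And>n. 1 \<le> n \<Longrightarrow> nc_moments \<kappa> n = m n"
    using nc_moments_surj[of m] by blast
  then have "nc_moments (free_cumulants m) n = nc_moments \<kappa> n"
    by (intro nc_moments_cong free_cumulants_eqI) auto
  then show ?thesis using assms \<open>\<And>n. 1 \<le> n \<Longrightarrow> nc_moments \<kappa> n = m n\<close> by simp
qed

section \<open>Additivity of free cumulants\<close>

text \<open>The Cauchy product of power series with operator coefficients, given as coefficient
  sequences; \<open>op_delta\<close> is its unit.\<close>

definition op_conv :: "(nat \<Rightarrow> 'h::complex_hilbert op) \<Rightarrow> (nat \<Rightarrow> 'h op) \<Rightarrow> nat \<Rightarrow> 'h op" where
  "op_conv a b n = (\<Sum>k=0..n. a k o\<^sub>L b (n - k))"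

definition op_delta :: "nat \<Rightarrow> 'h::complex_hilbert op" where
  "op_delta n = (if n = 0 then id_blinfun else 0)"

lemma op_conv_assoc: "op_conv (op_conv a b) c n = op_conv a (op_conv b c) n"
proof -
  have "(\<Sum>j=0..n. \<Sum>i=0..j. (a i o\<^sub>L b (j - i)) o\<^sub>L c (n - j)) =
      (\<Sum>j=0..n. \<Sum>i=0..n - j. (a j o\<^sub>L b i) o\<^sub>L c (n - j - i))"
    by (rule fps_mult_assoc_lemma)
  then show ?thesis
    by (simp add: op_conv_def compose.sum_left compose.sum_right compose_assoc)
qed

lemma op_conv_delta: "op_conv op_delta b n = b n" "op_conv a op_delta n = a n"
proof -
  have "op_conv op_delta b n = (\<Sum>k=0..n. if k = 0 then b n else 0)"
    unfolding op_conv_def by (intro sum.cong) (auto simp: op_delta_def compose.zero_left)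
  then show "op_conv op_delta b n = b n" by simp
  have "op_conv a op_delta n = (\<Sum>k=0..n. if k = n then a n else 0)"
    unfolding op_conv_def by (intro sum.cong) (auto simp: op_delta_def compose.zero_right)
  then show "op_conv a op_delta n = a n" by simp
qed

lemma op_conv_linear:
  "op_conv (\<lambda>n. a n + b n) c n = op_conv a c n + op_conv b c n"
  "op_conv (\<lambda>n. a n - b n) c n = op_conv a c n - op_conv b c n"
  "op_conv c (\<lambda>n. a n - b n) n = op_conv c a n - op_conv c b n"
  "op_conv c (\<lambda>n. - a n) n = - op_conv c a n"
  "op_conv (\<lambda>n. \<Sum>i\<in>I. f i n) c n = (\<Sum>i\<in>I. op_conv (f i) c n)"
  by (simp_all add: op_conv_def compose.add_left compose.diff_left compose.diff_right
      compose.minus_right compose.sum_left sum.distrib sum_subtractf sum_negf sum.swap[of _ I])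

text \<open>A series with constant term 1 is left cancellable, since the coefficients of the other
  factor can be read off one after the other.\<close>

lemma op_conv_cancel:
  assumes "a 0 = id_blinfun" and "\<And>n. op_conv a b n = op_conv a c n"
  shows "b n = c n"
proof (induction n rule: less_induct)
  case (less n)
  have split: "op_conv a d n = d n + (\<Sum>k=1..n. a k o\<^sub>L d (n - k))" for d
    by (simp add: op_conv_def sum.atLeast_Suc_atMost assms(1))
  have "(\<Sum>k=1..n. a k o\<^sub>L b (n - k)) = (\<Sum>k=1..n. a k o\<^sub>L c (n - k))"
    using less by (intro sum.cong) auto
  then show ?case using assms(2)[of n] by (simp add: split)
qed

abbreviation cumulant_fps :: "(nat \<Rightarrow> real) \<Rightarrow> real fps" where
  "cumulant_fps \<kappa> \<equiv> Abs_fps (\<lambda>n. if n = 0 then 1 else \<kappa> n)"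

text \<open>
  The coefficients of \<open>C(z) - z Y\<close>, where \<open>C(z) = 1 + \<Sum> \<kappa>\<^sub>n z\<^sup>n\<close>, and of its inverse
  \<open>\<Sum> z\<^sup>k C(z)\<^sup>-\<^sup>k\<^sup>-\<^sup>1 Y\<^sup>k\<close>.  If the \<open>\<kappa>\<^sub>n\<close> are the free cumulants of \<open>Y\<close>, this inverse has trace \<open>1\<close>.
\<close>

definition shifted_op :: "(nat \<Rightarrow> real) \<Rightarrow> 'h::complex_hilbert op \<Rightarrow> nat \<Rightarrow> 'h op" where
  "shifted_op \<kappa> Y n = fps_nth (cumulant_fps \<kappa>) n *\<^sub>R id_blinfun - (if n = 1 then Y else 0)"

definition resolvent_op :: "(nat \<Rightarrow> real) \<Rightarrow> 'h::complex_hilbert op \<Rightarrow> nat \<Rightarrow> 'h op" where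
  "resolvent_op \<kappa> Y n =
     (\<Sum>k=0..n. fps_nth (inverse (cumulant_fps \<kappa>) ^ Suc k) (n - k) *\<^sub>R op_pow Y k)"

lemma resolvent_op_0: "resolvent_op \<kappa> Y 0 = id_blinfun"
  by (simp add: resolvent_op_def)

text \<open>With R = 1 / C the product (C - z Y) (sum of z^k R^(k+1) Y^k) telescopes: the sums of
  z^k R^k Y^k over k from 0 and over k from 1 differ by 1.\<close>

lemma shifted_conv_resolvent: "op_conv (shifted_op \<kappa> Y) (resolvent_op \<kappa> Y) n = op_delta n"
proof -
  define C where "C = cumulant_fps \<kappa>"
  define R where "R = inverse C"
  have CR: "C * R ^ Suc k = R ^ k" for k
  proof -
    have "C * R = 1" unfolding R_def by (rule inverse_mult_eq_1') (simp add: C_def)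
    then show ?thesis by (simp flip: mult.assoc)
  qed
  have B: "resolvent_op \<kappa> Y n = (\<Sum>k=0..n. ((R ^ Suc k) $ (n - k)) *\<^sub>R op_pow Y k)" for n
    by (simp add: resolvent_op_def R_def C_def)
  have "op_conv (shifted_op \<kappa> Y) (resolvent_op \<kappa> Y) n =
      (\<Sum>j=0..n. (C $ j) *\<^sub>R resolvent_op \<kappa> Y (n - j))
      - (\<Sum>j=0..n. (if j = 1 then Y else 0) o\<^sub>L resolvent_op \<kappa> Y (n - j))"
    by (simp add: op_conv_def shifted_op_def compose.diff_left compose.scaleR_left sum_subtractf C_def)
  also have "(\<Sum>j=0..n. (C $ j) *\<^sub>R resolvent_op \<kappa> Y (n - j))
      = (\<Sum>j=0..n. \<Sum>k=0..n - j. (C $ j * (R ^ Suc k) $ (n - k - j)) *\<^sub>R op_pow Y k)"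
    by (simp add: B scaleR_sum_right add.commute del: power_Suc)
  also have "\<dots> = (\<Sum>(j, k)\<in>(SIGMA j:{0..n}. {0..n - j}). (C $ j * (R ^ Suc k) $ (n - k - j)) *\<^sub>R op_pow Y k)"
    by (simp add: sum.Sigma del: power_Suc)
  also have "\<dots> = (\<Sum>(k, j)\<in>(SIGMA k:{0..n}. {0..n - k}). (C $ j * (R ^ Suc k) $ (n - k - j)) *\<^sub>R op_pow Y k)"
    by (rule sum.reindex_bij_witness[where i = "\<lambda>(k, j). (j, k)" and j = "\<lambda>(j, k). (k, j)"]) auto
  also have "\<dots> = (\<Sum>k=0..n. (\<Sum>j=0..n - k. C $ j * (R ^ Suc k) $ (n - k - j)) *\<^sub>R op_pow Y k)"
    by (simp add: sum.Sigma[symmetric] scaleR_sum_left del: power_Suc)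
  also have "\<dots> = (\<Sum>k=0..n. ((R ^ k) $ (n - k)) *\<^sub>R op_pow Y k)"
    by (simp only: fps_mult_nth[symmetric] CR)
  also have "(\<Sum>j=0..n. (if j = 1 then Y else 0) o\<^sub>L resolvent_op \<kappa> Y (n - j))
      = (\<Sum>k=1..n. ((R ^ k) $ (n - k)) *\<^sub>R op_pow Y k)"
  proof (cases n)
    case 0
    then show ?thesis by (simp add: compose.zero_left)
  next
    case (Suc m)
    have "(\<Sum>j=0..n. (if j = 1 then Y else 0) o\<^sub>L resolvent_op \<kappa> Y (n - j))
        = (\<Sum>j=0..n. if j = 1 then Y o\<^sub>L resolvent_op \<kappa> Y (n - 1) else 0)"
      by (intro sum.cong) (auto simp: compose.zero_left)
    also have "\<dots> = Y o\<^sub>L resolvent_op \<kappa> Y m" by (simp add: Suc)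
    also have "\<dots> = (\<Sum>k=0..m. ((R ^ Suc k) $ (n - Suc k)) *\<^sub>R op_pow Y (Suc k))"
      by (simp add: B compose.sum_right compose.scaleR_right op_pow_Suc Suc del: power_Suc)
    also have "\<dots> = (\<Sum>k=1..n. ((R ^ k) $ (n - k)) *\<^sub>R op_pow Y k)"
      unfolding Suc using sum.shift_bounds_cl_Suc_ivl[of "\<lambda>k. ((R ^ k) $ (Suc m - k)) *\<^sub>R op_pow Y k" 0 m]
      by simp
    finally show ?thesis .
  qed
  also have "(\<Sum>k=0..n. ((R ^ k) $ (n - k)) *\<^sub>R op_pow Y k) - (\<Sum>k=1..n. ((R ^ k) $ (n - k)) *\<^sub>R op_pow Y k)
      = op_delta n"
    by (simp add: sum.atLeast_Suc_atMost[of 0] op_delta_def)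
  finally show ?thesis .
qed

text \<open>C(z) - z Y - 1 is additive in the pair of cumulants and operator; this is the
  linearisation behind the additivity of free cumulants.\<close>

lemma shifted_op_sum:
  assumes "finite I"
  shows "shifted_op (\<lambda>n. \<Sum>i\<in>I. \<kappa> i n) (\<Sum>i\<in>I. Y i) n =
    op_delta n + (\<Sum>i\<in>I. shifted_op (\<kappa> i) (Y i) n - op_delta n)"
  using assms
  by (auto simp: shifted_op_def op_delta_def sum_subtractf scaleR_sum_left intro!: sum.cong)

text \<open>Makes the range of k visible in the recursive calls of \<open>free_words\<close>, so
  that n - k is seen to decrease.\<close>

declare sum.cong [fundef_cong]

text \<open>
  \<open>free_words E I n i\<close> is the coefficient of \<open>z\<^sup>n\<close> in the sum of all \<open>(-1)\<^sup>r E\<^sub>i E\<^sub>j \<dots>\<close>, taken over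
  alternating words of length \<open>r \<ge> 1\<close> that begin with \<open>i\<close>.
\<close>

function free_words :: "('i \<Rightarrow> nat \<Rightarrow> 'h::complex_hilbert op) \<Rightarrow> 'i set \<Rightarrow> nat \<Rightarrow> 'i \<Rightarrow> 'h op" where
  "free_words E I n i =
     - (\<Sum>k\<in>{1..n}. E i k o\<^sub>L (op_delta (n - k) + (\<Sum>j\<in>I - {i}. free_words E I (n - k) j)))"
  by auto
termination by (relation "Wellfounded.measure (\<lambda>(E, I, n, i). n)") auto

declare free_words.simps [simp del]

lemma star_algebra_zero: "0 \<in> star_algebra a"
proof -
  have "op_cscale 0 id_blinfun = (0 :: 'a op)"
    using op_cscale_of_real[of 0 "id_blinfun :: 'a op"] by simp
  then show ?thesis using star_algebra.scale[OF star_algebra.one, of 0 a] by simp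
qed

lemma star_algebra_scaleR: "b \<in> star_algebra a \<Longrightarrow> r *\<^sub>R b \<in> star_algebra a"
  using star_algebra.scale[of b a "complex_of_real r"] by (simp add: op_cscale_of_real)

lemma star_algebra_uminus: "b \<in> star_algebra a \<Longrightarrow> - b \<in> star_algebra a"
  using star_algebra_scaleR[of b a "- 1"] by simp

lemma star_algebra_diff: "b \<in> star_algebra a \<Longrightarrow> c \<in> star_algebra a \<Longrightarrow> b - c \<in> star_algebra a"
  using star_algebra.add[OF _ star_algebra_uminus, of b a c] by simp

lemma star_algebra_sum: "(\<And>i. i \<in> I \<Longrightarrow> f i \<in> star_algebra a) \<Longrightarrow> sum f I \<in> star_algebra a"
  by (induction I rule: infinite_finite_induct) (auto intro: star_algebra_zero star_algebra.add)

lemma star_algebra_op_pow: "b \<in> star_algebra a \<Longrightarrow> op_pow b n \<in> star_algebra a"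
  by (induction n) (auto simp: op_pow_Suc intro: star_algebra.intros)

lemma resolvent_op_star_algebra: "Y \<in> star_algebra a \<Longrightarrow> resolvent_op \<kappa> Y n \<in> star_algebra a"
  unfolding resolvent_op_def
  by (intro star_algebra_sum star_algebra_scaleR star_algebra_op_pow)

section \<open>Resolvents of trace one and traces of alternating words\<close>

context wstar_probability_space
begin

lemma star_algebra_subset: "a \<in> M \<Longrightarrow> star_algebra a \<subseteq> M"
proof
  fix b assume "a \<in> M" "b \<in> star_algebra a"
  from this(2,1) show "b \<in> M" by induction (simp_all add: M_intros)
qed

lemma phi_resolvent_op:
  assumes "Y \<in> M"
  shows "\<phi> (resolvent_op \<kappa> Y n) =
    (\<Sum>k=0..n. complex_of_real (fps_nth (inverse (cumulant_fps \<kappa>) ^ Suc k) (n - k)) * \<phi> (op_pow Y k))"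
  unfolding resolvent_op_def
  by (subst phi_sum) (simp_all add: assms M_intros phi_scaleR del: power_Suc)

text \<open>By \<open>nc_moments_inversion\<close> the prescribed moments solve the equations for
  trace one, and the equations form a triangular system with unit diagonal, so they are the only
  solution.\<close>

lemma phi_resolvent_delta_iff:
  assumes Y: "Y \<in> M"
  shows "(\<forall>n. \<phi> (resolvent_op \<kappa> Y n) = (if n = 0 then 1 else 0)) \<longleftrightarrow>
    (\<forall>n. \<phi> (op_pow Y n) = complex_of_real (nc_moments \<kappa> n))"
proof -
  define R where "R k n = fps_nth (inverse (cumulant_fps \<kappa>) ^ Suc k) (n - k)" for k n
  have inv: "(\<Sum>k=0..n. nc_moments \<kappa> k * R k n) = (if n = 0 then 1 else 0)" for n
    using nc_moments_inversion[of \<kappa> n] by (simp add: R_def)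
  have eq: "\<phi> (resolvent_op \<kappa> Y n) - (if n = 0 then 1 else 0) =
      (\<Sum>k=0..n. complex_of_real (R k n) * (\<phi> (op_pow Y k) - complex_of_real (nc_moments \<kappa> k)))" for n
  proof -
    have "(if n = 0 then 1 else 0) = complex_of_real (\<Sum>k=0..n. nc_moments \<kappa> k * R k n)"
      unfolding inv by simp
    then show ?thesis
      by (simp add: phi_resolvent_op[OF Y] R_def left_diff_distrib sum_subtractf mult.commute
          del: power_Suc)
  qed
  show ?thesis
  proof
    assume "\<forall>n. \<phi> (op_pow Y n) = complex_of_real (nc_moments \<kappa> n)"
    then show "\<forall>n. \<phi> (resolvent_op \<kappa> Y n) = (if n = 0 then 1 else 0)"
      using eq by simp
  next
    assume *: "\<forall>n. \<phi> (resolvent_op \<kappa> Y n) = (if n = 0 then 1 else 0)"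
    show "\<forall>n. \<phi> (op_pow Y n) = complex_of_real (nc_moments \<kappa> n)"
    proof
      fix n
      show "\<phi> (op_pow Y n) = complex_of_real (nc_moments \<kappa> n)"
      proof (induction n rule: less_induct)
        case (less n)
        \<comment> \<open>The diagonal coefficient is the constant term of a power of a series with
          constant term 1.\<close>
        have "(\<Sum>k=0..n. complex_of_real (R k n) * (\<phi> (op_pow Y k) - complex_of_real (nc_moments \<kappa> k)))
            = (\<Sum>k=0..n. if k = n then \<phi> (op_pow Y n) - complex_of_real (nc_moments \<kappa> n) else 0)"
          using less by (intro sum.cong) (auto simp: R_def fps_power_zeroth)
        then show ?case using eq[of n] * by simp
      qed
    qed
  qed
qed

text \<open>The trace property of alternating centred words beginning with i, put in a form that is
  closed under sums: v may be preceded by any alternating centred word not ending in i. The empty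
  word is included, so v itself has trace 0.\<close>

definition alternating_null :: "'i set \<Rightarrow> ('i \<Rightarrow> 'h op) \<Rightarrow> 'i \<Rightarrow> 'h op \<Rightarrow> bool" where
  "alternating_null I x i v \<longleftrightarrow> v \<in> M \<and>
     (\<forall>is as. (is = [] \<or> last is \<noteq> i) \<longrightarrow> set is \<subseteq> I \<longrightarrow> distinct_adj is \<longrightarrow>
        list_all2 (\<lambda>i a. a \<in> star_algebra (x i) \<and> \<phi> a = 0) is as \<longrightarrow> \<phi> (op_prod as o\<^sub>L v) = 0)"

lemma list_all2_star_algebra_subset:
  assumes "list_all2 (\<lambda>i a. a \<in> star_algebra (x i) \<and> \<phi> a = 0) is as" and "set is \<subseteq> I"
    and "\<And>i. i \<in> I \<Longrightarrow> x i \<in> M"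
  shows "op_prod as \<in> M"
proof (rule M_op_prod)
  show "set as \<subseteq> M"
    using assms(1,2)
  proof (induction rule: list_all2_induct)
    case (Cons i "is" a as)
    then show ?case using star_algebra_subset[OF assms(3)[of i]] by auto
  qed simp
qed

lemma alternating_null_zero: "alternating_null I x i 0"
  by (simp add: alternating_null_def M_intros compose.zero_right)

lemma alternating_null_add:
  assumes "\<And>i. i \<in> I \<Longrightarrow> x i \<in> M" and "alternating_null I x i v" and "alternating_null I x i w"
  shows "alternating_null I x i (v + w)"
  unfolding alternating_null_def
proof (intro conjI allI impI)
  show "v + w \<in> M" using assms(2,3) by (simp add: alternating_null_def M_intros)
  fix "is" as
  assume *: "is = [] \<or> last is \<noteq> i" "set is \<subseteq> I" "distinct_adj is"
    "list_all2 (\<lambda>i a. a \<in> star_algebra (x i) \<and> \<phi> a = 0) is as"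
  have "op_prod as \<in> M" using list_all2_star_algebra_subset[OF *(4,2) assms(1)] .
  moreover have "v \<in> M" "w \<in> M" "\<phi> (op_prod as o\<^sub>L v) = 0" "\<phi> (op_prod as o\<^sub>L w) = 0"
    using assms(2,3) * unfolding alternating_null_def by blast+
  ultimately show "\<phi> (op_prod as o\<^sub>L (v + w)) = 0"
    by (simp add: compose.add_right add M_intros)
qed

lemma alternating_null_sum:
  assumes "\<And>i. i \<in> I \<Longrightarrow> x i \<in> M" and "\<And>k. k \<in> K \<Longrightarrow> alternating_null I x i (f k)"
  shows "alternating_null I x i (sum f K)"
  using assms(2) by (induction K rule: infinite_finite_induct)
    (simp_all add: alternating_null_zero alternating_null_add[OF assms(1)])

lemma alternating_null_uminus:
  assumes "\<And>i. i \<in> I \<Longrightarrow> x i \<in> M" and "alternating_null I x i v"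
  shows "alternating_null I x i (- v)"
  unfolding alternating_null_def
proof (intro conjI allI impI)
  show "- v \<in> M" using assms(2) by (simp add: alternating_null_def M_intros)
  fix "is" as
  assume *: "is = [] \<or> last is \<noteq> i" "set is \<subseteq> I" "distinct_adj is"
    "list_all2 (\<lambda>i a. a \<in> star_algebra (x i) \<and> \<phi> a = 0) is as"
  have "op_prod as \<in> M" using list_all2_star_algebra_subset[OF *(4,2) assms(1)] .
  moreover have "v \<in> M" "\<phi> (op_prod as o\<^sub>L v) = 0"
    using assms(2) * unfolding alternating_null_def by blast+
  ultimately show "\<phi> (op_prod as o\<^sub>L (- v)) = 0"
    by (simp add: compose.minus_right phi_uminus M_intros)
qed

text \<open>The new letter e is appended to the word in front of it, which then ends in i and may
  precede v. For v = 1 the trace vanishes by freeness itself.\<close>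

lemma alternating_null_compose:
  assumes x: "\<And>i. i \<in> I \<Longrightarrow> x i \<in> M" and free: "freely_independent \<phi> I x"
    and i: "i \<in> I" and e: "e \<in> star_algebra (x i)" "\<phi> e = 0"
    and v: "v = id_blinfun \<or> (\<exists>j\<in>I - {i}. alternating_null I x j v)"
  shows "alternating_null I x i (e o\<^sub>L v)"
  unfolding alternating_null_def
proof (intro conjI allI impI)
  show "e o\<^sub>L v \<in> M"
    using v e star_algebra_subset[OF x[OF i]] by (auto simp: alternating_null_def M_intros)
  fix "is" as
  assume *: "is = [] \<or> last is \<noteq> i" "set is \<subseteq> I" "distinct_adj is"
    "list_all2 (\<lambda>i a. a \<in> star_algebra (x i) \<and> \<phi> a = 0) is as"
  have **: "set (is @ [i]) \<subseteq> I" "distinct_adj (is @ [i])"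
    "list_all2 (\<lambda>i a. a \<in> star_algebra (x i) \<and> \<phi> a = 0) (is @ [i]) (as @ [e])"
    using * i e by (auto simp: distinct_adj_append_iff intro!: list_all2_appendI)
  have eq: "op_prod as o\<^sub>L (e o\<^sub>L v) = op_prod (as @ [e]) o\<^sub>L v"
    unfolding op_prod_append by (simp add: compose_assoc)
  show "\<phi> (op_prod as o\<^sub>L (e o\<^sub>L v)) = 0"
    using v
  proof
    assume "v = id_blinfun"
    moreover have "\<phi> (op_prod (as @ [e])) = 0"
      using free ** unfolding freely_independent_def by blast
    ultimately show ?thesis unfolding eq by (simp only: compose_id)
  next
    assume "\<exists>j\<in>I - {i}. alternating_null I x j v"
    then obtain j where j: "j \<noteq> i" "alternating_null I x j v" by blast
    have "is @ [i] = [] \<or> last (is @ [i]) \<noteq> j" using j(1) by simp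
    then show ?thesis
      unfolding eq using j(2)[unfolded alternating_null_def] ** by blast
  qed
qed

lemma alternating_null_free_words:
  assumes x: "\<And>i. i \<in> I \<Longrightarrow> x i \<in> M" and free: "freely_independent \<phi> I x"
    and E: "\<And>i n. i \<in> I \<Longrightarrow> E i n \<in> star_algebra (x i)" "\<And>i n. i \<in> I \<Longrightarrow> \<phi> (E i n) = 0"
  shows "i \<in> I \<Longrightarrow> alternating_null I x i (free_words E I n i)"
proof (induction n arbitrary: i rule: less_induct)
  case (less n)
  show ?case
    unfolding free_words.simps[of E I n i]
  proof (intro alternating_null_uminus alternating_null_sum x)
    fix k assume k: "k \<in> {1..n}"
    have "alternating_null I x i (E i k o\<^sub>L op_delta (n - k))"
      unfolding op_delta_def
      using alternating_null_compose[OF x free less.prems E[OF less.prems], of id_blinfun k]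
      by (simp add: compose.zero_right alternating_null_zero)
    moreover have "alternating_null I x i (\<Sum>j\<in>I - {i}. E i k o\<^sub>L free_words E I (n - k) j)"
    proof (intro alternating_null_sum x)
      fix j assume j: "j \<in> I - {i}"
      then have "alternating_null I x j (free_words E I (n - k) j)"
        using k by (intro less.IH) auto
      then show "alternating_null I x i (E i k o\<^sub>L free_words E I (n - k) j)"
        using j by (intro alternating_null_compose[OF x free less.prems E[OF less.prems]]) auto
    qed
    ultimately show "alternating_null I x i
        (E i k o\<^sub>L (op_delta (n - k) + (\<Sum>j\<in>I - {i}. free_words E I (n - k) j)))"
      unfolding compose.add_right compose.sum_right by (intro alternating_null_add x)
  qed
qed

text \<open>
  Let \<open>1 - E\<^sub>i\<close> be the inverse of \<open>L\<^sub>i = C\<^sub>i(z) - z Y\<^sub>i\<close>.  The coefficients of the \<open>E\<^sub>i\<close> are centred,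
  hence the signed sum \<open>W\<close> of all alternating words in the \<open>E\<^sub>i\<close> has trace \<open>1\<close> by freeness; but \<open>W\<close>
  is the inverse of \<open>1 + \<Sum> (L\<^sub>i - 1)\<close>, which belongs to \<open>\<Sum> Y\<^sub>i\<close> and the sums of the cumulants.
\<close>

theorem free_cumulants_additive:
  assumes I: "finite I" and x: "\<And>i. i \<in> I \<Longrightarrow> x i \<in> M" and free: "freely_independent \<phi> I x"
    and Y: "\<And>i. i \<in> I \<Longrightarrow> Y i \<in> star_algebra (x i)"
    and moments: "\<And>i n. i \<in> I \<Longrightarrow> \<phi> (op_pow (Y i) n) = complex_of_real (nc_moments (\<kappa> i) n)"
  shows "\<phi> (op_pow (\<Sum>i\<in>I. Y i) n) = complex_of_real (nc_moments (\<lambda>n. \<Sum>i\<in>I. \<kappa> i n) n)"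
proof -
  define L where "L i = shifted_op (\<kappa> i) (Y i)" for i
  define B where "B i = resolvent_op (\<kappa> i) (Y i)" for i
  define E where "E i n = op_delta n - B i n" for i n
  define V where "V n i = free_words E I n i" for n i
  define W where "W n = op_delta n + (\<Sum>i\<in>I. V n i)" for n
  define L' where "L' = shifted_op (\<lambda>n. \<Sum>i\<in>I. \<kappa> i n) (\<Sum>i\<in>I. Y i)"
  have YM: "Y i \<in> M" if "i \<in> I" for i using Y[OF that] star_algebra_subset[OF x[OF that]] by blast
  have E0: "E i 0 = 0" for i by (simp add: E_def B_def resolvent_op_0 op_delta_def)
  have BM: "B i n \<in> star_algebra (x i)" if "i \<in> I" for i n
    unfolding B_def by (intro resolvent_op_star_algebra Y that)
  have ES: "E i n \<in> star_algebra (x i)" if "i \<in> I" for i n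
    unfolding E_def op_delta_def using BM[OF that]
    by (cases "n = 0") (auto intro: star_algebra_diff star_algebra.one star_algebra_uminus)
  have Ephi: "\<phi> (E i n) = 0" if "i \<in> I" for i n
  proof -
    have "\<phi> (B i n) = (if n = 0 then 1 else 0)"
      using phi_resolvent_delta_iff[OF YM[OF that], of "\<kappa> i"] moments[OF that] by (simp add: B_def)
    moreover have "B i n \<in> M" using BM[OF that] star_algebra_subset[OF x[OF that]] by blast
    ultimately show ?thesis by (simp add: E_def phi_diff M_intros unital op_delta_def)
  qed
  have alt: "alternating_null I x i (V n i)" if "i \<in> I" for n i
    unfolding V_def using alternating_null_free_words[OF x free ES Ephi that] .
  have phiV: "V n i \<in> M" "\<phi> (V n i) = 0" if "i \<in> I" for n i
  proof -
    show "V n i \<in> M" using alt[OF that] by (simp add: alternating_null_def)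
    show "\<phi> (V n i) = 0"
      using alt[OF that, of n, unfolded alternating_null_def, THEN conjunct2, rule_format, of "[]" "[]"]
      by simp
  qed
  have phiW: "\<phi> (W n) = (if n = 0 then 1 else 0)" for n
    unfolding W_def op_delta_def using phiV
    by (simp add: add phi_sum M_sum M_intros unital)
  \<comment> \<open>A word beginning with i is a letter from E i followed by nothing or by a word
    beginning elsewhere. The term k = 0 of the convolution vanishes as E i has no constant
    term.\<close>
  have Vrec: "V n i = - op_conv (E i) (\<lambda>n. W n - V n i) n" if "i \<in> I" for n i
  proof -
    have W: "op_delta m + (\<Sum>j\<in>I - {i}. V m j) = W m - V m i" for m
      using I that by (simp add: W_def sum.remove)
    have "V n i = - (\<Sum>k\<in>{1..n}. E i k o\<^sub>L (W (n - k) - V (n - k) i))"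
      unfolding W[symmetric] unfolding V_def by (rule free_words.simps)
    also have "(\<Sum>k\<in>{1..n}. E i k o\<^sub>L (W (n - k) - V (n - k) i)) = op_conv (E i) (\<lambda>n. W n - V n i) n"
      by (simp add: op_conv_def sum.atLeast_Suc_atMost[of 0] E0 compose.zero_left)
    finally show ?thesis .
  qed
  have LE: "op_conv (L i) (E i) n = L i n - op_delta n" for i n
    unfolding E_def op_conv_linear by (simp add: op_conv_delta L_def B_def shifted_conv_resolvent)
  \<comment> \<open>Multiply the recursion by L i and use L E = L - 1: then L V = - (L - 1) (W - V),
    where L V cancels and V = W - L W remains.\<close>
  have VW: "V n i = W n - op_conv (L i) W n" if "i \<in> I" for n i
  proof -
    have "op_conv (L i) (\<lambda>n. V n i) n = op_conv (L i) (\<lambda>n. - op_conv (E i) (\<lambda>n. W n - V n i) n) n"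
      by (subst (1) Vrec[OF that]) (rule refl)
    also have "\<dots> = - op_conv (op_conv (L i) (E i)) (\<lambda>n. W n - V n i) n"
      by (simp add: op_conv_linear(4) op_conv_assoc)
    also have "op_conv (L i) (E i) = (\<lambda>n. L i n - op_delta n)"
      by (rule ext) (rule LE)
    also have "op_conv (\<lambda>n. L i n - op_delta n) (\<lambda>n. W n - V n i) n
        = op_conv (L i) W n - op_conv (L i) (\<lambda>n. V n i) n - (W n - V n i)"
      by (simp add: op_conv_linear op_conv_delta)
    finally show ?thesis by (simp add: algebra_simps)
  qed
  have L': "L' = (\<lambda>n. op_delta n + (\<Sum>i\<in>I. L i n - op_delta n))"
    unfolding L'_def L_def by (rule ext) (rule shifted_op_sum[OF I])
  \<comment> \<open>Summation over i gives L' W = W minus the sum of all V, that is 1. As L' has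
    constant term 1, W must be the resolvent of the sum.\<close>
  have "op_conv L' W n = op_conv L' (resolvent_op (\<lambda>n. \<Sum>i\<in>I. \<kappa> i n) (\<Sum>i\<in>I. Y i)) n" for n
  proof -
    have "op_conv L' W n = W n + (\<Sum>i\<in>I. op_conv (L i) W n - W n)"
      unfolding L' op_conv_linear by (simp add: op_conv_delta)
    also have "\<dots> = W n - (\<Sum>i\<in>I. V n i)"
      using VW by (simp add: sum_subtractf)
    also have "\<dots> = op_delta n" by (simp add: W_def)
    finally show ?thesis unfolding L'_def by (simp add: shifted_conv_resolvent)
  qed
  moreover have "L' 0 = id_blinfun" by (simp add: L'_def shifted_op_def)
  ultimately have "W n = resolvent_op (\<lambda>n. \<Sum>i\<in>I. \<kappa> i n) (\<Sum>i\<in>I. Y i) n" for n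
    using op_conv_cancel by blast
  then have "\<forall>n. \<phi> (resolvent_op (\<lambda>n. \<Sum>i\<in>I. \<kappa> i n) (\<Sum>i\<in>I. Y i) n) = (if n = 0 then 1 else 0)"
    using phiW by metis
  then show ?thesis
    using phi_resolvent_delta_iff[of "\<Sum>i\<in>I. Y i"] YM by (simp add: M_sum)
qed

end

section \<open>The integral of simple functions\<close>

definition finite_simple :: "(real \<Rightarrow> real) \<Rightarrow> bool" where
  "finite_simple s \<longleftrightarrow> simple_function lborel s \<and> emeasure lborel {t. s t \<noteq> 0} < \<infinity>"

lemma finite_simple_level:
  assumes "finite_simple s" and "c \<noteq> 0"
  shows "{t. s t = c} \<in> finite_borel_sets"
proof -
  have meas: "{t. P (s t)} \<in> sets borel" for P
    using assms(1) simple_functionD(2)[of lborel s "{c. P c}"]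
    by (simp add: finite_simple_def vimage_def)
  have "emeasure lborel {t. s t = c} \<le> emeasure lborel {t. s t \<noteq> 0}"
    using assms(2) meas by (intro emeasure_mono) auto
  then show ?thesis
    using assms(1) meas by (simp add: finite_borel_sets_def finite_simple_def le_less_trans)
qed

lemma finite_simple_finite_range: "finite_simple s \<Longrightarrow> finite (range s)"
  using simple_functionD(1)[of lborel s] by (simp add: finite_simple_def)

lemma finite_borel_sets_intros:
  "{} \<in> finite_borel_sets"
  "A \<in> finite_borel_sets \<Longrightarrow> B \<in> sets borel \<Longrightarrow> A \<inter> B \<in> finite_borel_sets"
  by (auto simp: finite_borel_sets_def intro: le_less_trans[OF emeasure_mono])

text \<open>The level set of 0 has infinite measure; its coefficient is 0, so the empty set can take
  its place.\<close>

lemma finite_simple_cases: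
  assumes "finite_simple s"
  shows "s t = (\<Sum>c\<in>range s. c * indicator (if c = 0 then {} else {t. s t = c}) t)"
proof -
  have "(\<Sum>c\<in>range s. c * indicator (if c = 0 then {} else {t. s t = c}) t)
      = (\<Sum>c\<in>range s. if c = s t then s t else 0)"
    by (intro sum.cong) (auto simp: indicator_def)
  also have "\<dots> = s t" using finite_simple_finite_range[OF assms] by simp
  finally show ?thesis by simp
qed

lemma sum_indicator_disjoint:
  fixes c :: "'i \<Rightarrow> real" and f :: "real \<Rightarrow> real"
  assumes "finite I" and "disjoint_family_on E I" and "i \<in> I" and "t \<in> E i"
  shows "(\<Sum>j\<in>I. f (c j) * indicator (E j) t) = f (c i)"
proof -
  have "(\<Sum>j\<in>I. f (c j) * indicator (E j) t) = (\<Sum>j\<in>I. if j = i then f (c i) else 0)"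
    using assms(2-4) by (intro sum.cong) (auto simp: indicator_def disjoint_family_on_def)
  then show ?thesis using assms by simp
qed

context free_poisson_random_measure
begin

text \<open>Two copies of the empty set are disjoint, so additivity gives X {} = X {} + X
  {}.\<close>

lemma X_empty: "X {} = 0"
proof -
  have "X (\<Union>i\<in>{1..2::nat}. {}) = (\<Sum>i\<in>{1..2::nat}. X {})"
    by (rule additive) (auto simp: finite_borel_sets_intros disjoint_family_on_def)
  then show ?thesis by (simp add: numeral_2_eq_2)
qed

lemma X_UN:
  assumes "finite J" and "disjoint_family_on E J" and "\<And>j. j \<in> J \<Longrightarrow> E j \<in> finite_borel_sets"
  shows "X (\<Union>j\<in>J. E j) = (\<Sum>j\<in>J. X (E j))"
proof (cases "J = {}")
  case False
  obtain h where h: "bij_betw h {1..card J} J"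
    using ex_bij_betw_nat_finite_1[OF assms(1)] by blast
  have "1 \<le> card J" using False assms(1) by (simp add: Suc_le_eq card_gt_0_iff)
  then have "X (\<Union>i\<in>{1..card J}. E (h i)) = (\<Sum>i\<in>{1..card J}. X (E (h i)))"
  proof (rule additive)
    show "\<forall>i\<in>{1..card J}. E (h i) \<in> finite_borel_sets"
      using assms(3) h by (auto dest: bij_betwE)
    show "disjoint_family_on (\<lambda>i. E (h i)) {1..card J}"
      using assms(2) h unfolding disjoint_family_on_def bij_betw_def inj_on_def by blast
  qed
  moreover have "(\<Union>i\<in>{1..card J}. E (h i)) = (\<Union>j\<in>J. E j)"
    using bij_betw_imp_surj_on[OF h] by (metis image_image)
  moreover have "(\<Sum>i\<in>{1..card J}. X (E (h i))) = (\<Sum>j\<in>J. X (E j))"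
    by (rule sum.reindex_bij_betw[OF h])
  ultimately show ?thesis by simp
qed (simp add: X_empty)

text \<open>Additivity merges all sets with the same coefficient into one level set, on which the
  definition is based.\<close>

lemma integral_simple_eq:
  assumes I: "finite I" and disj: "disjoint_family_on E I"
    and E: "\<And>i. i \<in> I \<Longrightarrow> E i \<in> finite_borel_sets"
    and s: "\<And>t. s t = (\<Sum>i\<in>I. c i * indicator (E i) t)"
  shows "integral_simple X s = (\<Sum>i\<in>I. c i *\<^sub>R X (E i))"
proof -
  \<comment> \<open>A set with coefficient 0 belongs to the level set of 0, and the coefficient of
    an empty set need not be a value of s; both kinds contribute 0.\<close>
  define I' where "I' = {i \<in> I. c i \<noteq> 0 \<and> E i \<noteq> {}}"
  have val: "s t = c i" if "i \<in> I" "t \<in> E i" for i t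
    using sum_indicator_disjoint[OF I disj that, of "\<lambda>x. x" c] by (simp add: s)
  have zero: "s t = 0" if "\<And>i. i \<in> I \<Longrightarrow> t \<notin> E i" for t
    using that by (auto simp: s indicator_def intro!: sum.neutral)
  have "range s \<subseteq> insert 0 (c ` I)" using val zero by blast
  then have fin: "finite (range s)" using I by (meson finite_imageI finite_insert finite_subset)
  have level: "X {t. s t = y} = (\<Sum>i\<in>{i\<in>I'. c i = y}. X (E i))" if "y \<noteq> 0" for y
  proof -
    have "{t. s t = y} = (\<Union>i\<in>{i\<in>I'. c i = y}. E i)"
      using that val zero by (fastforce simp: I'_def)
    then show ?thesis
      using I disj E by (subst X_UN[symmetric]) (auto simp: I'_def disjoint_family_on_def)
  qed
  have "integral_simple X s = (\<Sum>y\<in>range s - {0}. y *\<^sub>R X {t. s t = y})"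
    unfolding integral_simple_def using fin by (intro sum.mono_neutral_right) auto
  also have "\<dots> = (\<Sum>y\<in>range s - {0}. \<Sum>i\<in>{i\<in>I'. c i = y}. c i *\<^sub>R X (E i))"
    by (intro sum.cong refl) (simp add: level scaleR_sum_right)
  also have "\<dots> = (\<Sum>i\<in>I'. c i *\<^sub>R X (E i))"
  proof (rule sum.group)
    show "c ` I' \<subseteq> range s - {0}"
    proof
      fix y assume "y \<in> c ` I'"
      then obtain i t where "y = c i" "i \<in> I'" "t \<in> E i" by (auto simp: I'_def)
      moreover from this have "s t = c i" by (intro val) (simp_all add: I'_def)
      ultimately show "y \<in> range s - {0}"
        by (metis (mono_tags, lifting) DiffI I'_def mem_Collect_eq rangeI singletonD)
    qed
  qed (use I fin in \<open>auto simp: I'_def\<close>)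
  also have "\<dots> = (\<Sum>i\<in>I. c i *\<^sub>R X (E i))"
    using I by (intro sum.mono_neutral_left) (auto simp: I'_def X_empty)
  finally show ?thesis .
qed

text \<open>All three functions are written over the common refinement of the level sets of s and
  r.\<close>

lemma integral_simple_diff:
  assumes s: "finite_simple s" and r: "finite_simple r"
  shows "integral_simple X (\<lambda>t. s t - r t) = integral_simple X s - integral_simple X r"
proof -
  \<comment> \<open>The cell where both functions vanish has infinite measure and is left
    out.\<close>
  define I where "I = range s \<times> range r - {(0, 0)}"
  define E where "E p = {t. s t = fst p} \<inter> {t. r t = snd p}" for p
  have I: "finite I" by (simp add: I_def finite_simple_finite_range s r)
  have disj: "disjoint_family_on E I" by (auto simp: disjoint_family_on_def E_def)
  have Eb: "E p \<in> finite_borel_sets" if p: "p \<in> I" for p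
  proof -
    have meas: "{t. s t = c} \<in> sets borel" "{t. r t = c} \<in> sets borel" for c
      using s r simple_functionD(2)[of lborel s "{c}"] simple_functionD(2)[of lborel r "{c}"]
      by (simp_all add: finite_simple_def vimage_def)
    show ?thesis
    proof (cases "fst p = 0")
      case True
      then have "snd p \<noteq> 0" using p by (auto simp: I_def prod_eq_iff)
      then show ?thesis
        using finite_borel_sets_intros(2)[OF finite_simple_level[OF r] meas(1)]
        by (simp add: E_def Int_commute)
    next
      case False
      then show ?thesis
        using finite_borel_sets_intros(2)[OF finite_simple_level[OF s] meas(2)] by (simp add: E_def)
    qed
  qed
  \<comment> \<open>Stated for any f with f 0 0 = 0, to be used for the difference and for both
    projections.\<close>
  have rep: "f (s t) (r t) = (\<Sum>p\<in>I. f (fst p) (snd p) * indicator (E p) t)"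
    if "f 0 0 = 0" for f :: "real \<Rightarrow> real \<Rightarrow> real" and t
  proof (cases "(s t, r t) \<in> I")
    case True
    then show ?thesis
      using sum_indicator_disjoint[OF I disj True, of t "\<lambda>x. x" "\<lambda>p. f (fst p) (snd p)"] by (simp add: E_def)
  next
    case False
    then have "s t = 0" "r t = 0" by (auto simp: I_def)
    moreover have "t \<notin> E p" if "p \<in> I" for p
      using that calculation by (auto simp: E_def I_def)
    ultimately show ?thesis by (simp add: \<open>f 0 0 = 0\<close>)
  qed
  show ?thesis
    using integral_simple_eq[OF I disj Eb rep[of "\<lambda>x y. x - y"]]
      integral_simple_eq[OF I disj Eb rep[of "\<lambda>x y. x"]]
      integral_simple_eq[OF I disj Eb rep[of "\<lambda>x y. y"]]
    by (simp add: scaleR_diff_left sum_subtractf)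
qed

lemma X_M: "E \<in> finite_borel_sets \<Longrightarrow> X E \<in> M" "E \<in> finite_borel_sets \<Longrightarrow> adj (X E) = X E"
  using selfadjoint[of E] by (simp_all add: selfadjoint_part_def)

lemma phi_X_pow:
  assumes "E \<in> finite_borel_sets"
  shows "\<phi> (op_pow (X E) n) = complex_of_real (nc_moments (\<lambda>_. measure lborel E) n)"
proof (cases "n = 0")
  case False
  then have "\<phi> (op_pow (X E) n) = nc_moments (free_cumulants (\<lambda>j. \<phi> (op_pow (X E) j))) n"
    by (simp add: nc_moments_free_cumulants)
  also have "\<dots> = nc_moments (\<lambda>_. complex_of_real (measure lborel E)) n"
    using cumulants[OF assms] by (intro nc_moments_cong) (simp add: op_cumulant_def)
  finally show ?thesis by (simp add: nc_moments_of_real)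
qed (simp add: nc_moments_0 unital)

lemma integral_simple_rep:
  assumes s: "finite_simple s"
  obtains k F h where "1 \<le> k" and "\<And>i. i \<in> {1..k::nat} \<Longrightarrow> F i \<in> finite_borel_sets"
    and "disjoint_family_on F {1..k}" and "\<And>t. s t = (\<Sum>i=1..k. h i * indicator (F i) t)"
    and "integral_simple X s = (\<Sum>i=1..k. h i *\<^sub>R X (F i))"
proof -
  obtain h where h: "bij_betw h {1..card (range s)} (range s)"
    using ex_bij_betw_nat_finite_1[OF finite_simple_finite_range[OF s]] by blast
  define F where "F i = (if h i = 0 then {} else {t. s t = h i})" for i
  have Fb: "F i \<in> finite_borel_sets" for i
    using finite_simple_level[OF s] by (simp add: F_def finite_borel_sets_intros)
  have disj: "disjoint_family_on F {1..card (range s)}"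
    unfolding disjoint_family_on_def
  proof (intro ballI impI)
    fix i j assume "i \<in> {1..card (range s)}" "j \<in> {1..card (range s)}" "i \<noteq> j"
    then have "h i \<noteq> h j" using inj_onD[OF bij_betw_imp_inj_on[OF h]] by blast
    then show "F i \<inter> F j = {}" by (auto simp: F_def)
  qed
  have rep: "s t = (\<Sum>i=1..card (range s). h i * indicator (F i) t)" for t
    unfolding F_def by (rule trans[OF finite_simple_cases[OF s] sum.reindex_bij_betw[OF h, symmetric]])
  show thesis
  proof (rule that[OF _ Fb disj rep])
    show "1 \<le> card (range s)"
      using finite_simple_finite_range[OF s] by (simp add: Suc_le_eq card_gt_0_iff)
    show "integral_simple X s = (\<Sum>i=1..card (range s). h i *\<^sub>R X (F i))"
      by (rule integral_simple_eq[OF _ disj Fb rep]) simp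
  qed
qed

lemma integral_simple_selfadjoint:
  assumes "finite_simple s"
  shows "integral_simple X s \<in> M" and "adj (integral_simple X s) = integral_simple X s"
proof -
  obtain k F h where "1 \<le> k" and F: "\<And>i. i \<in> {1..k::nat} \<Longrightarrow> F i \<in> finite_borel_sets"
    and "disjoint_family_on F {1..k}" and "\<And>t. s t = (\<Sum>i=1..k. h i * indicator (F i) t)"
    and eq: "integral_simple X s = (\<Sum>i=1..k. h i *\<^sub>R X (F i))"
    by (rule integral_simple_rep[OF assms]) (rule that)
  show "integral_simple X s \<in> M" unfolding eq by (intro M_sum M_intros X_M F)
  have "(\<Sum>i\<in>J. h i *\<^sub>R X (F i)) \<in> M \<and> adj (\<Sum>i\<in>J. h i *\<^sub>R X (F i)) = (\<Sum>i\<in>J. h i *\<^sub>R X (F i))"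
    if "finite J" "J \<subseteq> {1..k}" for J
    using that
  proof (induction J rule: finite_induct)
    case empty
    then show ?case using adj_M_simps(1)[OF M_intros(1), of 0] by (simp add: M_intros)
  next
    case (insert i J)
    then have "X (F i) \<in> M" "adj (X (F i)) = X (F i)" using F X_M by auto
    with insert show ?case by (simp add: adj_M_simps M_intros)
  qed
  then show "adj (integral_simple X s) = integral_simple X s" unfolding eq by blast
qed

lemma phi_integral_simple_pow:
  assumes "finite_simple s"
  shows "\<phi> (op_pow (integral_simple X s) n) =
    complex_of_real (nc_moments (\<lambda>m. \<integral>t. s t ^ m \<partial>lebesgue) n)"
proof -
  obtain k F h where k: "1 \<le> k" and F: "\<And>i. i \<in> {1..k::nat} \<Longrightarrow> F i \<in> finite_borel_sets"
    and disj: "disjoint_family_on F {1..k}" and s: "\<And>t. s t = (\<Sum>i=1..k. h i * indicator (F i) t)"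
    and eq: "integral_simple X s = (\<Sum>i=1..k. h i *\<^sub>R X (F i))"
    by (rule integral_simple_rep[OF assms]) (rule that)
  have "\<phi> (op_pow (\<Sum>i=1..k. h i *\<^sub>R X (F i)) n) =
      complex_of_real (nc_moments (\<lambda>m. \<Sum>i=1..k. h i ^ m * measure lborel (F i)) n)"
  proof (rule free_cumulants_additive)
    show "freely_independent \<phi> {1..k} (\<lambda>i. X (F i))"
      using free k F disj by blast
    show "X (F i) \<in> M" if "i \<in> {1..k}" for i using X_M F that by blast
    show "h i *\<^sub>R X (F i) \<in> star_algebra (X (F i))" for i
      by (intro star_algebra_scaleR star_algebra.gen)
    show "\<phi> (op_pow (h i *\<^sub>R X (F i)) n) =
        complex_of_real (nc_moments (\<lambda>m. h i ^ m * measure lborel (F i)) n)" if "i \<in> {1..k}" for i n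
      using phi_X_pow[OF F[OF that]] X_M(1)[OF F[OF that]]
      by (simp add: op_pow_scaleR phi_scaleR M_intros nc_moments_scale)
  qed simp
  also have "nc_moments (\<lambda>m. \<Sum>i=1..k. h i ^ m * measure lborel (F i)) n
      = nc_moments (\<lambda>m. \<integral>t. s t ^ m \<partial>lebesgue) n"
  proof (rule nc_moments_cong)
    fix m :: nat assume m: "1 \<le> m"
    \<comment> \<open>Disjointness lets the power act on each coefficient; off the sets 0 ^ m = 0
      requires m to be positive.\<close>
    have pow: "s t ^ m = (\<Sum>i=1..k. h i ^ m * indicator (F i) t)" for t
    proof (cases "\<exists>i\<in>{1..k}. t \<in> F i")
      case True
      then obtain i where i: "i \<in> {1..k}" "t \<in> F i" by blast
      show ?thesis
        using sum_indicator_disjoint[OF _ disj i, of "\<lambda>x. x" h]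
          sum_indicator_disjoint[OF _ disj i, of "\<lambda>x. x ^ m" h] by (simp add: s)
    next
      case False
      then have "indicator (F i) t = (0::real)" if "i \<in> {1..k}" for i using that by auto
      then show ?thesis using m by (simp add: s)
    qed
    have F': "F i \<in> sets lebesgue" "emeasure lebesgue (F i) < \<infinity>"
      "measure lebesgue (F i) = measure lborel (F i)" if "i \<in> {1..k}" for i
      using F[OF that] by (auto simp: finite_borel_sets_def)
    have "(\<integral>t. s t ^ m \<partial>lebesgue) = (\<Sum>i=1..k. \<integral>t. h i ^ m * indicator (F i) t \<partial>lebesgue)"
      unfolding pow
      by (intro Bochner_Integration.integral_sum integrable_mult_right integrable_real_indicator F')
    also have "\<dots> = (\<Sum>i=1..k. h i ^ m * measure lborel (F i))"
      using F'(3) by (intro sum.cong refl) simp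
    finally show "(\<Sum>i=1..k. h i ^ m * measure lborel (F i)) = (\<integral>t. s t ^ m \<partial>lebesgue)" by simp
  qed
  finally show ?thesis unfolding eq .
qed

lemma finite_simple_diff:
  assumes s: "finite_simple s" and r: "finite_simple r"
  shows "finite_simple (\<lambda>t. s t - r t)"
proof -
  have sf: "simple_function lborel (\<lambda>t. s t - r t)"
    using s r by (intro simple_function_diff) (auto simp: finite_simple_def)
  have meas: "{t. s t \<noteq> 0} \<in> sets lborel" "{t. r t \<noteq> 0} \<in> sets lborel"
    using s r simple_functionD(2)[of lborel s "- {0}"] simple_functionD(2)[of lborel r "- {0}"]
    by (simp_all add: finite_simple_def vimage_def Compl_eq)
  have "emeasure lborel {t. s t - r t \<noteq> 0} \<le> emeasure lborel ({t. s t \<noteq> 0} \<union> {t. r t \<noteq> 0})"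
    using meas by (intro emeasure_mono) auto
  also have "\<dots> \<le> emeasure lborel {t. s t \<noteq> 0} + emeasure lborel {t. r t \<noteq> 0}"
    using meas by (rule emeasure_subadditive)
  also have "\<dots> < \<infinity>" using s r by (simp add: finite_simple_def ennreal_add_less_top)
  finally show ?thesis using sf by (simp add: finite_simple_def)
qed

text \<open>The 2-norm of the integral of g: its second moment is \<kappa> 2 + (\<kappa> 1)^2, where
  \<kappa> m is the integral of g^m.\<close>

definition moment_norm :: "(real \<Rightarrow> real) \<Rightarrow> real" where
  "moment_norm g = sqrt ((\<integral>t. g t ^ 2 \<partial>lebesgue) + (\<integral>t. g t ^ 1 \<partial>lebesgue)\<^sup>2)"

lemma nc_norm_integral_simple_diff:
  assumes s: "finite_simple s" and r: "finite_simple r"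
  shows "nc_norm \<phi> 2 (integral_simple X s - integral_simple X r) = moment_norm (\<lambda>t. s t - r t)"
proof -
  let ?d = "\<lambda>t. s t - r t"
  note d = finite_simple_diff[OF s r]
  have "nc_norm \<phi> 2 (integral_simple X ?d) = sqrt (Re (\<phi> (op_pow (integral_simple X ?d) 2)))"
    by (simp add: nc_norm_2 integral_simple_selfadjoint[OF d] op_pow_2)
  then show ?thesis
    unfolding phi_integral_simple_pow[OF d] nc_moments_2 moment_norm_def
      integral_simple_diff[OF s r, symmetric] by simp
qed

end

section \<open>Approximation by simple functions\<close>

abbreviation L_inf_minus :: "(real \<Rightarrow> real) set" where
  "L_inf_minus \<equiv> (\<Inter>n\<in>{1..}. L_space n)"

lemma L_inf_minus_iff:
  "f \<in> L_inf_minus \<longleftrightarrow> f \<in> borel_measurable lebesgue \<and> (\<forall>p\<ge>1. integrable lebesgue (\<lambda>t. \<bar>f t\<bar> ^ p))"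
  by (auto simp: L_space_def)

lemma L_inf_minus_dominated:
  assumes w: "w \<in> L_inf_minus" and g: "g \<in> borel_measurable lebesgue" and le: "\<And>t. \<bar>g t\<bar> \<le> \<bar>w t\<bar>"
  shows "g \<in> L_inf_minus" and "1 \<le> m \<Longrightarrow> integrable lebesgue (\<lambda>t. g t ^ m)"
proof -
  have bound: "integrable lebesgue h" if "h \<in> borel_measurable lebesgue" "\<And>t. \<bar>h t\<bar> = \<bar>g t\<bar> ^ m" "1 \<le> m"
    for h :: "real \<Rightarrow> real" and m
  proof (rule Bochner_Integration.integrable_bound)
    show "integrable lebesgue (\<lambda>t. \<bar>w t\<bar> ^ m)" using w that(3) unfolding L_inf_minus_iff by blast
    show "AE t in lebesgue. norm (h t) \<le> norm (\<bar>w t\<bar> ^ m)"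
      using le that(2) by (auto intro!: AE_I2 power_mono simp: power_abs)
  qed (rule that)
  show "g \<in> L_inf_minus" unfolding L_inf_minus_iff
    using g by (auto intro!: bound)
  show "1 \<le> m \<Longrightarrow> integrable lebesgue (\<lambda>t. g t ^ m)"
    using g by (intro bound[of _ m]) (auto simp: power_abs)
qed

lemma L_inf_minus_convergence:
  assumes w: "w \<in> L_inf_minus" and m: "1 \<le> m"
    and g: "\<And>k. g k \<in> borel_measurable lebesgue" "h \<in> borel_measurable lebesgue"
    and le: "\<And>k t. \<bar>g k t\<bar> \<le> \<bar>w t\<bar>" and lim: "AE t in lebesgue. (\<lambda>k. g k t) \<longlonglongrightarrow> h t"
  shows "(\<lambda>k. \<integral>t. g k t ^ m \<partial>lebesgue) \<longlonglongrightarrow> (\<integral>t. h t ^ m \<partial>lebesgue)"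
proof (rule integral_dominated_convergence)
  show "integrable lebesgue (\<lambda>t. \<bar>w t\<bar> ^ m)" using w m unfolding L_inf_minus_iff by blast
  show "AE t in lebesgue. (\<lambda>k. g k t ^ m) \<longlonglongrightarrow> h t ^ m"
    using lim by eventually_elim (rule tendsto_power)
  show "AE t in lebesgue. norm (g k t ^ m) \<le> \<bar>w t\<bar> ^ m" for k
    using le by (auto intro!: AE_I2 power_mono simp: power_abs)
qed (use g in auto)

lemma power_add_le_two_power:
  fixes a b :: real
  assumes "0 \<le> a" and "0 \<le> b"
  shows "(a + b) ^ p \<le> 2 ^ p * (a ^ p + b ^ p)"
proof -
  have "(a + b) ^ p \<le> (2 * max a b) ^ p" using assms by (intro power_mono) auto
  also have "\<dots> = 2 ^ p * max a b ^ p" by (rule power_mult_distrib)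
  also have "max a b ^ p \<le> a ^ p + b ^ p" using assms by (simp add: max_def)
  finally show ?thesis by simp
qed

lemma L_inf_minus_add:
  assumes f: "f \<in> L_inf_minus" and g: "g \<in> L_inf_minus"
  shows "(\<lambda>t. f t + g t) \<in> L_inf_minus"
  unfolding L_inf_minus_iff
proof (intro conjI allI impI)
  show meas: "(\<lambda>t. f t + g t) \<in> borel_measurable lebesgue"
    using f g unfolding L_inf_minus_iff by (intro borel_measurable_add) auto
  fix p :: nat assume p: "1 \<le> p"
  show "integrable lebesgue (\<lambda>t. \<bar>f t + g t\<bar> ^ p)"
  proof (rule Bochner_Integration.integrable_bound)
    show "integrable lebesgue (\<lambda>t. 2 ^ p * (\<bar>f t\<bar> ^ p + \<bar>g t\<bar> ^ p))"
      using f g p unfolding L_inf_minus_iff by simp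
    show "(\<lambda>t. \<bar>f t + g t\<bar> ^ p) \<in> borel_measurable lebesgue" using meas by (intro borel_measurable_power borel_measurable_abs)
    have "\<bar>f t + g t\<bar> ^ p \<le> 2 ^ p * (\<bar>f t\<bar> ^ p + \<bar>g t\<bar> ^ p)" for t
      by (rule order_trans[OF power_mono power_add_le_two_power]) simp_all
    then show "AE t in lebesgue. norm (\<bar>f t + g t\<bar> ^ p) \<le> norm (2 ^ p * (\<bar>f t\<bar> ^ p + \<bar>g t\<bar> ^ p))"
      by (intro AE_I2) (simp add: power_abs)
  qed
qed

lemma finite_simple_measurable: "finite_simple s \<Longrightarrow> s \<in> borel_measurable lebesgue"
  by (rule measurable_completion, rule borel_measurable_simple_function) (simp add: finite_simple_def)

lemma finite_simple_L_inf_minus: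
  assumes s: "finite_simple s"
  shows "s \<in> L_inf_minus"
proof -
  define B where "B = Max (abs ` range s)"
  define S where "S = {t. s t \<noteq> 0}"
  have B: "\<bar>s t\<bar> \<le> B" for t
    unfolding B_def using finite_simple_finite_range[OF s] by (intro Max_ge) auto
  have S: "S \<in> sets lebesgue" "emeasure lebesgue S < \<infinity>"
    using s simple_functionD(2)[of lborel s "- {0}"]
    by (auto simp: finite_simple_def vimage_def Compl_eq S_def)
  have "(\<lambda>t. B * indicator S t) \<in> L_inf_minus"
    unfolding L_inf_minus_iff
  proof (intro conjI allI impI)
    show "(\<lambda>t. B * indicator S t) \<in> borel_measurable lebesgue"
      using S by (intro borel_measurable_times borel_measurable_indicator) auto
    fix p :: nat assume "1 \<le> p"
    have "\<bar>B * indicator S t\<bar> ^ p = \<bar>B\<bar> ^ p * indicator S t" for t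
      using \<open>1 \<le> p\<close> by (auto simp: indicator_def)
    then show "integrable lebesgue (\<lambda>t. \<bar>B * indicator S t\<bar> ^ p)"
      using S by (simp only:) (intro integrable_mult_right integrable_real_indicator)
  qed
  then show ?thesis
  proof (rule L_inf_minus_dominated(1)[OF _ finite_simple_measurable[OF s]])
    show "\<bar>s t\<bar> \<le> \<bar>B * indicator S t\<bar>" for t
      using B[of t] by (auto simp: S_def indicator_def)
  qed
qed

text \<open>The majorant 2 |f| gives dominated convergence for all exponents at once, and the
  support condition is the one required of competitors in
  \<open>integral_finite_support\<close>.\<close>

definition approximates :: "(nat \<Rightarrow> real \<Rightarrow> real) \<Rightarrow> (real \<Rightarrow> real) \<Rightarrow> bool" where
  "approximates s f \<longleftrightarrow> (\<forall>k. finite_simple (s k)) \<and> (\<forall>k. {t. s k t \<noteq> 0} \<subseteq> {t. f t \<noteq> 0}) \<and>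
     (\<forall>k t. \<bar>s k t\<bar> \<le> 2 * \<bar>f t\<bar>) \<and> (AE t in lebesgue. (\<lambda>k. s k t) \<longlonglongrightarrow> f t)"

lemma approximates_exists:
  assumes f: "f \<in> borel_measurable lebesgue"
  shows "\<exists>s. approximates s f"
proof -
  obtain g where g: "g \<in> borel_measurable lborel" and fg: "AE t in lborel. f t = g t"
    using completion_ex_borel_measurable_real[OF f] by blast
  obtain N where N: "{t \<in> space lborel. f t \<noteq> g t} \<subseteq> N" "emeasure lborel N = 0" "N \<in> sets lborel"
    using fg by (rule AE_E)
  \<comment> \<open>A Borel version of f that is set to 0 on the exceptional null set. Thus |h| is
    at most |f| everywhere, and bounds and supports carry over without exceptions.\<close>
  define h where "h t = g t * indicator (- N) t" for t
  have h: "h \<in> borel_measurable lborel"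
    unfolding h_def using g N(3) by (intro borel_measurable_times borel_measurable_indicator) auto
  have hf: "h t = (if t \<in> N then 0 else f t)" for t
  proof -
    have "f t = g t" if "t \<notin> N" using N(1) that by auto
    then show ?thesis by (simp add: h_def)
  qed
  obtain F where F: "\<And>k. simple_function lborel (F k)" "\<And>t. (\<lambda>k. F k t) \<longlonglongrightarrow> h t"
    "\<And>k t. \<bar>F k t\<bar> \<le> 2 * \<bar>h t\<bar>"
    using borel_measurable_implies_sequence_metric[OF h, of 0] by (auto simp: dist_real_def)
  \<comment> \<open>The cut-off makes the support finite in measure and is eventually inactive at
    every point.\<close>
  define s where "s k t = F k t * indicator {- real k..real k} t" for k t
  have "approximates s f"
    unfolding approximates_def
  proof (intro conjI allI)
    have le: "\<bar>s k t\<bar> \<le> 2 * \<bar>h t\<bar>" for k t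
      using F(3)[of k t] by (simp add: s_def indicator_def)
    then show "\<bar>s k t\<bar> \<le> 2 * \<bar>f t\<bar>" for k t
      using hf[of t] le[of k t] by (auto split: if_splits)
    then show "{t. s k t \<noteq> 0} \<subseteq> {t. f t \<noteq> 0}" for k
      by (metis (mono_tags, lifting) Collect_mono abs_le_zero_iff abs_zero mult_zero_right)
    show "finite_simple (s k)" for k
    proof -
      have sf: "simple_function lborel (s k)"
        unfolding s_def using F(1) by (intro simple_function_mult simple_function_indicator) auto
      have "emeasure lborel {t. s k t \<noteq> 0} \<le> emeasure lborel {- real k..real k}"
        by (intro emeasure_mono) (auto simp: s_def indicator_def)
      also have "\<dots> < \<infinity>" by simp
      finally show ?thesis using sf by (simp add: finite_simple_def)
    qed
    have "N \<in> null_sets lebesgue" using N by (intro null_sets_completionI) auto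
    then show "AE t in lebesgue. (\<lambda>k. s k t) \<longlonglongrightarrow> f t"
    proof (rule AE_I')
      show "{t \<in> space lebesgue. \<not> (\<lambda>k. s k t) \<longlonglongrightarrow> f t} \<subseteq> N"
      proof
        fix t assume t: "t \<in> {t \<in> space lebesgue. \<not> (\<lambda>k. s k t) \<longlonglongrightarrow> f t}"
        have "\<forall>\<^sub>F k in sequentially. F k t = s k t"
          using eventually_ge_at_top[of "nat \<lceil>\<bar>t\<bar>\<rceil>"]
        proof eventually_elim
          case (elim k)
          then have "\<bar>t\<bar> \<le> real k" by linarith
          then show ?case by (auto simp: s_def indicator_def)
        qed
        then have "(\<lambda>k. s k t) \<longlonglongrightarrow> h t" using F(2) by (rule Lim_transform_eventually[rotated])
        then show "t \<in> N" using t hf[of t] by (auto split: if_splits)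
      qed
    qed
  qed
  then show ?thesis by blast
qed

lemma approximatesD:
  assumes "approximates s f"
  shows "finite_simple (s k)" and "{t. s k t \<noteq> 0} \<subseteq> {t. f t \<noteq> 0}" and "\<bar>s k t\<bar> \<le> 2 * \<bar>f t\<bar>"
    and "AE t in lebesgue. (\<lambda>k. s k t) \<longlonglongrightarrow> f t"
  using assms by (simp_all add: approximates_def)

lemma L_inf_minus_measurable: "f \<in> L_inf_minus \<Longrightarrow> f \<in> borel_measurable lebesgue"
  unfolding L_inf_minus_iff by blast

lemma L_inf_minus_scale: "f \<in> L_inf_minus \<Longrightarrow> (\<lambda>t. c * \<bar>f t\<bar>) \<in> L_inf_minus"
  unfolding L_inf_minus_iff by (auto simp: abs_mult power_mult_distrib)

lemma approximates_integral:
  assumes "approximates s f" and f: "f \<in> L_inf_minus" and "1 \<le> m"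
  shows "(\<lambda>k. \<integral>t. s k t ^ m \<partial>lebesgue) \<longlonglongrightarrow> (\<integral>t. f t ^ m \<partial>lebesgue)"
proof (rule L_inf_minus_convergence[OF L_inf_minus_scale[OF f, of 2] assms(3)])
  show "\<bar>s k t\<bar> \<le> \<bar>2 * \<bar>f t\<bar>\<bar>" for k t using approximatesD(3)[OF assms(1), of k t] by simp
qed (rule finite_simple_measurable approximatesD[OF assms(1)] L_inf_minus_measurable[OF f])+

lemma approximates_integral_abs_diff:
  assumes s: "approximates s f" and f: "f \<in> L_inf_minus" and m: "1 \<le> m"
  shows "(\<lambda>k. \<integral>t. \<bar>s k t - f t\<bar> ^ m \<partial>lebesgue) \<longlonglongrightarrow> 0"
    and "integrable lebesgue (\<lambda>t. \<bar>s k t - f t\<bar> ^ m)"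
proof -
  have meas: "(\<lambda>t. \<bar>s k t - f t\<bar>) \<in> borel_measurable lebesgue" for k
    by (intro borel_measurable_abs borel_measurable_diff finite_simple_measurable
        approximatesD(1)[OF s] L_inf_minus_measurable[OF f])
  \<comment> \<open>The constant is 3 = 2 + 1, from the majorant of s and from f itself.\<close>
  have le: "\<bar>\<bar>s k t - f t\<bar>\<bar> \<le> \<bar>3 * \<bar>f t\<bar>\<bar>" for k t
    using approximatesD(3)[OF s, of k t] by simp
  have lim: "AE t in lebesgue. (\<lambda>k. \<bar>s k t - f t\<bar>) \<longlonglongrightarrow> 0"
    using approximatesD(4)[OF s]
    by eventually_elim (rule tendsto_rabs_zero, simp add: LIM_zero_iff)
  show "(\<lambda>k. \<integral>t. \<bar>s k t - f t\<bar> ^ m \<partial>lebesgue) \<longlonglongrightarrow> 0"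
    using L_inf_minus_convergence[OF L_inf_minus_scale[OF f, of 3] m meas _ le lim] m
    by (simp add: power_0_left)
  show "integrable lebesgue (\<lambda>t. \<bar>s k t - f t\<bar> ^ m)"
    by (rule L_inf_minus_dominated(2)[OF L_inf_minus_scale[OF f, of 3] meas le m])
qed

lemma approximates_Cauchy:
  assumes s: "approximates s f" and f: "f \<in> L_inf_minus" and m: "1 \<le> m"
  shows "((\<lambda>(k, l). \<integral>t. (s k t - s l t) ^ m \<partial>lebesgue) \<longlongrightarrow> 0) (sequentially \<times>\<^sub>F sequentially)"
proof -
  define a where "a k = (\<integral>t. \<bar>s k t - f t\<bar> ^ m \<partial>lebesgue)" for k
  have a: "a \<longlonglongrightarrow> 0" unfolding a_def by (rule approximates_integral_abs_diff[OF s f m])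
  have le: "\<bar>\<integral>t. (s k t - s l t) ^ m \<partial>lebesgue\<bar> \<le> 2 ^ m * (a k + a l)" for k l
  proof -
    \<comment> \<open>Both functions are compared with f, at the cost of the factor 2^m.\<close>
    have "\<bar>(s k t - s l t) ^ m\<bar> \<le> 2 ^ m * (\<bar>s k t - f t\<bar> ^ m + \<bar>s l t - f t\<bar> ^ m)" for t
      unfolding power_abs by (rule order_trans[OF power_mono power_add_le_two_power]) simp_all
    then have "\<bar>\<integral>t. (s k t - s l t) ^ m \<partial>lebesgue\<bar> \<le>
        (\<integral>t. 2 ^ m * (\<bar>s k t - f t\<bar> ^ m + \<bar>s l t - f t\<bar> ^ m) \<partial>lebesgue)"
      using approximates_integral_abs_diff(2)[OF s f m]
      by (intro integral_abs_bound[THEN order_trans] integral_mono')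
        (auto intro!: Bochner_Integration.integrable_add integrable_mult_right)
    also have "\<dots> = 2 ^ m * (a k + a l)"
      unfolding a_def using approximates_integral_abs_diff(2)[OF s f m] by simp
    finally show ?thesis .
  qed
  have "((\<lambda>z. 2 ^ m * (a (fst z) + a (snd z))) \<longlongrightarrow> 2 ^ m * (0 + 0)) (sequentially \<times>\<^sub>F sequentially)"
    by (intro tendsto_intros filterlim_compose[OF a filterlim_fst] filterlim_compose[OF a filterlim_snd])
  then have "((\<lambda>z. 2 ^ m * (a (fst z) + a (snd z))) \<longlongrightarrow> 0) (sequentially \<times>\<^sub>F sequentially)"
    by simp
  moreover have "\<forall>\<^sub>F z in sequentially \<times>\<^sub>F sequentially.
      norm ((\<lambda>(k, l). \<integral>t. (s k t - s l t) ^ m \<partial>lebesgue) z) \<le> 2 ^ m * (a (fst z) + a (snd z))"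
  proof (rule always_eventually, rule allI)
    fix z :: "nat \<times> nat"
    show "norm ((\<lambda>(k, l). \<integral>t. (s k t - s l t) ^ m \<partial>lebesgue) z) \<le> 2 ^ m * (a (fst z) + a (snd z))"
      using le[of "fst z" "snd z"] by (simp only: case_prod_beta real_norm_def)
  qed
  ultimately show ?thesis by (rule Lim_null_comparison[rotated])
qed

section \<open>The free Poisson integral\<close>

text \<open>Cauchy-Schwarz against the indicator of S. It bounds the first cumulant by the L^2 norm,
  so that L^2 convergence alone controls the integral on sets of finite measure.\<close>

lemma square_integral_le:
  fixes g :: "real \<Rightarrow> real"
  assumes g: "integrable lebesgue g" "integrable lebesgue (\<lambda>t. g t ^ 2)"
    and S: "S \<in> sets lebesgue" "emeasure lebesgue S < \<infinity>" and zero: "\<And>t. t \<notin> S \<Longrightarrow> g t = 0"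
  shows "(\<integral>t. g t \<partial>lebesgue)\<^sup>2 \<le> measure lebesgue S * (\<integral>t. g t ^ 2 \<partial>lebesgue)"
proof -
  define A I V where "A = (\<integral>t. g t ^ 2 \<partial>lebesgue)" and "I = (\<integral>t. g t \<partial>lebesgue)"
    and "V = measure lebesgue S"
  have *: "0 \<le> A - 2 * m * I + m\<^sup>2 * V" for m
  proof -
    have iS: "integrable lebesgue (indicator S :: real \<Rightarrow> real)"
      using S by (intro integrable_real_indicator)
    have "(g t - m * indicator S t)\<^sup>2 = g t ^ 2 - 2 * m * g t + m\<^sup>2 * indicator S t" for t
      using zero[of t] by (auto simp: indicator_def power2_eq_square algebra_simps)
    then have "(\<integral>t. (g t - m * indicator S t)\<^sup>2 \<partial>lebesgue)
        = (\<integral>t. g t ^ 2 - 2 * m * g t + m\<^sup>2 * indicator S t \<partial>lebesgue)"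
      by (simp only:)
    also have "\<dots> = (\<integral>t. g t ^ 2 - 2 * m * g t \<partial>lebesgue) + (\<integral>t. m\<^sup>2 * indicator S t \<partial>lebesgue)"
      using g iS by (intro Bochner_Integration.integral_add Bochner_Integration.integrable_diff
          integrable_mult_right)
    also have "(\<integral>t. g t ^ 2 - 2 * m * g t \<partial>lebesgue) = A - (\<integral>t. 2 * m * g t \<partial>lebesgue)"
      unfolding A_def using g by (intro Bochner_Integration.integral_diff integrable_mult_right)
    also have "(\<integral>t. 2 * m * g t \<partial>lebesgue) = 2 * m * I" by (simp add: I_def)
    also have "(\<integral>t. m\<^sup>2 * indicator S t \<partial>lebesgue) = m\<^sup>2 * V" by (simp add: V_def)
    finally have "(\<integral>t. (g t - m * indicator S t)\<^sup>2 \<partial>lebesgue) = A - 2 * m * I + m\<^sup>2 * V" .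
    moreover have "0 \<le> (\<integral>t. (g t - m * indicator S t)\<^sup>2 \<partial>lebesgue)"
      by (rule integral_nonneg_AE) simp
    ultimately show ?thesis by simp
  qed
  have "I\<^sup>2 \<le> V * A"
  proof (cases "V = 0")
    case True
    have "I = 0"
    proof (rule ccontr)
      assume "I \<noteq> 0"
      then show False using *[of "(A + 1) / (2 * I)"] True by simp
    qed
    then show ?thesis by (simp add: True)
  next
    case False
    then have "0 < V" by (simp add: V_def zero_less_measure_iff)
    with *[of "I / V"] show ?thesis by (simp add: field_simps power2_eq_square)
  qed
  then show ?thesis by (simp add: A_def I_def V_def)
qed

context wstar_probability_space
begin

lemma nc_Cauchy_const: "a \<in> M \<Longrightarrow> nc_Cauchy M \<phi> 2 (\<lambda>_. a)"
  by (simp add: nc_Cauchy_def nc_norm_zero)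

text \<open>Uniqueness for both descriptions of the integral. The filter is arbitrary, as one limit
  is taken along a sequence and the other for real t tending to infinity.\<close>

lemma nc_class_eq_if_common_limit:
  assumes u: "nc_Cauchy M \<phi> 2 u" and v: "nc_Cauchy M \<phi> 2 v" and w: "\<And>t. nc_Cauchy M \<phi> 2 (w t)"
    and lim_u: "((\<lambda>t. nc_dist M \<phi> 2 (nc_class M \<phi> (w t)) (nc_class M \<phi> u)) \<longlongrightarrow> 0) F"
    and lim_v: "((\<lambda>t. nc_dist M \<phi> 2 (nc_class M \<phi> (w t)) (nc_class M \<phi> v)) \<longlongrightarrow> 0) F"
    and F: "F \<noteq> bot"
  shows "nc_class M \<phi> u = nc_class M \<phi> v"
proof -
  have conv: "(\<lambda>k. nc_norm \<phi> 2 (a k - b k)) \<longlonglongrightarrow> nc_dist M \<phi> 2 (nc_class M \<phi> a) (nc_class M \<phi> b)"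
    if "nc_Cauchy M \<phi> 2 a" "nc_Cauchy M \<phi> 2 b" for a b
    using nc_norm_2_diff_convergent[OF that] nc_dist_eqI[OF that] unfolding convergent_def by metis
  let ?d = "\<lambda>a b. nc_dist M \<phi> 2 (nc_class M \<phi> a) (nc_class M \<phi> b)"
  have tri: "?d u v \<le> ?d (w t) u + ?d (w t) v" for t
  proof (rule LIMSEQ_le[OF conv[OF u v] tendsto_add[OF conv[OF w u] conv[OF w v]]])
    show "\<exists>N. \<forall>k\<ge>N. nc_norm \<phi> 2 (u k - v k)
        \<le> nc_norm \<phi> 2 (w t k - u k) + nc_norm \<phi> 2 (w t k - v k)"
    proof (intro exI allI impI)
      fix k
      note M = nc_CauchyD[OF u, of k] nc_CauchyD[OF v, of k] nc_CauchyD[OF w, of t k]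
      show "nc_norm \<phi> 2 (u k - v k) \<le> nc_norm \<phi> 2 (w t k - u k) + nc_norm \<phi> 2 (w t k - v k)"
        using nc_norm_2_triangle[of "u k - w t k" "w t k - v k"]
          nc_norm_minus_commute[OF M(1,3), of 2] M by (simp add: M_intros)
    qed
  qed
  have "((\<lambda>t. ?d (w t) u + ?d (w t) v) \<longlongrightarrow> 0) F"
    using tendsto_add[OF lim_u lim_v] by simp
  then have "?d u v \<le> 0"
    by (rule tendsto_lowerbound[OF _ _ F]) (intro always_eventually allI tri)
  moreover have "0 \<le> ?d u v"
    by (rule LIMSEQ_le_const[OF conv[OF u v]])
      (auto intro!: nc_norm_nonneg M_intros nc_CauchyD[OF u] nc_CauchyD[OF v])
  ultimately have null: "(\<lambda>k. nc_norm \<phi> 2 (u k - v k)) \<longlonglongrightarrow> 0" using conv[OF u v] by simp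
  show ?thesis
  proof (rule nc_class_eqI[OF nc_Cauchy_2_imp_1[OF u] nc_Cauchy_2_imp_1[OF v]])
    show "(\<lambda>k. nc_norm \<phi> 1 (u k - v k)) \<longlonglongrightarrow> 0"
    proof (rule Lim_null_comparison[OF _ null], intro always_eventually allI)
      fix k
      have "u k - v k \<in> M" by (intro M_intros nc_CauchyD[OF u] nc_CauchyD[OF v])
      from nc_norm_1_le_2[OF this] nc_norm_nonneg[OF this, of 1]
      show "norm (nc_norm \<phi> 1 (u k - v k)) \<le> nc_norm \<phi> 2 (u k - v k)" by simp
    qed
  qed
qed

end

context free_poisson_random_measure
begin

abbreviation integral_class :: "(nat \<Rightarrow> real \<Rightarrow> real) \<Rightarrow> 'h nc_elem" where
  "integral_class s \<equiv> nc_class M \<phi> (\<lambda>k. integral_simple X (s k))"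

lemma nc_Cauchy_integral_simple:
  assumes s: "approximates s f" and f: "f \<in> L_inf_minus" and p: "1 \<le> p"
  shows "nc_Cauchy M \<phi> p (\<lambda>k. integral_simple X (s k))"
proof (rule nc_Cauchy_selfadjointI[OF _ _ p])
  note S = approximatesD(1)[OF s]
  show "integral_simple X (s k) \<in> M" "adj (integral_simple X (s k)) = integral_simple X (s k)" for k
    by (intro integral_simple_selfadjoint S)+
  have "((\<lambda>z. nc_moments (\<lambda>m. case z of (k, l) \<Rightarrow> \<integral>t. (s k t - s l t) ^ m \<partial>lebesgue) (2 * p))
      \<longlongrightarrow> nc_moments (\<lambda>_. 0) (2 * p)) (sequentially \<times>\<^sub>F sequentially)"
    by (intro tendsto_nc_moments approximates_Cauchy[OF s f])
  moreover have "nc_moments (\<lambda>_. 0) (2 * p) = (0::real)"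
    using p by (intro nc_moments_zero) auto
  moreover have "Re (\<phi> (op_pow (integral_simple X (s k) - integral_simple X (s l)) (2 * p)))
      = nc_moments (\<lambda>m. \<integral>t. (s k t - s l t) ^ m \<partial>lebesgue) (2 * p)" for k l
    using phi_integral_simple_pow[OF finite_simple_diff[OF S[of k] S[of l]], of "2 * p"]
    by (simp add: integral_simple_diff S)
  ultimately show "((\<lambda>(k, l). Re (\<phi> (op_pow (integral_simple X (s k) - integral_simple X (s l)) (2 * p))))
      \<longlongrightarrow> 0) (sequentially \<times>\<^sub>F sequentially)"
    by (simp add: case_prod_unfold)
qed

text \<open>Only simple functions with a common majorant for the differences are assumed, so
  constant sequences, i.e. embedded elements, are covered as well.\<close>

lemma nc_dist_integral_class:
  assumes s: "\<And>k. finite_simple (s k)" "nc_Cauchy M \<phi> 2 (\<lambda>k. integral_simple X (s k))"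
    and r: "\<And>k. finite_simple (r k)" "nc_Cauchy M \<phi> 2 (\<lambda>k. integral_simple X (r k))"
    and w: "w \<in> L_inf_minus" "\<And>k t. \<bar>s k t - r k t\<bar> \<le> \<bar>w t\<bar>"
    and g: "g \<in> borel_measurable lebesgue" "AE t in lebesgue. (\<lambda>k. s k t - r k t) \<longlonglongrightarrow> g t"
  shows "nc_dist M \<phi> 2 (integral_class s) (integral_class r) = moment_norm g"
proof (rule nc_dist_eqI[OF s(2) r(2)])
  have meas: "(\<lambda>t. s k t - r k t) \<in> borel_measurable lebesgue" for k
    by (intro borel_measurable_diff finite_simple_measurable s r)
  have lim: "(\<lambda>k. \<integral>t. (s k t - r k t) ^ m \<partial>lebesgue) \<longlonglongrightarrow> (\<integral>t. g t ^ m \<partial>lebesgue)"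
    if "1 \<le> m" for m
    by (rule L_inf_minus_convergence[OF w(1) that meas g(1) w(2) g(2)])
  show "(\<lambda>k. nc_norm \<phi> 2 (integral_simple X (s k) - integral_simple X (r k))) \<longlonglongrightarrow> moment_norm g"
    unfolding nc_norm_integral_simple_diff[OF s(1) r(1)] moment_norm_def
    by (intro tendsto_real_sqrt tendsto_add tendsto_power lim) simp_all
qed

lemma integral_class_Lp:
  assumes "approximates s f" and "f \<in> L_inf_minus" and "1 \<le> p"
  shows "integral_class s \<in> nc_Lp M \<phi> p"
  using nc_Cauchy_integral_simple[OF assms] unfolding nc_Lp_def by blast

lemma L_norm_2: "L_norm 2 g = sqrt (\<integral>t. g t ^ 2 \<partial>lebesgue)"
  by (simp add: L_norm_def sqrt_def)

text \<open>The distance of the class of s to X(r n) is the \<open>moment_norm\<close> of r n - f;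
  on a support of finite measure the L^2 norm controls both of its terms.\<close>

lemma integral_finite_support_eq:
  assumes s: "approximates s f" and f: "f \<in> L_inf_minus"
    and fin: "emeasure lebesgue {t. f t \<noteq> 0} < \<infinity>"
  shows "integral_finite_support M \<phi> X f = integral_class s"
proof -
  define S where "S = {t. f t \<noteq> 0}"
  have Smeas: "S \<in> sets lebesgue"
    using measurable_sets[OF L_inf_minus_measurable[OF f], of "- {0}"]
    by (simp add: S_def vimage_def Compl_eq)
  note cs = nc_Cauchy_integral_simple[OF s f]
  define admissible where "admissible r \<longleftrightarrow> (\<forall>n. simple_function lborel (r n) \<and>
      emeasure lborel {t. r n t \<noteq> 0} < \<infinity> \<and> {t. r n t \<noteq> 0} \<subseteq> {t. f t \<noteq> 0})"
    for r :: "nat \<Rightarrow> real \<Rightarrow> real"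
  have lim: "(\<lambda>n. nc_dist M \<phi> 2 (nc_embed M \<phi> (integral_simple X (r n))) (integral_class s)) \<longlonglongrightarrow> 0"
    if r: "admissible r" and r0: "(\<lambda>n. L_norm 2 (\<lambda>t. r n t - f t)) \<longlonglongrightarrow> 0" for r
  proof -
    have R: "finite_simple (r n)" "t \<notin> S \<Longrightarrow> r n t = 0" for n t
      using r unfolding admissible_def by (auto simp: finite_simple_def S_def)
    have dist: "nc_dist M \<phi> 2 (nc_embed M \<phi> (integral_simple X (r n))) (integral_class s)
        = moment_norm (\<lambda>t. r n t - f t)" for n
      unfolding nc_embed_def
    proof (rule nc_dist_integral_class)
      show "nc_Cauchy M \<phi> 2 (\<lambda>k. integral_simple X (r n))"
        by (intro nc_Cauchy_const integral_simple_selfadjoint R)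
      show "(\<lambda>t. 1 * \<bar>r n t\<bar> + 2 * \<bar>f t\<bar>) \<in> L_inf_minus"
        by (intro L_inf_minus_add L_inf_minus_scale f finite_simple_L_inf_minus R)
      show "\<bar>r n t - s k t\<bar> \<le> \<bar>1 * \<bar>r n t\<bar> + 2 * \<bar>f t\<bar>\<bar>" for k t
        using approximatesD(3)[OF s, of k t] by simp
      show "AE t in lebesgue. (\<lambda>k. r n t - s k t) \<longlonglongrightarrow> r n t - f t"
        using approximatesD(4)[OF s] by eventually_elim (intro tendsto_diff tendsto_const)
      show "(\<lambda>t. r n t - f t) \<in> borel_measurable lebesgue"
        by (intro borel_measurable_diff finite_simple_measurable R L_inf_minus_measurable f)
    qed (use R approximatesD(1)[OF s] cs in simp_all)
    define A where "A n = (\<integral>t. (r n t - f t) ^ 2 \<partial>lebesgue)" for n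
    have A0: "0 \<le> A n" for n by (simp add: A_def)
    have "(\<lambda>n. sqrt (A n) ^ 2) \<longlonglongrightarrow> 0 ^ 2"
      using r0 unfolding L_norm_2 A_def by (intro tendsto_power)
    then have A: "A \<longlonglongrightarrow> 0" using A0 by simp
    have "norm (moment_norm (\<lambda>t. r n t - f t)) \<le> sqrt (A n + measure lebesgue S * A n)" for n
    proof -
      have int: "integrable lebesgue (\<lambda>t. (r n t - f t) ^ m)" if "1 \<le> m" for m
      proof (rule L_inf_minus_dominated(2)[OF _ _ _ that])
        show "(\<lambda>t. 1 * \<bar>r n t\<bar> + 1 * \<bar>f t\<bar>) \<in> L_inf_minus"
          by (intro L_inf_minus_add L_inf_minus_scale f finite_simple_L_inf_minus R)
        show "(\<lambda>t. r n t - f t) \<in> borel_measurable lebesgue"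
          by (intro borel_measurable_diff finite_simple_measurable R L_inf_minus_measurable f)
      qed simp
      have "(\<integral>t. r n t - f t \<partial>lebesgue)\<^sup>2 \<le> measure lebesgue S * A n"
        unfolding A_def
      proof (rule square_integral_le)
        show "integrable lebesgue (\<lambda>t. r n t - f t)" using int[of 1] by simp
        show "emeasure lebesgue S < \<infinity>" using fin by (simp only: S_def)
        show "r n t - f t = 0" if "t \<notin> S" for t using R(2)[OF that] that by (simp add: S_def)
      qed (use int Smeas in auto)
      then have "moment_norm (\<lambda>t. r n t - f t) \<le> sqrt (A n + measure lebesgue S * A n)"
        unfolding moment_norm_def A_def[symmetric] by simp
      moreover have "0 \<le> moment_norm (\<lambda>t. r n t - f t)" by (simp add: moment_norm_def)
      ultimately show ?thesis by simp
    qed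
    note bound = this
    have "(\<lambda>n. sqrt (A n + measure lebesgue S * A n)) \<longlonglongrightarrow> sqrt (0 + measure lebesgue S * 0)"
      by (intro tendsto_intros A)
    then have "(\<lambda>n. sqrt (A n + measure lebesgue S * A n)) \<longlonglongrightarrow> 0" by simp
    then have "(\<lambda>n. moment_norm (\<lambda>t. r n t - f t)) \<longlonglongrightarrow> 0"
      by (rule Lim_null_comparison[OF always_eventually[OF allI[OF bound]]])
    then show ?thesis by (simp add: dist)
  qed
  \<comment> \<open>The sequence s competes in the description itself, so any other solution is a
    limit of the same elements and coincides with its class.\<close>
  have s_adm: "admissible s"
    using approximatesD(1,2)[OF s] by (simp add: admissible_def finite_simple_def)
  have "(\<lambda>n. sqrt (\<integral>t. \<bar>s n t - f t\<bar> ^ 2 \<partial>lebesgue)) \<longlonglongrightarrow> sqrt 0"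
    by (intro tendsto_real_sqrt approximates_integral_abs_diff(1)[OF s f]) simp
  then have s0: "(\<lambda>n. L_norm 2 (\<lambda>t. s n t - f t)) \<longlonglongrightarrow> 0"
    by (simp add: L_norm_2)
  show ?thesis
    unfolding integral_finite_support_def admissible_def[symmetric]
  proof (rule the_equality)
    show "integral_class s \<in> nc_Lp M \<phi> 2 \<and> (\<forall>r. admissible r \<longrightarrow>
        (\<lambda>n. L_norm 2 (\<lambda>t. r n t - f t)) \<longlonglongrightarrow> 0 \<longrightarrow>
        (\<lambda>n. nc_dist M \<phi> 2 (nc_embed M \<phi> (integral_simple X (r n))) (integral_class s)) \<longlonglongrightarrow> 0)"
      using integral_class_Lp[OF s f] lim by auto
    fix y assume y: "y \<in> nc_Lp M \<phi> 2 \<and> (\<forall>r. admissible r \<longrightarrow>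
        (\<lambda>n. L_norm 2 (\<lambda>t. r n t - f t)) \<longlonglongrightarrow> 0 \<longrightarrow>
        (\<lambda>n. nc_dist M \<phi> 2 (nc_embed M \<phi> (integral_simple X (r n))) y) \<longlonglongrightarrow> 0)"
    then obtain v where v: "y = nc_class M \<phi> v" "nc_Cauchy M \<phi> 2 v"
      by (auto simp: nc_Lp_def)
    have "nc_class M \<phi> v = integral_class s"
    proof (rule nc_class_eq_if_common_limit[OF v(2) cs])
      show "nc_Cauchy M \<phi> 2 (\<lambda>_. integral_simple X (s n))" for n
        by (intro nc_Cauchy_const integral_simple_selfadjoint approximatesD(1)[OF s])
      show "(\<lambda>n. nc_dist M \<phi> 2 (nc_class M \<phi> (\<lambda>_. integral_simple X (s n))) (nc_class M \<phi> v)) \<longlonglongrightarrow> 0"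
        using y s_adm s0 unfolding v(1) nc_embed_def by blast
      show "(\<lambda>n. nc_dist M \<phi> 2 (nc_class M \<phi> (\<lambda>_. integral_simple X (s n))) (integral_class s)) \<longlonglongrightarrow> 0"
        using lim[OF s_adm s0] by (simp only: nc_embed_def)
    qed simp_all
    then show "y = integral_class s" by (simp only: v(1))
  qed
qed

text \<open>Each truncation has its own approximating sequence, and its distance to the class of s
  is the \<open>moment_norm\<close> of g t - f. Integrability of |f| and |f|^2 makes both terms
  vanish as t grows.\<close>

lemma free_poisson_integral_eq:
  assumes s: "approximates s f" and f: "f \<in> L_inf_minus"
  shows "free_poisson_integral M \<phi> X f = integral_class s"
proof -
  define g where "g t y = f y * indicator {- t..t} y" for t y :: real
  have le: "\<bar>g t y\<bar> \<le> \<bar>f y\<bar>" for t y by (simp add: g_def indicator_def)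
  have gmeas: "g t \<in> borel_measurable lebesgue" for t
    unfolding g_def
    by (intro borel_measurable_times borel_measurable_indicator L_inf_minus_measurable[OF f]) simp
  have g: "g t \<in> L_inf_minus" for t
    by (rule L_inf_minus_dominated(1)[OF f gmeas le])
  obtain r where r: "\<And>t. approximates (r t) (g t)"
    using approximates_exists[OF gmeas] by metis
  note cs = nc_Cauchy_integral_simple[OF s f] and cr = nc_Cauchy_integral_simple[OF r g]
  have fin_support: "integral_finite_support M \<phi> X (g t) = integral_class (r t)" for t
  proof (rule integral_finite_support_eq[OF r g])
    have "emeasure lebesgue {y. g t y \<noteq> 0} \<le> emeasure lebesgue {- t..t}"
      by (intro emeasure_mono) (auto simp: g_def indicator_def)
    also have "\<dots> < \<infinity>" by (simp add: emeasure_lborel_Icc_eq)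
    finally show "emeasure lebesgue {y. g t y \<noteq> 0} < \<infinity>" .
  qed
  have dist: "nc_dist M \<phi> 2 (integral_class (r t)) (integral_class s) = moment_norm (\<lambda>y. g t y - f y)" for t
  proof (rule nc_dist_integral_class)
    show "(\<lambda>y. 4 * \<bar>f y\<bar>) \<in> L_inf_minus" by (rule L_inf_minus_scale[OF f])
    show "\<bar>r t k y - s k y\<bar> \<le> \<bar>4 * \<bar>f y\<bar>\<bar>" for k y
      using approximatesD(3)[OF s, of k y] approximatesD(3)[OF r, of t k y] le[of t y] by simp
    show "(\<lambda>y. g t y - f y) \<in> borel_measurable lebesgue"
      by (intro borel_measurable_diff gmeas L_inf_minus_measurable f)
    show "AE y in lebesgue. (\<lambda>k. r t k y - s k y) \<longlonglongrightarrow> g t y - f y"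
      using approximatesD(4)[OF s] approximatesD(4)[OF r] by eventually_elim (intro tendsto_diff)
  qed (use approximatesD(1)[OF s] approximatesD(1)[OF r] cs cr in simp_all)
  have lim_int: "((\<lambda>t. \<integral>y. (g t y - f y) ^ m \<partial>lebesgue) \<longlongrightarrow> 0) at_top" if m: "1 \<le> m" for m
  proof -
    have "((\<lambda>t. \<integral>y. (g t y - f y) ^ m \<partial>lebesgue) \<longlongrightarrow> integral\<^sup>L lebesgue (\<lambda>_::real. 0)) at_top"
    proof (rule integral_dominated_convergence_at_top[where s = "\<lambda>t y. (g t y - f y) ^ m"
          and f = "\<lambda>_. 0" and w = "\<lambda>y. \<bar>f y\<bar> ^ m"])
      show "(\<lambda>y. (g t y - f y) ^ m) \<in> borel_measurable lebesgue" for t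
        by (intro borel_measurable_power borel_measurable_diff gmeas L_inf_minus_measurable f)
      show "integrable lebesgue (\<lambda>y. \<bar>f y\<bar> ^ m)" using f m unfolding L_inf_minus_iff by blast
      show "AE y in lebesgue. ((\<lambda>t. (g t y - f y) ^ m) \<longlongrightarrow> 0) at_top"
      proof (rule AE_I2)
        \<comment> \<open>Once t reaches |y|, the truncation changes nothing at y.\<close>
        fix y :: real
        have "\<forall>\<^sub>F t in at_top. (g t y - f y) ^ m = 0"
          using eventually_ge_at_top[of "\<bar>y\<bar>"]
          by eventually_elim (use m in \<open>auto simp: g_def indicator_def abs_le_iff\<close>)
        then show "((\<lambda>t. (g t y - f y) ^ m) \<longlongrightarrow> 0) at_top" by (rule tendsto_eventually)
      qed
      show "\<forall>\<^sub>F t in at_top. AE y in lebesgue. norm ((g t y - f y) ^ m) \<le> \<bar>f y\<bar> ^ m"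
        by (intro always_eventually allI AE_I2)
          (auto simp: g_def indicator_def power_abs intro!: power_mono)
    qed simp
    then show ?thesis by simp
  qed
  have "((\<lambda>t. moment_norm (\<lambda>y. g t y - f y)) \<longlongrightarrow> sqrt (0 + 0\<^sup>2)) at_top"
    unfolding moment_norm_def by (intro tendsto_real_sqrt tendsto_add tendsto_power lim_int) simp_all
  then have lim: "((\<lambda>t. nc_dist M \<phi> 2 (integral_class (r t)) (integral_class s)) \<longlongrightarrow> 0) at_top"
    by (simp add: dist)
  show ?thesis
    unfolding free_poisson_integral_def g_def[symmetric] fin_support
  proof (rule the_equality)
    show "integral_class s \<in> nc_Lp M \<phi> 2 \<and>
        ((\<lambda>t. nc_dist M \<phi> 2 (integral_class (r t)) (integral_class s)) \<longlongrightarrow> 0) at_top"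
      using integral_class_Lp[OF s f] lim by simp
    fix y assume y: "y \<in> nc_Lp M \<phi> 2 \<and>
        ((\<lambda>t. nc_dist M \<phi> 2 (integral_class (r t)) y) \<longlongrightarrow> 0) at_top"
    then obtain v where v: "y = nc_class M \<phi> v" "nc_Cauchy M \<phi> 2 v"
      by (auto simp: nc_Lp_def)
    have "nc_class M \<phi> v = integral_class s"
      by (rule nc_class_eq_if_common_limit[OF v(2) cs cr _ lim]) (use y v(1) in simp_all)
    then show "y = integral_class s" by (simp only: v(1))
  qed
qed

lemma nc_cumulant_integral_class:
  assumes s: "approximates s f" and f: "f \<in> L_inf_minus" and "1 \<le> m"
  shows "nc_cumulant M \<phi> (integral_class s) m = complex_of_real (\<integral>t. f t ^ m \<partial>lebesgue)"
  unfolding nc_cumulant_def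
proof (rule free_cumulants_eqI[OF _ assms(3)])
  fix n
  have "(\<lambda>k. complex_of_real (nc_moments (\<lambda>m. \<integral>t. s k t ^ m \<partial>lebesgue) n))
      \<longlonglongrightarrow> complex_of_real (nc_moments (\<lambda>m. \<integral>t. f t ^ m \<partial>lebesgue) n)"
    by (intro tendsto_of_real tendsto_nc_moments approximates_integral[OF s f])
  then have "nc_moment M \<phi> (integral_class s) n = complex_of_real (nc_moments (\<lambda>m. \<integral>t. f t ^ m \<partial>lebesgue) n)"
    by (intro nc_moment_eqI nc_Cauchy_integral_simple[OF s f])
      (simp_all add: phi_integral_simple_pow approximatesD(1)[OF s])
  then show "nc_moment M \<phi> (integral_class s) n
      = nc_moments (\<lambda>m. complex_of_real (\<integral>t. f t ^ m \<partial>lebesgue)) n"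
    by (simp only: nc_moments_of_real)
qed

end

text \<open>
  The jump distribution is the distribution of \<open>f\<close> under the normalised Lebesgue measure on the
  support of \<open>f\<close>.
\<close>

lemma jump_distribution_exists:
  fixes f :: "real \<Rightarrow> real"
  assumes f: "f \<in> borel_measurable lebesgue" and fin: "emeasure lebesgue {t. f t \<noteq> 0} < \<infinity>"
    and bounded: "AE t in lebesgue. \<bar>f t\<bar> \<le> C"
  shows "\<exists>r (\<nu> :: real measure). 0 \<le> r \<and> prob_space \<nu> \<and> sets \<nu> = sets borel \<and>
     (\<exists>K. compact K \<and> emeasure \<nu> (- K) = 0) \<and>
     (\<forall>n\<ge>1. r * (\<integral>t. t ^ n \<partial>\<nu>) = (\<integral>t. f t ^ n \<partial>lebesgue))"
proof -
  define S where "S = {t. f t \<noteq> 0}"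
  have S: "S \<in> sets lebesgue" "emeasure lebesgue S < \<infinity>"
    using measurable_sets[OF f, of "- {0}"] fin by (simp_all add: S_def vimage_def Compl_eq)
  define r where "r = measure lebesgue S"
  have r: "emeasure lebesgue S = ennreal r"
    using S(2) by (simp add: r_def emeasure_eq_ennreal_measure less_top)
  show ?thesis
  proof (cases "r = 0")
    \<comment> \<open>All moments of f vanish, so rate 0 with a point mass as jump distribution will
      do; normalisation is impossible here.\<close>
    case True
    then have "emeasure lebesgue S = 0" using r by simp
    then have "AE t in lebesgue. f t = 0"
      using S(1) by (intro AE_I[of _ _ S]) (auto simp: S_def)
    then have "AE t in lebesgue. f t ^ n = 0" if "1 \<le> n" for n
      by eventually_elim (use that in simp)
    then have "(\<integral>t. f t ^ n \<partial>lebesgue) = 0" if "1 \<le> n" for n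
      using that by (intro integral_eq_zero_AE)
    then show ?thesis
      by (intro exI[of _ 0] exI[of _ "return borel 0"] conjI exI[of _ "{0}"])
        (auto simp: prob_space_return)
  next
    case False
    then have "0 < r" by (simp add: r_def zero_less_measure_iff)
    define P where "P = uniform_measure lebesgue S"
    define \<nu> where "\<nu> = distr P borel f"
    have P: "prob_space P"
      unfolding P_def using r S(2) \<open>0 < r\<close> by (intro prob_space_uniform_measure) auto
    have fP: "f \<in> measurable P borel" using f by (simp add: P_def uniform_measure_def)
    have P_density: "P = density lebesgue (\<lambda>t. ennreal (indicator S t / r))"
    proof -
      have "indicator S t / ennreal r = ennreal (indicator S t / r)" for t
        using divide_ennreal[of 1 r] \<open>0 < r\<close> by (simp add: indicator_def)
      then show ?thesis unfolding P_def uniform_measure_def r by simp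
    qed
    have "r * (\<integral>t. t ^ n \<partial>\<nu>) = (\<integral>t. f t ^ n \<partial>lebesgue)" if n: "1 \<le> n" for n
    proof -
      have "(\<integral>t. t ^ n \<partial>\<nu>) = (\<integral>t. f t ^ n \<partial>P)"
        unfolding \<nu>_def by (rule integral_distr[OF fP]) simp
      also have "\<dots> = (\<integral>t. (indicator S t / r) *\<^sub>R f t ^ n \<partial>lebesgue)"
        unfolding P_density using S(1) \<open>0 < r\<close> f
        by (intro integral_density borel_measurable_power borel_measurable_divide
            borel_measurable_indicator borel_measurable_const) auto
      \<comment> \<open>The indicator is absorbed because f^n vanishes off S for positive n.\<close>
      also have "\<dots> = (\<integral>t. f t ^ n / r \<partial>lebesgue)"
        using n by (intro Bochner_Integration.integral_cong) (auto simp: S_def indicator_def)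
      also have "\<dots> = (\<integral>t. f t ^ n \<partial>lebesgue) / r" by simp
      finally show ?thesis using \<open>0 < r\<close> by simp
    qed
    moreover have "emeasure \<nu> (- {- C..C}) = 0"
    proof -
      have "AE t in lebesgue. t \<in> S \<longrightarrow> \<bar>f t\<bar> \<le> C" using bounded by eventually_elim simp
      then have "AE t in P. \<bar>f t\<bar> \<le> C"
        unfolding P_def using S(1) by (intro AE_uniform_measureI)
      then have "AE t in P. t \<notin> f -` (- {- C..C}) \<inter> space P" by eventually_elim auto
      moreover have "f -` (- {- C..C}) \<inter> space P \<in> sets P" by (rule measurable_sets[OF fP]) simp
      ultimately have "emeasure P (f -` (- {- C..C}) \<inter> space P) = 0"
        using AE_iff_null_sets null_setsD1 by blast
      then show ?thesis unfolding \<nu>_def by (subst emeasure_distr[OF fP]) simp_all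
    qed
    moreover have "prob_space \<nu>" unfolding \<nu>_def by (rule prob_space.prob_space_distr[OF P fP])
    ultimately show ?thesis
      using \<open>0 < r\<close> by (intro exI[of _ r] exI[of _ \<nu>] conjI exI[of _ "{- C..C}"]) (auto simp: \<nu>_def)
  qed
qed

text \<open>The last clause is conditional because a compound free Poisson distribution asks for a
  finite rate and a compactly supported jump distribution: the rate is the measure of the support of
  f, and essential boundedness of f makes the jumps bounded.\<close>

theorem theorem5p9:
  fixes M :: "'h::complex_hilbert op set"
    and \<phi> :: "'h op \<Rightarrow> complex"
    and X :: "real set \<Rightarrow> 'h op"
    and f :: "real \<Rightarrow> real"
  assumes "free_poisson_random_measure M \<phi> X"
    and "f \<in> (\<Inter>n\<in>{1..}. L_space n)"
    and "\<And>E. E \<in> finite_borel_sets \<Longrightarrow> op_positive (X E)"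
  shows "free_poisson_integral M \<phi> X f \<in> (\<Inter>n\<in>{1..}. nc_Lp M \<phi> n) \<and>
    (\<forall>m\<ge>1. nc_cumulant M \<phi> (free_poisson_integral M \<phi> X f) m =
       complex_of_real (\<integral>x. f x ^ m \<partial>lebesgue)) \<and>
    (emeasure lebesgue {x. f x \<noteq> 0} < \<infinity> \<longrightarrow> (\<exists>C. AE x in lebesgue. \<bar>f x\<bar> \<le> C) \<longrightarrow>
       (\<exists>r \<nu>. has_compound_free_poisson_distribution M \<phi> (free_poisson_integral M \<phi> X f) r \<nu>))"
proof -
  interpret free_poisson_random_measure M \<phi> X by (rule assms(1))
  note f = assms(2)
  obtain s where s: "approximates s f"
    using approximates_exists[OF L_inf_minus_measurable[OF f]] by blast
  have eq: "free_poisson_integral M \<phi> X f = integral_class s"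
    by (rule free_poisson_integral_eq[OF s f])
  have Lp: "integral_class s \<in> (\<Inter>n\<in>{1..}. nc_Lp M \<phi> n)"
    using integral_class_Lp[OF s f] by auto
  note cumulant = nc_cumulant_integral_class[OF s f]
  have self: "\<exists>u\<in>integral_class s. \<forall>k. adj (u k) = u k"
  proof (rule bexI)
    show "\<forall>k. adj (integral_simple X (s k)) = integral_simple X (s k)"
      using integral_simple_selfadjoint(2)[OF approximatesD(1)[OF s]] by blast
    show "(\<lambda>k. integral_simple X (s k)) \<in> integral_class s"
      by (rule nc_class_self[OF nc_Cauchy_integral_simple[OF s f order_refl]])
  qed
  have "\<exists>r \<nu>. has_compound_free_poisson_distribution M \<phi> (integral_class s) r \<nu>"
    if "emeasure lebesgue {x. f x \<noteq> 0} < \<infinity>" "\<exists>C. AE x in lebesgue. \<bar>f x\<bar> \<le> C"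
  proof -
    obtain C where "AE x in lebesgue. \<bar>f x\<bar> \<le> C" using \<open>\<exists>C. _ C\<close> by blast
    from jump_distribution_exists[OF L_inf_minus_measurable[OF f] \<open>emeasure _ _ < _\<close> this]
    show ?thesis
      unfolding has_compound_free_poisson_distribution_def using Lp self cumulant by metis
  qed
  then show ?thesis unfolding eq using Lp cumulant by blast
qed

end
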